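(* Let $\rho=\rho_g(\mathbf{0},\mathbf{0};S)$ be an $n$-mode Gaussian state in $\Gamma(\mathbb{C}^n)$ with zero means, let $\lambda_1\ge\cdots\ge\lambda_{2n}$ be the eigenvalues of $S$, put $\alpha_j=\frac{\lambda_j-1/2}{\lambda_j+1/2}$ for $1\le j\le2n$, and suppose $\alpha_j\ge0$ for every $j$. Then the probability generating function of the total number operator $N$ in the state $\rho$ is $$G_N(x)=\prod_{j=1}^{2n}\left(\frac{1-\alpha_j}{1-\alpha_jx}\right)^{1/2},$$ so that the distribution of $N$ is a convolution of $2n$ negative binomial distributions of index $\frac12$ (some of which may be degenerate at $0$). In particular the distribution of $N$ is infinitely divisible. Moreover $$\mathrm{Variance}(N)-\langle N\rangle=\frac12\mathrm{Tr}\left(S-\tfrac12I_{2n}\right)^2\ge0.$$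
   Context: $\Gamma(\mathbb{C}^n)=\bigoplus_{r\ge0}(\mathbb{C}^n)^{\circledS r}$ is the boson (symmetric) Fock space over $\mathbb{C}^n$ (inner products are linear in the second variable). For $\mathbf{u}\in\mathbb{C}^n$ the exponential vector is $\mathbf{e}(\mathbf{u})=\bigoplus_{r\ge0}\mathbf{u}^{\otimes r}/\sqrt{r!}$. The Weyl operator $W(\mathbf{u})$ is the unitary operator on $\Gamma(\mathbb{C}^n)$ determined by $W(\mathbf{u})\mathbf{e}(\mathbf{v})=e^{-\frac12\|\mathbf{u}\|^2-\langle\mathbf{u}|\mathbf{v}\rangle}\mathbf{e}(\mathbf{u}+\mathbf{v})$ for all $\mathbf{v}\in\mathbb{C}^n$. A state is a positive operator of trace one. The $n$-mode Gaussian state $\rho_g(\mathbf{l},\mathbf{m};S)$, with $\mathbf{l},\mathbf{m}\in\mathbb{R}^n$ and $S$ a real symmetric $2n\times2n$ matrix satisfying $2S+iJ_{2n}\ge0$, $J_{2n}=\begin{bmatrix} 0 & -I_n \\ I_n & 0 \end{bmatrix}$, is the unique state $\rho$ with $$\mathrm{Tr}\,\rho W(\mathbf{x}+i\mathbf{y})=\exp\left[-i\sqrt2(\mathbf{l}^T\mathbf{x}-\mathbf{m}^T\mathbf{y})-\begin{pmatrix}\mathbf{x}\\ \mathbf{y}\end{pmatrix}^TS\begin{pmatrix}\mathbf{x}\\ \mathbf{y}\end{pmatrix}\right],\quad\mathbf{x},\mathbf{y}\in\mathbb{R}^n.$$ The total number operator $N$ acts as multiplication by $r$ on the $r$-particle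 subspace $(\mathbb{C}^n)^{\circledS r}$. Its distribution in $\rho$ is $\Pr(N=k)=\mathrm{Tr}\,\rho P_k$, with $P_k$ the projection onto the $k$-particle subspace, and $G_N(x)=\sum_{k\ge0}\Pr(N=k)x^k$, $0\le x<1$; $\langle N\rangle$ and $\mathrm{Variance}(N)$ are its mean and variance. The negative binomial distribution of index $\frac12$ with parameter $\alpha\in[0,1)$ is the distribution on $\{0,1,2,\dots\}$ with generating function $\left(\frac{1-\alpha}{1-\alpha x}\right)^{1/2}$ (degenerate at $0$ when $\alpha=0$). A probability distribution is infinitely divisible if for every $k\ge1$ it is the $k$-fold convolution of some probability distribution. *)

theory Defs
  imports "HOL-Probability.Probability"
begin

section \<open>The boson Fock space over \<open>\<complex>\<^sup>n\<close>\<close>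

text \<open>
  In the basis \<open>e\<^sub>i\<^sub>1 \<otimes> \<dots> \<otimes> e\<^sub>i\<^sub>r\<close> an element of the \<open>r\<close>-fold tensor power of \<open>\<complex>\<^sup>n\<close> is a
  function on the words of length \<open>r\<close> over the index type \<open>'n\<close>, and it is a symmetric tensor iff
  that function is invariant under permuting the letters.  An element of the Hilbert space direct sum
  over all \<open>r\<close> is thus a square summable, permutation invariant function on \<open>'n list\<close>.
\<close>

definition fock_set :: "('n list \<Rightarrow> complex) set" where
  "fock_set = {f. (\<forall>v w. mset v = mset w \<longrightarrow> f v = f w) \<and>
                  (\<lambda>w. (cmod (f w))\<^sup>2) summable_on UNIV}"

typedef 'n fock = "fock_set :: ('n list \<Rightarrow> complex) set"
  morphisms amplitude Abs_fock
  by (rule exI[of _ "\<lambda>_. 0"]) (simp add: fock_set_def)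

setup_lifting type_definition_fock

lemma fock_set_summable: "f \<in> fock_set \<Longrightarrow> (\<lambda>w. (cmod (f w))\<^sup>2) summable_on UNIV"
  unfolding fock_set_def by blast

lemma amplitude_summable: "(\<lambda>w. (cmod (amplitude f w))\<^sup>2) summable_on UNIV"
  by (rule fock_set_summable[OF amplitude])

lemma cmod_prod_le: "cmod (cnj a * b) \<le> (cmod a)\<^sup>2 + (cmod b)\<^sup>2"
proof -
  have "2 * (cmod a * cmod b) \<le> (cmod a)\<^sup>2 + (cmod b)\<^sup>2"
    using sum_squares_bound[of "cmod a" "cmod b"] by simp
  moreover have "0 \<le> cmod a * cmod b" by simp
  ultimately show ?thesis unfolding norm_mult complex_mod_cnj by linarith
qed

lemma amplitude_mult_summable:
  "(\<lambda>w. cnj (amplitude f w) * amplitude g w) summable_on UNIV"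
proof -
  have "(\<lambda>w. cmod (cnj (amplitude f w) * amplitude g w)) summable_on UNIV"
    by (rule summable_on_comparison_test[OF summable_on_add[OF amplitude_summable[of f] amplitude_summable[of g]]])
       (auto intro: cmod_prod_le)
  then show ?thesis by (rule abs_summable_summable)
qed

lemma fock_set_add:
  assumes "f \<in> fock_set" "g \<in> fock_set" shows "(\<lambda>w. f w + g w) \<in> fock_set"
proof -
  have "(cmod (a + b))\<^sup>2 \<le> 2 * ((cmod a)\<^sup>2 + (cmod b)\<^sup>2)" for a b
  proof -
    have "(cmod (a + b))\<^sup>2 \<le> (cmod a + cmod b)\<^sup>2"
      by (intro power_mono norm_triangle_ineq) simp
    also have "\<dots> \<le> 2 * ((cmod a)\<^sup>2 + (cmod b)\<^sup>2)"
      using sum_squares_bound[of "cmod a" "cmod b"] by (simp add: power2_sum)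
    finally show ?thesis .
  qed
  moreover have "(\<lambda>w. 2 * ((cmod (f w))\<^sup>2 + (cmod (g w))\<^sup>2)) summable_on UNIV"
    using assms by (intro summable_on_cmult_right summable_on_add fock_set_summable)
  ultimately have "(\<lambda>w. (cmod (f w + g w))\<^sup>2) summable_on UNIV"
    using summable_on_comparison_test[where f = "\<lambda>w. 2 * ((cmod (f w))\<^sup>2 + (cmod (g w))\<^sup>2)"
        and g = "\<lambda>w. (cmod (f w + g w))\<^sup>2" and A = UNIV] by simp
  moreover have "\<forall>v w. mset v = mset w \<longrightarrow> f v + g v = f w + g w"
  proof (intro allI impI)
    fix v w :: "'a list" assume "mset v = mset w"
    then have "f v = f w" "g v = g w" using assms unfolding fock_set_def by blast+
    then show "f v + g v = f w + g w" by simp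
  qed
  ultimately show ?thesis unfolding fock_set_def by blast
qed

lemma fock_set_scale:
  assumes "f \<in> fock_set" shows "(\<lambda>w. c * f w) \<in> fock_set"
proof -
  have "(\<lambda>w. (cmod (c * f w))\<^sup>2) summable_on UNIV"
    using fock_set_summable[OF assms] by (simp add: norm_mult power_mult_distrib summable_on_cmult_right)
  moreover have "\<forall>v w. mset v = mset w \<longrightarrow> c * f v = c * f w"
  proof (intro allI impI)
    fix v w :: "'a list" assume "mset v = mset w"
    then have "f v = f w" using assms unfolding fock_set_def by blast
    then show "c * f v = c * f w" by simp
  qed
  ultimately show ?thesis unfolding fock_set_def by blast
qed

lift_definition scaleC :: "complex \<Rightarrow> 'n fock \<Rightarrow> 'n fock"  (infixr \<open>*\<^sub>C\<close> 75)
  is "\<lambda>c f w. c * f w"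
  by (rule fock_set_scale)

definition cinner :: "'n fock \<Rightarrow> 'n fock \<Rightarrow> complex" where
  "cinner f g = (\<Sum>\<^sub>\<infinity>w. cnj (amplitude f w) * amplitude g w)"

lemma cinner_commute: "cinner f g = cnj (cinner g f)"
proof -
  have "cnj (cinner g f) = (\<Sum>\<^sub>\<infinity>w. cnj (cnj (amplitude g w) * amplitude f w))"
    unfolding cinner_def by (rule infsum_cnj[symmetric])
  also have "\<dots> = cinner f g"
    unfolding cinner_def by (intro infsum_cong) (simp add: mult.commute)
  finally show ?thesis by simp
qed

lemma cinner_add_aux:
  "(\<Sum>\<^sub>\<infinity>w. cnj (amplitude f w + amplitude g w) * amplitude h w) =
   (\<Sum>\<^sub>\<infinity>w. cnj (amplitude f w) * amplitude h w) + (\<Sum>\<^sub>\<infinity>w. cnj (amplitude g w) * amplitude h w)"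
  using infsum_add[OF amplitude_mult_summable[of f h] amplitude_mult_summable[of g h]]
  by (simp only: complex_cnj_add distrib_right)

lemma cinner_scale_aux:
  "(\<Sum>\<^sub>\<infinity>w. cnj (c * amplitude f w) * amplitude g w) =
   cnj c * (\<Sum>\<^sub>\<infinity>w. cnj (amplitude f w) * amplitude g w)"
  unfolding complex_cnj_mult mult.assoc by (rule infsum_cmult_right')

lemma cinner_self: "cinner f f = complex_of_real (\<Sum>\<^sub>\<infinity>w. (cmod (amplitude f w))\<^sup>2)"
proof -
  have "cnj z * z = complex_of_real ((cmod z)\<^sup>2)" for z
    by (metis complex_norm_square mult.commute of_real_power)
  then have "cinner f f = (\<Sum>\<^sub>\<infinity>w. complex_of_real ((cmod (amplitude f w))\<^sup>2))"
    unfolding cinner_def by simp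
  also have "\<dots> = complex_of_real (\<Sum>\<^sub>\<infinity>w. (cmod (amplitude f w))\<^sup>2)"
    by (intro infsumI has_sum_of_real has_sum_infsum amplitude_summable)
  finally show ?thesis .
qed

instantiation fock :: (type) real_inner
begin

lift_definition zero_fock :: "'a fock" is "\<lambda>_. 0"
  by (simp add: fock_set_def)

lift_definition plus_fock :: "'a fock \<Rightarrow> 'a fock \<Rightarrow> 'a fock" is "\<lambda>f g w. f w + g w"
  by (rule fock_set_add)

lift_definition uminus_fock :: "'a fock \<Rightarrow> 'a fock" is "\<lambda>f w. - f w"
  using fock_set_scale[of _ "-1"] by simp

lift_definition minus_fock :: "'a fock \<Rightarrow> 'a fock \<Rightarrow> 'a fock" is "\<lambda>f g w. f w - g w"
proof -
  fix f g :: "'a list \<Rightarrow> complex"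
  assume "f \<in> fock_set" "g \<in> fock_set"
  then show "(\<lambda>w. f w - g w) \<in> fock_set"
    using fock_set_add[of f "\<lambda>w. - 1 * g w"] fock_set_scale[of g "-1"] by simp
qed

definition scaleR_fock :: "real \<Rightarrow> 'a fock \<Rightarrow> 'a fock" where
  "scaleR_fock r f = complex_of_real r *\<^sub>C f"

definition inner_fock :: "'a fock \<Rightarrow> 'a fock \<Rightarrow> real" where
  "inner_fock f g = Re (cinner f g)"

definition norm_fock :: "'a fock \<Rightarrow> real" where
  "norm_fock f = sqrt (inner f f)"

definition dist_fock :: "'a fock \<Rightarrow> 'a fock \<Rightarrow> real" where
  "dist_fock f g = norm (f - g)"

definition sgn_fock :: "'a fock \<Rightarrow> 'a fock" where
  "sgn_fock f = inverse (norm f) *\<^sub>R f"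

definition uniformity_fock :: "('a fock \<times> 'a fock) filter" where
  "uniformity_fock = (INF e\<in>{0<..}. principal {(x, y). dist x y < e})"

definition open_fock :: "'a fock set \<Rightarrow> bool" where
  "open_fock U \<longleftrightarrow> (\<forall>x\<in>U. eventually (\<lambda>(x', y). x' = x \<longrightarrow> y \<in> U) uniformity)"

instance
proof
  fix f g h :: "'a fock" and a b r :: real
  show "f + g + h = f + (g + h)" by transfer (simp add: add.assoc)
  show "f + g = g + f" by transfer (simp add: add.commute)
  show "0 + f = f" by transfer simp
  show "- f + f = 0" by transfer simp
  show "f - g = f + - g" by transfer simp
  show "a *\<^sub>R (f + g) = a *\<^sub>R f + a *\<^sub>R g"
    unfolding scaleR_fock_def by transfer (simp add: algebra_simps)
  show "(a + b) *\<^sub>R f = a *\<^sub>R f + b *\<^sub>R f"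
    unfolding scaleR_fock_def by transfer (simp add: algebra_simps)
  show "a *\<^sub>R b *\<^sub>R f = (a * b) *\<^sub>R f"
    unfolding scaleR_fock_def by transfer (simp add: algebra_simps)
  show "1 *\<^sub>R f = f"
    unfolding scaleR_fock_def by transfer simp
  show "dist f g = norm (f - g)" by (rule dist_fock_def)
  show "sgn f = inverse (norm f) *\<^sub>R f" by (rule sgn_fock_def)
  show "uniformity = (INF e\<in>{0<..}. principal {(x, y :: 'a fock). dist x y < e})"
    by (rule uniformity_fock_def)
  show "open U \<longleftrightarrow> (\<forall>x\<in>U. eventually (\<lambda>(x', y). x' = x \<longrightarrow> y \<in> U) uniformity)"
    for U :: "'a fock set" by (rule open_fock_def)
  show "norm f = sqrt (inner f f)" by (rule norm_fock_def)
  show "inner f g = inner g f"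
    using cinner_commute[of f g] by (simp add: inner_fock_def)
  show "inner (f + g) h = inner f h + inner g h"
    unfolding inner_fock_def cinner_def plus_fock.rep_eq cinner_add_aux by simp
  show "inner (r *\<^sub>R f) g = r * inner f g"
    unfolding inner_fock_def cinner_def scaleR_fock_def scaleC.rep_eq cinner_scale_aux by simp
  have *: "inner f f = (\<Sum>\<^sub>\<infinity>w. (cmod (amplitude f w))\<^sup>2)"
    by (simp add: inner_fock_def cinner_self)
  show "0 \<le> inner f f" unfolding * by (rule infsum_nonneg) simp
  show "inner f f = 0 \<longleftrightarrow> f = 0"
  proof
    assume "inner f f = 0"
    then have le: "(\<Sum>\<^sub>\<infinity>w. (cmod (amplitude f w))\<^sup>2) \<le> 0" unfolding * by simp
    have "(cmod (amplitude f w))\<^sup>2 = 0" for w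
      by (rule nonneg_infsum_le_0D[OF le amplitude_summable]) simp_all
    then have "amplitude f w = amplitude 0 w" for w
      unfolding zero_fock.rep_eq by simp
    then have "amplitude f = amplitude 0" by (rule ext)
    then show "f = 0" by (simp only: amplitude_inject)
  next
    assume "f = 0"
    then show "inner f f = 0" unfolding * by (simp add: zero_fock.rep_eq)
  qed
qed

end


section \<open>Operators, trace and states\<close>

definition bounded_clinear :: "('n fock \<Rightarrow> 'n fock) \<Rightarrow> bool" where
  "bounded_clinear A \<longleftrightarrow> bounded_linear A \<and> (\<forall>c f. A (c *\<^sub>C f) = c *\<^sub>C A f)"

definition unitary :: "('n fock \<Rightarrow> 'n fock) \<Rightarrow> bool" where
  "unitary U \<longleftrightarrow> bounded_clinear U \<and> surj U \<and> (\<forall>f g. cinner (U f) (U g) = cinner f g)"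

definition positive_op :: "('n fock \<Rightarrow> 'n fock) \<Rightarrow> bool" where
  "positive_op A \<longleftrightarrow> bounded_clinear A \<and> (\<forall>f. cinner f (A f) \<in> \<real>\<^sub>\<ge>\<^sub>0)"

definition is_onb :: "'n fock set \<Rightarrow> bool" where
  "is_onb B \<longleftrightarrow> (\<forall>e\<in>B. \<forall>f\<in>B. cinner e f = (if e = f then 1 else 0)) \<and>
                (\<forall>f. (\<forall>e\<in>B. cinner e f = 0) \<longrightarrow> f = 0)"

text \<open>
  A bounded operator is trace class iff its diagonal is unconditionally (equivalently, absolutely)
  summable in every orthonormal basis, and the sum is then the same for all of them.  So
  \<open>has_trace A t\<close> says that \<open>A\<close> is trace class with trace \<open>t\<close>.
\<close>

definition has_trace :: "('n fock \<Rightarrow> 'n fock) \<Rightarrow> complex \<Rightarrow> bool" where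
  "has_trace A t \<longleftrightarrow> bounded_clinear A \<and>
     (\<forall>B. is_onb B \<longrightarrow> ((\<lambda>e. cinner e (A e)) has_sum t) B)"

definition is_state :: "('n fock \<Rightarrow> 'n fock) \<Rightarrow> bool" where
  "is_state \<rho> \<longleftrightarrow> positive_op \<rho> \<and> has_trace \<rho> 1"


section \<open>Exponential vectors and Weyl operators\<close>

lemma sum_words_prod:
  fixes g :: "'n::finite \<Rightarrow> 'a::comm_semiring_1"
  shows "(\<Sum>w | length w = r. prod_list (map g w)) = (\<Sum>i\<in>UNIV. g i) ^ r"
proof (induction r)
  case 0
  have "{w :: 'n list. length w = 0} = {[]}" by auto
  then show ?case by simp
next
  case (Suc r)
  have eq: "{w :: 'n list. length w = Suc r} = (\<lambda>(i, w). i # w) ` (UNIV \<times> {w. length w = r})"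
    by (auto simp: length_Suc_conv image_iff)
  have "(\<Sum>w | length w = Suc r. prod_list (map g w)) =
        (\<Sum>(i, w)\<in>UNIV \<times> {w. length w = r}. g i * prod_list (map g w))"
    unfolding eq by (subst sum.reindex) (auto simp: inj_on_def intro!: sum.cong)
  also have "\<dots> = (\<Sum>i\<in>UNIV. g i) * (\<Sum>w | length w = r. prod_list (map g w))"
    by (simp add: sum_product sum.cartesian_product)
  finally show ?case using Suc by simp
qed

lemma exponential_summable:
  fixes g :: "'n::finite \<Rightarrow> real"
  assumes "\<And>i. 0 \<le> g i"
  shows "(\<lambda>w. prod_list (map g w) / fact (length w)) summable_on UNIV"
proof (rule nonneg_bdd_above_summable_on)
  have nonneg: "0 \<le> prod_list (map g w)" for w
    by (induction w) (auto simp: assms)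
  then show "0 \<le> prod_list (map g w) / fact (length w)" for w by simp
  let ?a = "\<Sum>i\<in>UNIV. g i"
  show "bdd_above (sum (\<lambda>w. prod_list (map g w) / fact (length w)) ` {F. F \<subseteq> UNIV \<and> finite F})"
  proof (rule bdd_aboveI2)
    fix F :: "'n list set" assume "F \<in> {F. F \<subseteq> UNIV \<and> finite F}"
    then have fin: "finite F" by simp
    define m where "m = Suc (Max (insert 0 (length ` F)))"
    have "length w < m" if "w \<in> F" for w
      unfolding m_def by (rule le_imp_less_Suc, rule Max_ge) (use that fin in auto)
    then have sub: "F \<subseteq> (\<Union>r<m. {w. length w = r})" by auto
    have finr: "finite {w :: 'n list. length w = r}" for r
      using finite_lists_length_eq[of "UNIV :: 'n set" r] by simp
    have "(\<Sum>w\<in>F. prod_list (map g w) / fact (length w)) \<le>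
          (\<Sum>w\<in>(\<Union>r<m. {w. length w = r}). prod_list (map g w) / fact (length w))"
      using sub finr nonneg by (intro sum_mono2) auto
    also have "\<dots> = (\<Sum>r<m. \<Sum>w | length w = r. prod_list (map g w) / fact (length w))"
      using finr by (intro sum.UNION_disjoint) auto
    also have "\<dots> = (\<Sum>r<m. ?a ^ r / fact r)"
      by (intro sum.cong) (auto simp: sum_words_prod simp flip: sum_divide_distrib)
    also have "\<dots> = (\<Sum>r<m. ?a ^ r /\<^sub>R fact r)"
      by (simp add: divide_inverse mult.commute)
    also have "\<dots> \<le> (\<Sum>r. ?a ^ r /\<^sub>R fact r)"
    proof (rule sum_le_suminf[OF summable_exp_generic])
      have "0 \<le> ?a" by (rule sum_nonneg) (rule assms)
      then show "0 \<le> ?a ^ r /\<^sub>R fact r" for r by simp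
    qed simp
    finally show "(\<Sum>w\<in>F. prod_list (map g w) / fact (length w)) \<le> (\<Sum>r. ?a ^ r /\<^sub>R fact r)" .
  qed
qed

lift_definition exp_vec :: "complex ^ 'n \<Rightarrow> 'n::finite fock"
  is "\<lambda>u w. prod_list (map (\<lambda>i. u $ i) w) / complex_of_real (sqrt (fact (length w)))"
proof -
  fix u :: "complex ^ 'n"
  let ?f = "\<lambda>w. prod_list (map (\<lambda>i. u $ i) w) / complex_of_real (sqrt (fact (length w)))"
  have perm: "\<forall>v w. mset v = mset w \<longrightarrow> ?f v = ?f w"
  proof (intro allI impI)
    fix v w :: "'n list" assume eq: "mset v = mset w"
    have "prod_mset (mset (map (\<lambda>i. u $ i) v)) = prod_mset (mset (map (\<lambda>i. u $ i) w))"
      using eq by simp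
    moreover have "length v = length w" using eq by (rule mset_eq_length)
    ultimately show "?f v = ?f w" by (simp only: prod_mset_prod_list)
  qed
  have norm: "(cmod (?f w))\<^sup>2 = prod_list (map (\<lambda>i. (cmod (u $ i))\<^sup>2) w) / fact (length w)" for w
  proof -
    have "(cmod (prod_list (map (\<lambda>i. u $ i) w)))\<^sup>2 = prod_list (map (\<lambda>i. (cmod (u $ i))\<^sup>2) w)"
      by (induction w) (auto simp: norm_mult power_mult_distrib)
    then show ?thesis by (simp add: norm_divide power_divide)
  qed
  have "(\<lambda>w. (cmod (?f w))\<^sup>2) summable_on UNIV"
    unfolding norm by (rule exponential_summable) simp
  with perm show "?f \<in> fock_set"
    unfolding fock_set_def by blast
qed

definition cdot :: "complex ^ 'n \<Rightarrow> complex ^ 'n::finite \<Rightarrow> complex" where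
  "cdot u v = (\<Sum>i\<in>UNIV. cnj (u $ i) * v $ i)"

definition weyl :: "complex ^ 'n \<Rightarrow> 'n::finite fock \<Rightarrow> 'n fock" where
  "weyl u = (THE W. unitary W \<and>
     (\<forall>v. W (exp_vec v) =
            exp (- complex_of_real ((norm u)\<^sup>2) / 2 - cdot u v) *\<^sub>C exp_vec (u + v)))"


section \<open>Gaussian states\<close>

text \<open>Indices in \<open>{1..2n}\<close> are rendered by \<open>'n + 'n\<close>, the first block being \<open>Inl\<close>.\<close>

definition J_mat :: "real ^ ('n + 'n) ^ ('n::finite + 'n)" where
  "J_mat = (\<chi> a b. case (a, b) of
              (Inl i, Inr j) \<Rightarrow> if i = j then - 1 else 0
            | (Inr i, Inl j) \<Rightarrow> if i = j then 1 else 0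
            | _ \<Rightarrow> 0)"

definition cmat_nonneg :: "complex ^ 'm ^ 'm::finite \<Rightarrow> bool" where
  "cmat_nonneg M \<longleftrightarrow> (\<forall>z. cdot z (M *v z) \<in> \<real>\<^sub>\<ge>\<^sub>0)"

definition stack :: "real ^ 'n \<Rightarrow> real ^ 'n \<Rightarrow> real ^ ('n::finite + 'n)" where
  "stack x y = (\<chi> a. case a of Inl i \<Rightarrow> x $ i | Inr i \<Rightarrow> y $ i)"

definition is_gaussian_state ::
  "real ^ 'n \<Rightarrow> real ^ 'n \<Rightarrow> real ^ ('n + 'n) ^ ('n + 'n) \<Rightarrow> ('n::finite fock \<Rightarrow> 'n fock) \<Rightarrow> bool" where
  "is_gaussian_state l m S \<rho> \<longleftrightarrow>
     transpose S = S \<and>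
     cmat_nonneg (\<chi> a b. 2 * complex_of_real (S $ a $ b) + \<i> * complex_of_real (J_mat $ a $ b)) \<and>
     is_state \<rho> \<and>
     (\<forall>x y. has_trace (\<rho> \<circ> weyl (\<chi> i. Complex (x $ i) (y $ i)))
        (exp (- \<i> * complex_of_real (sqrt 2 * (l \<bullet> x - m \<bullet> y))
              - complex_of_real (stack x y \<bullet> (S *v stack x y)))))"


section \<open>The total number operator\<close>

text \<open>
  Under the above identification the \<open>r\<close>-particle subspace consists of the vectors supported on the
  words of length \<open>r\<close>.
\<close>

lift_definition number_proj :: "nat \<Rightarrow> 'n fock \<Rightarrow> 'n fock"
  is "\<lambda>k f w. if length w = k then f w else 0"
proof -
  fix k and f :: "'n list \<Rightarrow> complex"
  assume f: "f \<in> fock_set"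
  have "(\<lambda>w. (cmod (if length w = k then f w else 0))\<^sup>2) summable_on UNIV"
    by (rule summable_on_comparison_test[where f = "\<lambda>w. (cmod (f w))\<^sup>2"])
       (auto intro: fock_set_summable[OF f])
  moreover have "\<forall>v w. mset v = mset w \<longrightarrow>
      (if length v = k then f v else 0) = (if length w = k then f w else 0)"
  proof (intro allI impI)
    fix v w :: "'n list" assume vw: "mset v = mset w"
    then have "f v = f w" using f unfolding fock_set_def by blast
    then show "(if length v = k then f v else 0) = (if length w = k then f w else 0)"
      using mset_eq_length[OF vw] by simp
  qed
  ultimately show "(\<lambda>w. if length w = k then f w else 0) \<in> fock_set"
    unfolding fock_set_def by blast
qed

definition is_number_distribution :: "('n fock \<Rightarrow> 'n fock) \<Rightarrow> nat pmf \<Rightarrow> bool" where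
  "is_number_distribution \<rho> p \<longleftrightarrow>
     (\<forall>k. has_trace (\<rho> \<circ> number_proj k) (complex_of_real (pmf p k)))"


section \<open>Probability distributions on the natural numbers\<close>

definition pgf :: "nat pmf \<Rightarrow> real \<Rightarrow> real" where
  "pgf p x = (\<Sum>k. pmf p k * x ^ k)"

definition is_neg_binomial_half :: "real \<Rightarrow> nat pmf \<Rightarrow> bool" where
  "is_neg_binomial_half \<alpha> p \<longleftrightarrow> 0 \<le> \<alpha> \<and> \<alpha> < 1 \<and>
     (\<forall>x\<in>{0..<1}. pgf p x = ((1 - \<alpha>) / (1 - \<alpha> * x)) powr (1 / 2))"

definition conv_pmf :: "nat pmf \<Rightarrow> nat pmf \<Rightarrow> nat pmf" where
  "conv_pmf p q = map_pmf (\<lambda>(a, b). a + b) (pair_pmf p q)"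

definition conv_list :: "nat pmf list \<Rightarrow> nat pmf" where
  "conv_list ps = foldr conv_pmf ps (return_pmf 0)"

definition inf_divisible :: "nat pmf \<Rightarrow> bool" where
  "inf_divisible p \<longleftrightarrow> (\<forall>k\<ge>1. \<exists>q. p = conv_list (replicate k q))"


section \<open>Ordered eigenvalues of a real symmetric matrix\<close>

text \<open>
  \<open>lam 1 \<ge> \<dots> \<ge> lam d\<close> are the eigenvalues of \<open>S\<close>, repeated according to multiplicity, that is,
  the roots of its characteristic polynomial.
\<close>

definition ordered_eigenvalues :: "real ^ 'm ^ 'm::finite \<Rightarrow> (nat \<Rightarrow> real) \<Rightarrow> bool" where
  "ordered_eigenvalues S lam \<longleftrightarrow>
     (\<forall>i\<in>{1..CARD('m)}. \<forall>j\<in>{1..CARD('m)}. i \<le> j \<longrightarrow> lam j \<le> lam i) \<and>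
     (\<forall>t. det (mat t - S) = (\<Prod>j=1..CARD('m). t - lam j))"

end

(* With \<gamma> = 1/(1-x) and \<beta> = \<gamma> - 1/2, the operator x^N is the weak integral
   (\<gamma>/\<pi>)^n \<integral> exp(-\<beta>|z|^2) W(z) dz, as one sees on exponential vectors. Tracing
   against \<rho> inserts the characteristic function exp(-s^T S s), so G_N(x) is a Gaussian
   integral with matrix \<beta> I + S, which the spectral theorem for S evaluates as
   \<Prod> (\<gamma> / (\<beta> + \<lambda>_j))^(1/2), the stated product. Trace and integral may be interchanged
   because the partial sums of Tr \<rho> W(z) over a basis B are at most one: Cauchy-Schwarz for the
   form <f|\<rho> g> bounds them by the traces of \<rho> over B and over the basis W(z) B. *)
theory Submission
  imports Defs
begin

section \<open>The Fock space as a Hilbert space\<close>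

text \<open>Weyl operators are given by a definite description, so their existence comes first:
  exponential vectors are total, and a map between total families that preserves Gram matrices
  extends to a unitary, which takes completeness of the Fock space. Origin of the constants: on
  exponential vectors the factor exp(-|z|^2/2) of W(z) turns \<beta> into \<gamma>, and the Gaussian
  integral leaves exp((1 - 1/\<gamma>) <u|v>), which is <e(u)|e(xv)> because 1 - 1/\<gamma> = x.
  Since the weight depends on |z| alone, \<beta> I is unchanged by rotations, so S may be
  diagonalised by an orthogonal matrix instead of a symplectic one. The integral only yields the
  series of Pr(N=k) x^k. The law itself is found by comparing coefficients with an explicit
  convolution of negative binomial laws, where \<alpha>_j >= 0 makes the coefficients of each factor
  probabilities. Divisibility is visible on that convolution: index 1/2 splits into k indices
  1/(2k). The variance formula holds because variance minus mean is additive under convolution, and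
  \<alpha>_j / (1 - \<alpha>_j) = \<lambda>_j - 1/2 in each factor.\<close>

lemma cinner_add_left: "cinner (f + g) h = cinner f h + cinner g h"
  unfolding cinner_def plus_fock.rep_eq cinner_add_aux ..

lemma cinner_add_right: "cinner h (f + g) = cinner h f + cinner h g"
  by (metis cinner_add_left cinner_commute complex_cnj_add)

lemma cinner_scaleC_left: "cinner (c *\<^sub>C f) g = cnj c * cinner f g"
  unfolding cinner_def scaleC.rep_eq cinner_scale_aux ..

lemma cinner_scaleC_right: "cinner f (c *\<^sub>C g) = c * cinner f g"
  by (metis cinner_scaleC_left cinner_commute complex_cnj_cnj complex_cnj_mult)

lemma inner_eq_Re_cinner: "inner f g = Re (cinner f g)"
  by (rule inner_fock_def)

lemma cinner_norm: "cinner f f = complex_of_real ((norm f)\<^sup>2)"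
  unfolding power2_norm_eq_inner inner_eq_Re_cinner cinner_self by simp

lemma norm_fock_sq: "(norm f)\<^sup>2 = (\<Sum>\<^sub>\<infinity>w. (cmod (amplitude f w))\<^sup>2)"
  using cinner_norm[of f] unfolding cinner_self of_real_eq_iff by simp

text \<open>Real and imaginary parts of \<open>cinner\<close> are both real inner products, so a
  complex linear map preserving the real inner product preserves \<open>cinner\<close>.\<close>

lemma Im_cinner: "Im (cinner f g) = - inner f (\<i> *\<^sub>C g)"
  by (simp add: inner_eq_Re_cinner cinner_scaleC_right)

lemma norm_scaleC: "norm (c *\<^sub>C f) = cmod c * norm f"
proof -
  have "cinner (c *\<^sub>C f) (c *\<^sub>C f) = (cnj c * c) * cinner f f"
    by (simp add: cinner_scaleC_left cinner_scaleC_right)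
  also have "cnj c * c = complex_of_real ((cmod c)\<^sup>2)"
    by (metis complex_norm_square mult.commute of_real_power)
  finally have "(norm (c *\<^sub>C f))\<^sup>2 = (cmod c * norm f)\<^sup>2"
    unfolding cinner_norm of_real_mult[symmetric] of_real_eq_iff by (simp add: power_mult_distrib)
  then show ?thesis by (simp add: power2_eq_iff_nonneg)
qed

lemma scaleC_add_right: "c *\<^sub>C (f + g) = c *\<^sub>C f + c *\<^sub>C g"
  by transfer (simp add: algebra_simps)

lemma scaleC_scaleC [simp]: "c *\<^sub>C d *\<^sub>C f = (c * d) *\<^sub>C f"
  by transfer (simp add: algebra_simps)

lemma scaleC_one [simp]: "1 *\<^sub>C f = f"
  by transfer simp

lemma scaleR_scaleC: "r *\<^sub>R f = complex_of_real r *\<^sub>C f"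
  by (rule scaleR_fock_def)

text \<open>Sesquilinear over the complex numbers, hence bilinear over the reals; this gives access
  to the limit and sum rules for bounded bilinear maps.\<close>

lemma bounded_bilinear_cinner: "bounded_bilinear cinner"
proof
  fix f f' g g' :: "'a fock" and r :: real
  show "cinner (f + f') g = cinner f g + cinner f' g" by (rule cinner_add_left)
  show "cinner f (g + g') = cinner f g + cinner f g'" by (rule cinner_add_right)
  show "cinner (r *\<^sub>R f) g = r *\<^sub>R cinner f g"
    by (simp add: scaleR_scaleC cinner_scaleC_left scaleR_conv_of_real)
  show "cinner f (r *\<^sub>R g) = r *\<^sub>R cinner f g"
    by (simp add: scaleR_scaleC cinner_scaleC_right scaleR_conv_of_real)
  show "\<exists>K. \<forall>a b :: 'a fock. norm (cinner a b) \<le> norm a * norm b * K"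
  proof (intro exI allI)
    fix a b :: "'a fock"
    have "cmod (cinner a b) \<le> \<bar>inner a b\<bar> + \<bar>inner a (\<i> *\<^sub>C b)\<bar>"
      using cmod_le[of "cinner a b"] by (simp add: Im_cinner inner_eq_Re_cinner)
    also have "\<dots> \<le> norm a * norm b + norm a * norm b"
      using Cauchy_Schwarz_ineq2[of a b] Cauchy_Schwarz_ineq2[of a "\<i> *\<^sub>C b"]
      by (simp add: norm_scaleC)
    finally show "norm (cinner a b) \<le> norm a * norm b * 2" by simp
  qed
qed

lemma bounded_linear_scaleC: "bounded_linear ((*\<^sub>C) c)"
  by (rule bounded_linear_intro[of _ "cmod c"])
     (simp_all add: scaleC_add_right scaleR_scaleC norm_scaleC mult.commute)

interpretation cinner: bounded_bilinear cinner
  by (rule bounded_bilinear_cinner)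

lemma amplitude_sum: "amplitude (\<Sum>i\<in>I. f i) w = (\<Sum>i\<in>I. amplitude (f i) w)"
  by (induction I rule: infinite_finite_induct) (simp_all add: plus_fock.rep_eq zero_fock.rep_eq)

lemma sum_amplitude_le_norm:
  assumes "finite F" shows "(\<Sum>w\<in>F. (cmod (amplitude f w))\<^sup>2) \<le> (norm f)\<^sup>2"
  unfolding norm_fock_sq
  by (rule finite_sum_le_infsum[OF amplitude_summable assms]) simp_all

lemma cmod_amplitude_le: "cmod (amplitude f w) \<le> norm f"
  using sum_amplitude_le_norm[of "{w}" f] by (simp add: power2_le_iff_abs_le)

lemma amplitude_perm: "mset v = mset w \<Longrightarrow> amplitude f v = amplitude f w"
  using amplitude[of f] unfolding fock_set_def by blast

lemma fock_eqI: "(\<And>w. amplitude f w = amplitude g w) \<Longrightarrow> f = g"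
  by (metis amplitude_inject ext)

text \<open>Reduces norm estimates for operators that multiply amplitudes, and for truncation
  errors, to estimates word by word.\<close>

lemma norm_fock_mono:
  assumes "\<And>w. cmod (amplitude f w) \<le> cmod (amplitude g w)"
  shows "norm f \<le> norm g"
proof -
  have "(norm f)\<^sup>2 \<le> (norm g)\<^sup>2"
    unfolding norm_fock_sq
    by (intro infsum_mono amplitude_summable power_mono assms) simp
  then show ?thesis by (simp add: power2_le_iff_abs_le)
qed

text \<open>Completeness of a space of square summable functions: each amplitude is bounded by the
  norm, so amplitudes converge pointwise, and a uniform bound on finite partial sums survives the
  pointwise limit.\<close>

instance fock :: (type) complete_space
proof
  fix X :: "nat \<Rightarrow> 'a fock"
  assume X: "Cauchy X"
  have "Cauchy (\<lambda>n. amplitude (X n) w)" for w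
  proof (rule metric_CauchyI)
    fix e :: real assume "0 < e"
    then obtain M where M: "\<And>m n. m \<ge> M \<Longrightarrow> n \<ge> M \<Longrightarrow> dist (X m) (X n) < e"
      using X unfolding Cauchy_def by blast
    have "dist (amplitude (X m) w) (amplitude (X n) w) < e" if "m \<ge> M" "n \<ge> M" for m n
      using cmod_amplitude_le[of "X m - X n" w] M[OF that]
      unfolding dist_norm minus_fock.rep_eq by simp
    then show "\<exists>M. \<forall>m\<ge>M. \<forall>n\<ge>M. dist (amplitude (X m) w) (amplitude (X n) w) < e"
      by blast
  qed
  then have "\<exists>l. (\<lambda>n. amplitude (X n) w) \<longlonglongrightarrow> l" for w
    using Cauchy_convergent convergent_def by blast
  then obtain F where F: "\<And>w. (\<lambda>n. amplitude (X n) w) \<longlonglongrightarrow> F w" by metis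
  have perm: "\<forall>v w. mset v = mset w \<longrightarrow> F v = F w"
  proof (intro allI impI)
    fix v w :: "'a list" assume "mset v = mset w"
    then have "(\<lambda>n. amplitude (X n) v) = (\<lambda>n. amplitude (X n) w)"
      using amplitude_perm by blast
    then show "F v = F w" using F[of v] F[of w] LIMSEQ_unique by simp
  qed
  \<comment> \<open>Here \<open>n\<close> stays fixed and only the other index tends to infinity;
    finiteness of \<open>A\<close> lets the limit pass under the sum.\<close>
  have bound: "(\<Sum>w\<in>A. (cmod (F w - amplitude (X n) w))\<^sup>2) \<le> e\<^sup>2"
    if "finite A" "n \<ge> N" "\<And>m n. m \<ge> N \<Longrightarrow> n \<ge> N \<Longrightarrow> norm (X m - X n) \<le> e" for A n N e
  proof (rule LIMSEQ_le_const2)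
    show "(\<lambda>m. \<Sum>w\<in>A. (cmod (amplitude (X m) w - amplitude (X n) w))\<^sup>2)
            \<longlonglongrightarrow> (\<Sum>w\<in>A. (cmod (F w - amplitude (X n) w))\<^sup>2)"
      by (intro tendsto_intros F)
    have "(\<Sum>w\<in>A. (cmod (amplitude (X m) w - amplitude (X n) w))\<^sup>2) \<le> e\<^sup>2" if "m \<ge> N" for m
    proof -
      have "(\<Sum>w\<in>A. (cmod (amplitude (X m) w - amplitude (X n) w))\<^sup>2) \<le> (norm (X m - X n))\<^sup>2"
        using sum_amplitude_le_norm[of A "X m - X n"] \<open>finite A\<close> by (simp add: minus_fock.rep_eq)
      also have "\<dots> \<le> e\<^sup>2"
        using \<open>n \<ge> N\<close> that \<open>\<And>m n. m \<ge> N \<Longrightarrow> n \<ge> N \<Longrightarrow> norm (X m - X n) \<le> e\<close>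
        by (intro power_mono) auto
      finally show ?thesis .
    qed
    then show "\<exists>N. \<forall>m\<ge>N. (\<Sum>w\<in>A. (cmod (amplitude (X m) w - amplitude (X n) w))\<^sup>2) \<le> e\<^sup>2"
      by blast
  qed
  have cau: "\<exists>N. \<forall>m n. m \<ge> N \<longrightarrow> n \<ge> N \<longrightarrow> norm (X m - X n) \<le> e" if "e > 0" for e
    using X that unfolding Cauchy_def dist_norm by (meson less_imp_le)
  have diff: "(\<lambda>w. F w - amplitude (X n) w) \<in> fock_set"
    if "n \<ge> N" "\<And>m n. m \<ge> N \<Longrightarrow> n \<ge> N \<Longrightarrow> norm (X m - X n) \<le> e" for n N e
  proof -
    have "(\<lambda>w. (cmod (F w - amplitude (X n) w))\<^sup>2) summable_on UNIV"
      by (rule nonneg_bdd_above_summable_on)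
         (auto intro!: bdd_aboveI2[where M = "e\<^sup>2"] bound that)
    moreover have "F v - amplitude (X n) v = F w - amplitude (X n) w" if "mset v = mset w" for v w
      using perm that amplitude_perm[of v w] by metis
    ultimately show ?thesis unfolding fock_set_def by blast
  qed
  obtain N1 where N1: "\<And>m n. m \<ge> N1 \<Longrightarrow> n \<ge> N1 \<Longrightarrow> norm (X m - X n) \<le> 1"
    using cau[of 1] by auto
  have "F \<in> fock_set"
    using fock_set_add[OF diff[of N1 N1 1, OF order_refl N1] amplitude[of "X N1"]] by simp
  then obtain L where L: "amplitude L = F"
    using Abs_fock_inverse by blast
  have "X \<longlonglongrightarrow> L"
  proof (rule LIMSEQ_I)
    fix r :: real assume "0 < r"
    then have "r/2 > 0" by simp
    then obtain N where N: "\<And>m n. m \<ge> N \<Longrightarrow> n \<ge> N \<Longrightarrow> norm (X m - X n) \<le> r/2"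
      using cau by blast
    have "norm (X n - L) < r" if "n \<ge> N" for n
    proof -
      have "(norm (L - X n))\<^sup>2 \<le> (r/2)\<^sup>2"
        unfolding norm_fock_sq minus_fock.rep_eq L
      proof (rule infsum_le_finite_sums)
        show "(\<lambda>w. (cmod (F w - amplitude (X n) w))\<^sup>2) summable_on UNIV"
          by (rule fock_set_summable[OF diff[OF that N]])
        show "(\<Sum>w\<in>A. (cmod (F w - amplitude (X n) w))\<^sup>2) \<le> (r/2)\<^sup>2" if "finite A" for A
          by (rule bound[OF that \<open>n \<ge> N\<close> N])
      qed
      then have "norm (L - X n) \<le> r/2"
        using \<open>0 < r\<close> by (simp add: power2_le_iff_abs_le)
      then show ?thesis using \<open>0 < r\<close> by (simp add: norm_minus_commute)
    qed
    then show "\<exists>no. \<forall>n\<ge>no. norm (X n - L) < r" by blast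
  qed
  then show "convergent X" by (rule convergentI)
qed

section \<open>Number states\<close>

text \<open>The occupation number vector: \<open>m\<close> records how many particles sit in each
  mode. It is spread evenly over the words with content \<open>m\<close>, and the number of these
  words gives the normalisation.\<close>

lift_definition num_state :: "'n multiset \<Rightarrow> 'n fock"
  is "\<lambda>m w. if mset w = m then 1 / complex_of_real (sqrt (card (permutations_of_multiset m))) else 0"
proof -
  fix m :: "'n multiset"
  let ?f = "\<lambda>w. if mset w = m then 1 / complex_of_real (sqrt (card (permutations_of_multiset m))) else 0"
  have "(\<lambda>w. (cmod (?f w))\<^sup>2) summable_on permutations_of_multiset m"
    by (rule summable_on_finite) simp
  then have "(\<lambda>w. (cmod (?f w))\<^sup>2) summable_on UNIV"
    by (rule summable_on_cong_neutral[THEN iffD1, rotated 3])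
       (auto simp: permutations_of_multiset_def)
  then show "?f \<in> fock_set" unfolding fock_set_def by auto
qed

lemma card_permutations_pos: "0 < card (permutations_of_multiset m)"
  by (simp add: card_gt_0_iff)

text \<open>A symmetric amplitude is constant on the words with a given content, so the sum is the
  number of these words over its own square root, times one amplitude.\<close>

lemma cinner_num_state:
  "cinner (num_state (mset w)) f =
     complex_of_real (sqrt (card (permutations_of_multiset (mset w)))) * amplitude f w"
proof -
  let ?P = "permutations_of_multiset (mset w)"
  have "cinner (num_state (mset w)) f =
      (\<Sum>\<^sub>\<infinity>v\<in>?P. cnj (amplitude (num_state (mset w)) v) * amplitude f v)"
    unfolding cinner_def
    by (rule infsum_cong_neutral) (auto simp: num_state.rep_eq permutations_of_multiset_def)
  also have "\<dots> = (\<Sum>v\<in>?P. cnj (amplitude (num_state (mset w)) v) * amplitude f v)"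
    by simp
  also have "\<dots> = (\<Sum>v\<in>?P. 1 / complex_of_real (sqrt (card ?P)) * amplitude f w)"
    by (intro sum.cong refl)
       (auto simp: num_state.rep_eq permutations_of_multiset_def intro: amplitude_perm)
  also have "\<dots> = complex_of_real (real (card ?P) / sqrt (card ?P)) * amplitude f w"
    by simp
  finally show ?thesis by (simp add: real_div_sqrt)
qed

lemma num_state_orthonormal: "cinner (num_state m) (num_state m') = (if m = m' then 1 else 0)"
proof -
  obtain w where w: "m = mset w" by (metis ex_mset)
  have "sqrt (card (permutations_of_multiset m)) \<noteq> 0"
    using card_permutations_pos[of m] by simp
  then show ?thesis unfolding w cinner_num_state num_state.rep_eq
    by (auto simp flip: of_real_mult of_real_divide)
qed

lemma inj_num_state: "inj num_state"
  by (rule injI) (metis num_state_orthonormal zero_neq_one)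

lemma is_onb_num_state: "is_onb (range num_state)"
  unfolding is_onb_def
proof (intro conjI ballI allI impI)
  fix e f :: "'a fock" assume "e \<in> range num_state" "f \<in> range num_state"
  then show "cinner e f = (if e = f then 1 else 0)"
    using inj_num_state by (auto simp: num_state_orthonormal inj_eq)
next
  fix f :: "'a fock" assume "\<forall>e\<in>range num_state. cinner e f = 0"
  then have "cinner (num_state (mset w)) f = 0" for w by simp
  moreover have "sqrt (card (permutations_of_multiset (mset w))) \<noteq> 0" for w :: "'a list"
    using card_permutations_pos[of "mset w"] by simp
  ultimately have "amplitude f w = 0" for w
    unfolding cinner_num_state by simp
  then show "f = 0" by (intro fock_eqI) (simp add: zero_fock.rep_eq)
qed

lemma finite_msets_of_size: "finite {m :: 'n::finite multiset. size m = k}"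
proof -
  have "{m :: 'n multiset. size m = k} = mset ` {w. length w = k}"
    by (auto simp: image_iff) (metis ex_mset size_mset)
  then show ?thesis using finite_lists_length_eq[of "UNIV :: 'n set" k] by simp
qed

lemma finite_words_length: "finite {w :: 'n::finite list. length w = k}"
  using finite_lists_length_eq[of "UNIV :: 'n set" k] by simp

text \<open>With finitely many modes there are finitely many occupation patterns of \<open>k\<close>
  particles, so the projection has finite rank. This is what gives its products with bounded
  operators a trace.\<close>

lemma number_proj_eq_sum:
  "number_proj k (f :: 'n::finite fock) =
     (\<Sum>m | size m = k. cinner (num_state m) f *\<^sub>C num_state m)"
proof (rule fock_eqI)
  fix w :: "'n list"
  have nz: "sqrt (card (permutations_of_multiset (mset w))) \<noteq> 0"
    using card_permutations_pos[of "mset w"] by simp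
  have "amplitude (\<Sum>m | size m = k. cinner (num_state m) f *\<^sub>C num_state m) w =
     (\<Sum>m | size m = k. cinner (num_state m) f * amplitude (num_state m) w)"
    by (simp add: amplitude_sum scaleC.rep_eq)
  also have "\<dots> = (\<Sum>m | size m = k. if mset w = m then
        cinner (num_state m) f * amplitude (num_state m) w else 0)"
    by (intro sum.cong) (auto simp: num_state.rep_eq)
  also have "\<dots> = (if length w = k then
        cinner (num_state (mset w)) f * amplitude (num_state (mset w)) w else 0)"
    by (simp add: sum.delta' finite_msets_of_size)
  also have "\<dots> = amplitude (number_proj k f) w"
    using nz by (simp add: cinner_num_state num_state.rep_eq number_proj.rep_eq flip: of_real_divide)
  finally show "amplitude (number_proj k f) w =
      amplitude (\<Sum>m | size m = k. cinner (num_state m) f *\<^sub>C num_state m) w" ..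
qed

text \<open>Regroups an unordered sum over words or occupation patterns into a series graded by
  particle number.\<close>

lemma has_sum_finite_fibres:
  fixes f :: "'b \<Rightarrow> 'a::{banach, t3_space, uniform_topological_group_add}" and \<phi> :: "'b \<Rightarrow> nat"
  assumes "(f has_sum S) UNIV" "\<And>r. finite {w. \<phi> w = r}"
  shows "((\<lambda>r. \<Sum>w | \<phi> w = r. f w) has_sum S) UNIV"
proof -
  have bij: "bij_betw snd (SIGMA r:UNIV. {w. \<phi> w = r}) UNIV"
    by (rule bij_betwI[where g = "\<lambda>w. (\<phi> w, w)"]) auto
  have "((\<lambda>p. f (snd p)) has_sum S) (SIGMA r:UNIV. {w. \<phi> w = r})"
    using has_sum_reindex_bij_betw[OF bij, of f] assms by simp
  then show ?thesis
    by (rule has_sum_SigmaD) (simp add: assms)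
qed

text \<open>The remainder after \<open>n\<close> terms lives on the words of length at least
  \<open>n\<close>, so its squared norm is the tail of a convergent series.\<close>

lemma number_proj_sums:
  fixes f :: "'n::finite fock"
  shows "(\<lambda>k. number_proj k f) sums f"
proof -
  let ?a = "\<lambda>k. \<Sum>w | length w = k. (cmod (amplitude f w))\<^sup>2"
  have "?a sums (norm f)\<^sup>2"
    unfolding norm_fock_sq by (intro has_sum_imp_sums has_sum_finite_fibres has_sum_infsum amplitude_summable finite_words_length)
  then have "(\<lambda>n. (norm f)\<^sup>2 - sum ?a {..<n}) \<longlonglongrightarrow> (norm f)\<^sup>2 - (norm f)\<^sup>2"
    unfolding sums_def by (intro tendsto_intros)
  then have lim: "(\<lambda>n. sqrt ((norm f)\<^sup>2 - sum ?a {..<n})) \<longlonglongrightarrow> 0"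
    using tendsto_real_sqrt by fastforce
  have "norm (f - (\<Sum>k<n. number_proj k f)) = sqrt ((norm f)\<^sup>2 - sum ?a {..<n})" for n
  proof -
    let ?F = "{w :: 'n list. length w < n}"
    have F: "?F = (\<Union>k<n. {w. length w = k})" by auto
    then have fin: "finite ?F" by (simp add: finite_words_length)
    have sumF: "sum ?a {..<n} = (\<Sum>w\<in>?F. (cmod (amplitude f w))\<^sup>2)"
      unfolding F by (intro sum.UNION_disjoint[symmetric]) (auto simp: finite_words_length)
    have amp: "amplitude (f - (\<Sum>k<n. number_proj k f)) w = (if length w < n then 0 else amplitude f w)" for w
      by (simp add: minus_fock.rep_eq amplitude_sum number_proj.rep_eq)
    have "(norm (f - (\<Sum>k<n. number_proj k f)))\<^sup>2 = (\<Sum>\<^sub>\<infinity>w\<in>UNIV - ?F. (cmod (amplitude f w))\<^sup>2)"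
      unfolding norm_fock_sq amp by (rule infsum_cong_neutral) auto
    also have "\<dots> = (norm f)\<^sup>2 - (\<Sum>w\<in>?F. (cmod (amplitude f w))\<^sup>2)"
      unfolding norm_fock_sq
      by (subst infsum_Diff) (use fin in \<open>auto simp: amplitude_summable\<close>)
    finally show ?thesis unfolding sumF by (metis norm_ge_zero real_sqrt_unique)
  qed
  then have "(\<lambda>n. norm (f - (\<Sum>k<n. number_proj k f))) \<longlonglongrightarrow> 0"
    using lim by simp
  then have "(\<lambda>n. f - (\<Sum>k<n. number_proj k f)) \<longlonglongrightarrow> 0"
    by (rule tendsto_norm_zero_cancel)
  then have "(\<lambda>n. f - (f - (\<Sum>k<n. number_proj k f))) \<longlonglongrightarrow> f - 0"
    by (intro tendsto_diff tendsto_const)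
  then show ?thesis unfolding sums_def by simp
qed

section \<open>Totality of the exponential vectors\<close>

text \<open>Expanding the \<open>r\<close>-th power of \<open>cdot u v\<close> over words of length
  \<open>r\<close> identifies the contribution of these words as a term of the exponential
  series.\<close>

lemma cinner_exp_vec: "cinner (exp_vec u) (exp_vec v) = exp (cdot u v)"
proof -
  let ?g = "\<lambda>i. cnj (u $ i) * v $ i"
  have pr: "prod_list (map (\<lambda>i. cnj (u $ i)) w) * prod_list (map (\<lambda>i. v $ i) w) = prod_list (map ?g w)" for w
    by (induction w) (simp_all add: mult_ac)
  have cp: "cnj (prod_list (map (\<lambda>i. u $ i) w)) = prod_list (map (\<lambda>i. cnj (u $ i)) w)" for w
    by (induction w) simp_all
  have amp: "cnj (amplitude (exp_vec u) w) * amplitude (exp_vec v) w = prod_list (map ?g w) / fact (length w)"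
    for w
  proof -
    have "complex_of_real (sqrt (fact (length w))) * complex_of_real (sqrt (fact (length w))) = fact (length w)"
      unfolding of_real_mult[symmetric] by simp
    then show ?thesis
      by (simp add: exp_vec.rep_eq cp flip: pr)
  qed
  have "((\<lambda>r. \<Sum>w | length w = r. cnj (amplitude (exp_vec u) w) * amplitude (exp_vec v) w)
          has_sum cinner (exp_vec u) (exp_vec v)) UNIV"
    unfolding cinner_def by (intro has_sum_finite_fibres has_sum_infsum amplitude_mult_summable finite_words_length)
  moreover have "(\<Sum>w | length w = r. cnj (amplitude (exp_vec u) w) * amplitude (exp_vec v) w)
      = cdot u v ^ r /\<^sub>R fact r" for r
  proof -
    have "(\<Sum>w | length w = r. cnj (amplitude (exp_vec u) w) * amplitude (exp_vec v) w)
      = (\<Sum>w | length w = r. prod_list (map ?g w)) / fact r"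
      unfolding amp sum_divide_distrib by (intro sum.cong) auto
    then show ?thesis
      unfolding sum_words_prod cdot_def by (simp add: scaleR_conv_of_real divide_inverse mult.commute)
  qed
  ultimately have "(\<lambda>r. cdot u v ^ r /\<^sub>R fact r) sums cinner (exp_vec u) (exp_vec v)"
    by (simp add: has_sum_imp_sums)
  then show ?thesis using exp_converges sums_unique2 by blast
qed

text \<open>Totality in the form of an induction rule: a property preserved by sums, scalar
  multiples and limits that holds on the family holds everywhere.\<close>

definition total_family :: "('i \<Rightarrow> 'n fock) \<Rightarrow> bool" where
  "total_family a \<longleftrightarrow> (\<forall>X. closed X \<and> (\<forall>f\<in>X. \<forall>g\<in>X. f + g \<in> X) \<and> (\<forall>c. \<forall>f\<in>X. c *\<^sub>C f \<in> X) \<and>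
     range a \<subseteq> X \<longrightarrow> X = UNIV)"

lemma total_familyD:
  assumes "total_family a" "closed X" "\<And>f g. f \<in> X \<Longrightarrow> g \<in> X \<Longrightarrow> f + g \<in> X"
    "\<And>c f. f \<in> X \<Longrightarrow> c *\<^sub>C f \<in> X" "\<And>i. a i \<in> X"
  shows "f \<in> X"
proof -
  have "range a \<subseteq> X" using assms(5) by blast
  then have "X = UNIV"
    using assms(1)[unfolded total_family_def, rule_format, of X] assms(2-4) by blast
  then show ?thesis by simp
qed

text \<open>Orthogonality of the characters of the cyclic group of order \<open>M\<close>: the sum
  is geometric, and its ratio is an \<open>M\<close>-th root of unity, equal to 1 only when
  \<open>M\<close> divides \<open>a - b\<close>.\<close>

lemma sum_root_of_unity:
  assumes "a < M" "b < M"
  shows "(\<Sum>j<M. cis (2 * pi / M) ^ (j * a) * cnj (cis (2 * pi / M)) ^ (j * b)) =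
     (if a = b then of_nat M else (0 :: complex))"
proof -
  let ?\<omega> = "cis (2 * pi / M)"
  let ?\<zeta> = "cis (2 * pi * (real a - real b) / M)"
  have M: "real M > 0" using assms by simp
  have z: "?\<zeta> = ?\<omega> ^ a * cnj ?\<omega> ^ b"
    unfolding cis_cnj Complex.DeMoivre cis_mult by (rule arg_cong[where f = cis]) (use M in \<open>simp add: field_simps\<close>)
  have "(\<Sum>j<M. ?\<omega> ^ (j * a) * cnj ?\<omega> ^ (j * b)) = (\<Sum>j<M. ?\<zeta> ^ j)"
    unfolding z power_mult_distrib power_mult[symmetric] by (simp add: mult.commute)
  also have "\<dots> = (if a = b then of_nat M else 0)"
  proof (cases "a = b")
    case False
    have "?\<zeta> \<noteq> 1"
    proof
      assume "?\<zeta> = 1"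
      then have "cos (2 * pi * (real a - real b) / M) = 1"
        by (metis cis.sel(1) one_complex.sel(1))
      then obtain n :: int where "2 * pi * (real a - real b) / M = of_int n * 2 * pi"
        using cos_one_2pi_int by auto
      then have "2 * pi * ((real a - real b) / M - of_int n) = 0"
        by (simp add: algebra_simps)
      then have "(real a - real b) / M - of_int n = 0"
        by (metis mult_eq_0_iff pi_neq_zero zero_neq_numeral)
      then have "real a - real b = of_int n * real M"
        using M by (simp add: field_simps)
      then have "real_of_int (int a - int b) = real_of_int (n * int M)" by simp
      then have eq: "int a - int b = n * int M" using of_int_eq_iff by blast
      then have "n \<noteq> 0" using False by auto
      \<comment> \<open>A nonzero multiple of \<open>M\<close> has absolute value at least
        \<open>M\<close>, whereas \<open>a\<close> and \<open>b\<close> both lie below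
        \<open>M\<close>.\<close>
      then have "1 * int M \<le> \<bar>n\<bar> * int M" by (intro mult_right_mono) auto
      then have "int M \<le> \<bar>n * int M\<bar>" by (simp add: abs_mult)
      then show False using eq assms by linarith
    qed
    moreover have "?\<zeta> ^ M = 1"
    proof -
      have "?\<zeta> ^ M = cis (2 * pi * of_int (int a - int b))"
        unfolding Complex.DeMoivre using M by simp
      also have "\<dots> = 1" by (rule cis_multiple_2pi) simp
      finally show ?thesis .
    qed
    ultimately show ?thesis using False by (simp add: sum_gp_strict)
  qed simp
  finally show ?thesis .
qed

lemma prod_list_map_eq_prod_count:
  fixes g :: "'n::finite \<Rightarrow> 'a::comm_monoid_mult"
  shows "prod_list (map g w) = (\<Prod>i\<in>UNIV. g i ^ count (mset w) i)"
proof (induction w)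
  case (Cons x w)
  have "(\<Prod>i\<in>UNIV. g i ^ count (mset (x # w)) i) =
        (\<Prod>i\<in>UNIV. (if i = x then g i else 1) * g i ^ count (mset w) i)"
    by (intro prod.cong) auto
  also have "\<dots> = g x * (\<Prod>i\<in>UNIV. g i ^ count (mset w) i)"
    by (simp add: prod.distrib prod.delta)
  finally show ?case using Cons by simp
qed simp

text \<open>The vector \<open>num_state m\<close> is recovered from the exponential vectors on the torus by a discrete
  Fourier transform; aliasing only affects words of length at least \<open>M\<close>.\<close>

lemma num_state_exp_vec_approx:
  fixes m :: "'n::finite multiset"
  assumes "\<And>i. count m i < M"
  defines "\<omega> \<equiv> cis (2 * pi / M)"
  defines "k \<equiv> sqrt (card (permutations_of_multiset m)) / sqrt (fact (size m))"
  defines "T \<equiv> (\<Sum>j\<in>Pi\<^sub>E UNIV (\<lambda>_. {..<M}).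
     (\<Prod>i\<in>UNIV. cnj \<omega> ^ (j i * count m i) / of_nat M) *\<^sub>C exp_vec (\<chi> i. \<omega> ^ j i))"
  shows "norm (T - complex_of_real k *\<^sub>C num_state m) \<le>
     norm (exp_vec (\<chi> i. 1) - (\<Sum>r<M. number_proj r (exp_vec (\<chi> i::'n. 1))))"
proof (rule norm_fock_mono)
  fix w :: "'n list"
  let ?s = "complex_of_real (sqrt (fact (length w)))"
  have M: "M > 0" using assms(1)[of undefined] by simp
  let ?f = "\<lambda>i j. \<omega> ^ (j * count (mset w) i) * cnj \<omega> ^ (j * count m i) / of_nat M"
  have "amplitude T w = (\<Sum>j\<in>Pi\<^sub>E UNIV (\<lambda>_. {..<M}). (\<Prod>i\<in>UNIV. ?f i (j i))) / ?s"
    unfolding T_def amplitude_sum scaleC.rep_eq exp_vec.rep_eq prod_list_map_eq_prod_count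
      sum_divide_distrib
    by (intro sum.cong refl)
       (simp add: prod.distrib[symmetric] power_mult mult.commute flip: prod_dividef)
  \<comment> \<open>The average over the grid of torus points factors into one average for each
    mode.\<close>
  also have "(\<Sum>j\<in>Pi\<^sub>E UNIV (\<lambda>_. {..<M}). (\<Prod>i\<in>UNIV. ?f i (j i))) = (\<Prod>i\<in>UNIV. \<Sum>j<M. ?f i j)"
    by (rule prod_sum_PiE[symmetric]) auto
  finally have T: "amplitude T w = (\<Prod>i\<in>UNIV. \<Sum>j<M. ?f i j) / ?s" .
  \<comment> \<open>The comparison vector is the tail of an exponential vector with all coordinates
    1. Points of the torus have coordinates of modulus 1, so their amplitudes have exactly this
    size.\<close>
  have E: "amplitude (exp_vec (\<chi> i::'n. 1) - (\<Sum>r<M. number_proj r (exp_vec (\<chi> i::'n. 1)))) w =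
     (if length w < M then 0 else 1 / ?s)"
    by (simp add: minus_fock.rep_eq amplitude_sum number_proj.rep_eq exp_vec.rep_eq prod_list_map_eq_prod_count)
  have sc: "sqrt (card (permutations_of_multiset m)) \<noteq> 0"
    using card_permutations_pos[of m] by simp
  \<comment> \<open>The constant \<open>k\<close> is the quotient of the amplitude
    \<open>1 / ?s\<close>, which the Fourier transform leaves on words with content
    \<open>m\<close>, by the amplitude of the normalised \<open>num_state m\<close>.\<close>
  have N: "amplitude (complex_of_real k *\<^sub>C num_state m) w = (if mset w = m then 1 / ?s else 0)"
    using sc by (auto simp: scaleC.rep_eq num_state.rep_eq k_def)
  have om: "cmod \<omega> = 1" by (simp add: \<omega>_def)
  show "cmod (amplitude (T - complex_of_real k *\<^sub>C num_state m) w) \<le>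
        cmod (amplitude (exp_vec (\<chi> i::'n. 1) - (\<Sum>r<M. number_proj r (exp_vec (\<chi> i::'n. 1)))) w)"
  proof (cases "\<forall>i. count (mset w) i < M")
    case True
    have "(\<Sum>j<M. ?f i j) = (if count (mset w) i = count m i then 1 else 0)" for i
      using sum_root_of_unity[of "count (mset w) i" M "count m i"] True assms(1) M
      by (simp add: \<omega>_def flip: sum_divide_distrib)
    then have "(\<Prod>i\<in>UNIV. \<Sum>j<M. ?f i j) = (if mset w = m then 1 else 0)"
      by (auto simp: multiset_eq_iff)
    then have "amplitude T w = amplitude (complex_of_real k *\<^sub>C num_state m) w"
      unfolding T N by simp
    then show ?thesis by (simp add: minus_fock.rep_eq)
  next
    \<comment> \<open>A multiplicity of at least \<open>M\<close> may alias to that of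
      \<open>m\<close>. Such a word has length at least \<open>M\<close>, and the average of numbers
      of modulus one in each mode keeps its amplitude below that of the tail.\<close>
    case False
    then obtain i where i: "count (mset w) i \<ge> M" by (metis not_less)
    then have len: "length w \<ge> M"
      using count_le_size[of "mset w" i] by simp
    have "mset w \<noteq> m" using i assms(1)[of i] by auto
    then have "cmod (amplitude (T - complex_of_real k *\<^sub>C num_state m) w) = cmod (amplitude T w)"
      by (simp add: minus_fock.rep_eq N)
    also have "\<dots> = (\<Prod>i\<in>UNIV. cmod (\<Sum>j<M. ?f i j)) / sqrt (fact (length w))"
      unfolding T by (simp add: norm_divide prod_norm)
    also have "\<dots> \<le> (\<Prod>i\<in>(UNIV :: 'n set). 1) / sqrt (fact (length w))"
    proof (intro divide_right_mono prod_mono conjI)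
      fix i
      have "cmod (\<Sum>j<M. ?f i j) \<le> (\<Sum>j<M. cmod (?f i j))" by (rule norm_sum)
      also have "\<dots> = 1" using M by (simp add: norm_mult norm_divide norm_power om)
      finally show "cmod (\<Sum>j<M. ?f i j) \<le> 1" .
    qed simp_all
    also have "\<dots> = cmod (1 / ?s)" by (simp add: norm_divide)
    finally show ?thesis unfolding E using len by simp
  qed
qed

text \<open>Number states are limits of combinations of exponential vectors, each
  \<open>number_proj k f\<close> is a finite combination of number states, and every vector is the
  limit of its truncations in particle number.\<close>

theorem total_family_exp_vec: "total_family (exp_vec :: complex ^ 'n::finite \<Rightarrow> 'n fock)"
  unfolding total_family_def
proof (intro allI impI, elim conjE)
  fix X :: "'n fock set"
  assume X: "closed X" and add: "\<forall>f\<in>X. \<forall>g\<in>X. f + g \<in> X" and sc: "\<forall>c. \<forall>f\<in>X. c *\<^sub>C f \<in> X"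
    and ex: "range exp_vec \<subseteq> X"
  have zero: "0 \<in> X"
  proof -
    have "exp_vec 0 \<in> X" using ex by auto
    then have "0 *\<^sub>C exp_vec 0 \<in> X" using sc by blast
    moreover have "0 *\<^sub>C exp_vec 0 = (0 :: 'n fock)" by transfer simp
    ultimately show ?thesis by simp
  qed
  have sum: "(\<Sum>i\<in>I. c i *\<^sub>C g i) \<in> X" if "\<And>i. i \<in> I \<Longrightarrow> g i \<in> X" for I c and g :: "'b \<Rightarrow> 'n fock"
    using that by (induction I rule: infinite_finite_induct) (auto simp: zero add sc)
  have num: "num_state m \<in> X" for m
  proof -
    let ?E = "exp_vec (\<chi> i::'n. 1)"
    define k where "k = sqrt (card (permutations_of_multiset m)) / sqrt (fact (size m))"
    have k: "k \<noteq> 0" using card_permutations_pos[of m] by (simp add: k_def)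
    define T where "T M = (\<Sum>j\<in>Pi\<^sub>E UNIV (\<lambda>_. {..<M}). (\<Prod>i\<in>UNIV. cnj (cis (2 * pi / M)) ^ (j i * count m i) / of_nat M)
        *\<^sub>C exp_vec (\<chi> i. cis (2 * pi / M) ^ j i))" for M
    have "T M \<in> X" for M unfolding T_def by (rule sum) (use ex in auto)
    moreover have "T \<longlonglongrightarrow> complex_of_real k *\<^sub>C num_state m"
    proof (rule LIM_zero_cancel, rule Lim_null_comparison)
      show "\<forall>\<^sub>F M in sequentially. norm (T M - complex_of_real k *\<^sub>C num_state m) \<le>
          norm (?E - (\<Sum>r<M. number_proj r ?E))"
      proof (rule eventually_sequentiallyI)
        fix M assume M: "M \<ge> Suc (size m)"
        have "count m i < M" for i using count_le_size[of m i] M by linarith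
        from num_state_exp_vec_approx[OF this]
        show "norm (T M - complex_of_real k *\<^sub>C num_state m) \<le> norm (?E - (\<Sum>r<M. number_proj r ?E))"
          unfolding T_def k_def .
      qed
      have "(\<lambda>M. ?E - (\<Sum>r<M. number_proj r ?E)) \<longlonglongrightarrow> ?E - ?E"
        using number_proj_sums[of ?E] unfolding sums_def by (intro tendsto_intros)
      then show "(\<lambda>M. norm (?E - (\<Sum>r<M. number_proj r ?E))) \<longlonglongrightarrow> 0"
        using tendsto_norm_zero by simp
    qed
    ultimately have "complex_of_real k *\<^sub>C num_state m \<in> X"
      by (rule closed_sequentially[OF X])
    then have "complex_of_real (1 / k) *\<^sub>C complex_of_real k *\<^sub>C num_state m \<in> X"
      using sc by blast
    then show ?thesis using k by (simp flip: of_real_mult)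
  qed
  have "f \<in> X" for f
  proof -
    have "number_proj k f \<in> X" for k
      unfolding number_proj_eq_sum by (rule sum) (rule num)
    then have "(\<Sum>k<n. number_proj k f) \<in> X" for n
      using sum[of "{..<n}" "\<lambda>k. number_proj k f" "\<lambda>_. 1"] by simp
    then show ?thesis
      by (rule closed_sequentially[OF X]) (rule number_proj_sums[of f, unfolded sums_def])
  qed
  then show "X = UNIV" by auto
qed

section \<open>Weyl operators\<close>

text \<open>For \<open>G\<close> the graph of an isometry this says that the domain is closed:
  convergent arguments have Cauchy images, completeness supplies a limit, and closedness of the
  graph does the rest.\<close>

lemma closed_fst_isometric:
  fixes G :: "('n fock \<times> 'm fock) set"
  assumes "closed G" "subspace G" "\<And>p. p \<in> G \<Longrightarrow> norm (snd p) = norm (fst p)"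
  shows "closed (fst ` G)"
  unfolding closed_sequential_limits
proof (intro allI impI, elim conjE)
  fix x l assume x: "\<forall>n. x n \<in> fst ` G" and l: "x \<longlonglongrightarrow> l"
  have "\<exists>y. (x n, y) \<in> G" for n
    using x[rule_format, of n] by force
  then obtain y where y: "\<And>n. (x n, y n) \<in> G" by metis
  have "norm (y m - y n) = norm (x m - x n)" for m n
    using assms(3)[OF subspace_diff[OF assms(2) y y, of m n]] by simp
  then have "Cauchy y"
    using LIMSEQ_imp_Cauchy[OF l] unfolding Cauchy_def dist_norm by simp
  then obtain k where "y \<longlonglongrightarrow> k" using Cauchy_convergent convergent_def by blast
  then have "(\<lambda>n. (x n, y n)) \<longlonglongrightarrow> (l, k)" by (intro tendsto_Pair l)
  then have "(l, k) \<in> G" by (rule closed_sequentially[OF assms(1), rotated]) (rule y)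
  then show "l \<in> fst ` G" by force
qed

lemma bounded_clinear_bounded_linear: "bounded_clinear A \<Longrightarrow> bounded_linear A"
  unfolding bounded_clinear_def by simp

lemma bounded_clinear_scaleC: "bounded_clinear A \<Longrightarrow> A (c *\<^sub>C f) = c *\<^sub>C A f"
  unfolding bounded_clinear_def by simp

lemma bounded_clinear_eq_on_total:
  assumes "total_family a" "bounded_clinear A" "bounded_clinear B" "\<And>i. A (a i) = B (a i)"
  shows "A = B"
proof
  fix f
  interpret A: bounded_linear A by (rule bounded_clinear_bounded_linear[OF assms(2)])
  interpret B: bounded_linear B by (rule bounded_clinear_bounded_linear[OF assms(3)])
  have "f \<in> {f. A f = B f}"
  proof (rule total_familyD[OF assms(1)])
    show "closed {f. A f = B f}"
      by (intro closed_Collect_eq A.continuous_on B.continuous_on continuous_on_id)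
  qed (auto simp: A.add B.add bounded_clinear_scaleC[OF assms(2)] bounded_clinear_scaleC[OF assms(3)] assms(4))
  then show "A f = B f" by simp
qed

lemma subspace_closure:
  fixes S :: "'a::real_normed_vector set"
  assumes "subspace S" shows "subspace (closure S)"
  unfolding subspace_def
proof (intro conjI ballI allI)
  show "0 \<in> closure S" using subspace_0[OF assms] closure_subset by blast
next
  fix x y assume "x \<in> closure S" "y \<in> closure S"
  then obtain f g where "\<forall>n. f n \<in> S" "f \<longlonglongrightarrow> x" "\<forall>n. g n \<in> S" "g \<longlonglongrightarrow> y"
    unfolding closure_sequential by blast
  then have "\<forall>n. f n + g n \<in> S" "(\<lambda>n. f n + g n) \<longlonglongrightarrow> x + y"
    using subspace_add[OF assms] by (auto intro: tendsto_add)
  then show "x + y \<in> closure S"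
    unfolding closure_sequential by (intro exI[of _ "\<lambda>n. f n + g n"] conjI)
next
  fix c :: real and x assume "x \<in> closure S"
  then obtain f where "\<forall>n. f n \<in> S" "f \<longlonglongrightarrow> x"
    unfolding closure_sequential by blast
  then have "\<forall>n. c *\<^sub>R f n \<in> S" "(\<lambda>n. c *\<^sub>R f n) \<longlonglongrightarrow> c *\<^sub>R x"
    using subspace_scale[OF assms] by (auto intro: tendsto_scaleR)
  then show "c *\<^sub>R x \<in> closure S"
    unfolding closure_sequential by (intro exI[of _ "\<lambda>n. c *\<^sub>R f n"] conjI)
qed

text \<open>The operator is built through its graph \<open>G\<close>, the closed span of the pairs
  \<open>(a i, b i)\<close>. Equal Gram matrices make the two components of every element of
  \<open>G\<close> equally long, so \<open>G\<close> is a graph in both directions; totality of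
  \<open>a\<close> and of \<open>b\<close> makes both projections of \<open>G\<close> the whole
  space.\<close>

theorem isometric_families_unitary:
  fixes a b :: "'i \<Rightarrow> 'n fock"
  assumes a: "total_family a" and b: "total_family b"
    and iso: "\<And>i j. cinner (b i) (b j) = cinner (a i) (a j)"
  shows "\<exists>!U. unitary U \<and> (\<forall>i. U (a i) = b i)"
proof (rule ex_ex1I)
  \<comment> \<open>The complex factor is part of the generators because \<open>span\<close> is the
    real span; it makes \<open>G\<close> closed under complex scalars.\<close>
  let ?A = "range (\<lambda>x. (fst x *\<^sub>C a (snd x), fst x *\<^sub>C b (snd x)))"
  define G where "G = closure (span ?A)"
  have clG: "closed G" by (simp add: G_def)
  have subG: "subspace G" unfolding G_def by (simp add: subspace_closure)
  have scG: "(c *\<^sub>C f, c *\<^sub>C g) \<in> G" if "(f, g) \<in> G" for c f g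
  proof -
    let ?T = "\<lambda>p. (c *\<^sub>C fst p, c *\<^sub>C snd p :: 'n fock)"
    have T: "bounded_linear ?T"
      by (intro bounded_linear_Pair bounded_linear_compose[OF bounded_linear_scaleC]
          bounded_linear_fst bounded_linear_snd)
    have "?T (fst x *\<^sub>C a (snd x), fst x *\<^sub>C b (snd x)) \<in> ?A" for x
      by (rule range_eqI[of _ _ "(c * fst x, snd x)"]) simp
    then have "?T ` ?A \<subseteq> ?A" by blast
    then have "?T ` span ?A \<subseteq> span ?A"
      unfolding linear_span_image[OF bounded_linear.linear[OF T], symmetric] by (rule span_mono)
    then have "?T ` G \<subseteq> G"
      unfolding G_def
      by (rule order_trans[OF closure_bounded_linear_image_subset[OF T] closure_mono])
    then show ?thesis using that by force
  qed
  have genG: "(a i, b i) \<in> G" for i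
  proof -
    have "(1 *\<^sub>C a i, 1 *\<^sub>C b i) \<in> ?A" by (rule range_eqI[of _ _ "(1, i)"]) simp
    then show ?thesis unfolding G_def scaleC_one
      by (rule subsetD[OF closure_subset, OF span_base])
  qed
  have base: "inner (snd p) (snd q) = inner (fst p) (fst q)" if "p \<in> ?A" "q \<in> ?A" for p q
  proof -
    from \<open>p \<in> ?A\<close> obtain x where p: "p = (fst x *\<^sub>C a (snd x), fst x *\<^sub>C b (snd x))"
      by (rule rangeE)
    from \<open>q \<in> ?A\<close> obtain y where q: "q = (fst y *\<^sub>C a (snd y), fst y *\<^sub>C b (snd y))"
      by (rule rangeE)
    show ?thesis
      by (simp only: p q fst_conv snd_conv inner_eq_Re_cinner cinner_scaleC_left cinner_scaleC_right iso)
  qed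
  have sub: "subspace {p :: 'n fock \<times> 'n fock. inner (snd p) (snd q) = inner (fst p) (fst q)}" for q
    unfolding subspace_def by (simp add: inner_left_distrib)
  \<comment> \<open>Extension by linearity in one argument, the other still a generator; the
    symmetric argument then frees the second one.\<close>
  have semi: "inner (snd p) (snd q) = inner (fst p) (fst q)" if "p \<in> span ?A" "q \<in> ?A" for p q
    using span_minimal[OF _ sub, of ?A q] base[OF _ \<open>q \<in> ?A\<close>] \<open>p \<in> span ?A\<close> by blast
  have inn: "inner (snd p) (snd q) = inner (fst p) (fst q)" if "p \<in> span ?A" "q \<in> span ?A" for p q
  proof -
    have "inner (snd r) (snd p) = inner (fst r) (fst p)" if "r \<in> ?A" for r
      using semi[OF \<open>p \<in> span ?A\<close> that] by (simp only: inner_commute)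
    then have "inner (snd q) (snd p) = inner (fst q) (fst p)"
      using span_minimal[OF _ sub, of ?A p] \<open>q \<in> span ?A\<close> by blast
    then show ?thesis by (simp only: inner_commute)
  qed
  have nrm: "norm (snd p) = norm (fst p)" if "p \<in> G" for p
  proof -
    have "closed {p :: 'n fock \<times> 'n fock. norm (snd p) = norm (fst p)}"
      by (intro closed_Collect_eq continuous_intros)
    moreover have "span ?A \<subseteq> {p. norm (snd p) = norm (fst p)}"
    proof
      fix p assume "p \<in> span ?A"
      from inn[OF this this] show "p \<in> {p. norm (snd p) = norm (fst p)}"
        unfolding norm_eq_sqrt_inner by simp
    qed
    ultimately have "G \<subseteq> {p. norm (snd p) = norm (fst p)}"
      unfolding G_def by (intro closure_minimal)
    then show ?thesis using that by auto
  qed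
  have fstG: "f \<in> fst ` G" for f
  proof (rule total_familyD[OF a])
    show "closed (fst ` G)" by (rule closed_fst_isometric[OF clG subG nrm])
    show "f + g \<in> fst ` G" if "f \<in> fst ` G" "g \<in> fst ` G" for f g
      using that subspace_add[OF subG] by force
    show "c *\<^sub>C f \<in> fst ` G" if "f \<in> fst ` G" for c f
      using that scG by force
    show "a i \<in> fst ` G" for i by (rule image_eqI[OF _ genG]) simp
  qed
  have sndG: "f \<in> snd ` G" for f
  proof (rule total_familyD[OF b])
    \<comment> \<open>Swapping the components turns surjectivity into the domain statement for the
      inverse graph, which is isometric as well.\<close>
    let ?s = "\<lambda>p :: 'n fock \<times> 'n fock. (snd p, fst p)"
    have s: "bounded_linear ?s"
      by (intro bounded_linear_Pair bounded_linear_fst bounded_linear_snd)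
    have "closed (fst ` ?s -` G)"
    proof (rule closed_fst_isometric)
      show "closed (?s -` G)"
        by (intro continuous_closed_vimage clG) (intro linear_continuous_at s)
      show "subspace (?s -` G)"
        by (rule linear_subspace_vimage[OF bounded_linear.linear[OF s] subG])
      show "norm (snd p) = norm (fst p)" if "p \<in> ?s -` G" for p
        using nrm[of "?s p"] that by simp
    qed
    moreover have "fst ` ?s -` G = snd ` G"
    proof (intro equalityI subsetI)
      fix x assume "x \<in> fst ` ?s -` G"
      then obtain p where "x = fst p" "?s p \<in> G" by blast
      then show "x \<in> snd ` G" by (intro image_eqI[of _ _ "?s p"]) simp_all
    next
      fix x assume "x \<in> snd ` G"
      then obtain p where "x = snd p" "p \<in> G" by blast
      then show "x \<in> fst ` ?s -` G" by (intro image_eqI[of _ _ "?s p"]) simp_all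
    qed
    ultimately show "closed (snd ` G)" by simp
    show "f + g \<in> snd ` G" if "f \<in> snd ` G" "g \<in> snd ` G" for f g
      using that subspace_add[OF subG] by force
    show "c *\<^sub>C f \<in> snd ` G" if "f \<in> snd ` G" for c f
      using that scG by force
    show "b i \<in> snd ` G" for i by (rule image_eqI[OF _ genG]) simp
  qed
  have uniq: "g = g'" if "(f, g) \<in> G" "(f, g') \<in> G" for f g g'
    using nrm[OF subspace_diff[OF subG that]] by simp
  have "\<exists>g. (f, g) \<in> G" for f using fstG[of f] by force
  then obtain U where U: "\<And>f. (f, U f) \<in> G" by metis
  have Ueq: "U f = g" if "(f, g) \<in> G" for f g using uniq[OF U that] .
  have add: "U (f + g) = U f + U g" for f g
    using subspace_add[OF subG U[of f] U[of g]] by (intro Ueq) simp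
  have scale: "U (c *\<^sub>C f) = c *\<^sub>C U f" for c f
    by (intro Ueq scG U)
  have normU: "norm (U f) = norm f" for f using nrm[OF U] by simp
  have bl: "bounded_linear U"
    by (rule bounded_linear_intro[of _ 1]) (simp_all add: add scaleR_scaleC scale normU)
  \<comment> \<open>Polarisation: the real inner product is expressed through norms of sums, which
    the additive map \<open>U\<close> preserves.\<close>
  have innU: "inner (U f) (U g) = inner f g" for f g
    by (simp add: dot_norm normU flip: add)
  have "cinner (U f) (U g) = cinner f g" for f g
    by (rule complex_eqI) (simp_all add: Im_cinner innU flip: inner_eq_Re_cinner scale)
  moreover have "surj U"
  proof (rule surjI)
    show "U (fst (SOME p. p \<in> G \<and> snd p = g)) = g" for g
    proof (rule Ueq)
      have "\<exists>p. p \<in> G \<and> snd p = g" using sndG[of g] by blast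
      from someI_ex[OF this] show "(fst (SOME p. p \<in> G \<and> snd p = g), g) \<in> G"
        by (metis prod.collapse)
    qed
  qed
  ultimately have "unitary U"
    unfolding unitary_def bounded_clinear_def using bl scale by blast
  then show "\<exists>U. unitary U \<and> (\<forall>i. U (a i) = b i)"
    using Ueq[OF genG] by blast
next
  show "U = V" if "unitary U \<and> (\<forall>i. U (a i) = b i)" "unitary V \<and> (\<forall>i. V (a i) = b i)" for U V
    using that unfolding unitary_def by (intro bounded_clinear_eq_on_total[OF a]) auto
qed

section \<open>Existence of the Weyl operators\<close>

lemma cdot_add_left: "cdot (u + v) w = cdot u w + cdot v w"
  by (simp add: cdot_def algebra_simps sum.distrib)

lemma cdot_add_right: "cdot w (u + v) = cdot w u + cdot w v"
  by (simp add: cdot_def algebra_simps sum.distrib)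

lemma cnj_cdot: "cnj (cdot u v) = cdot v u"
  by (simp add: cdot_def mult.commute)

lemma cdot_self: "cdot u u = complex_of_real ((norm u)\<^sup>2)"
proof -
  have "(norm u)\<^sup>2 = (\<Sum>i\<in>UNIV. (cmod (u $ i))\<^sup>2)"
    by (simp add: norm_vec_def L2_set_def sum_nonneg)
  moreover have "cnj z * z = complex_of_real ((cmod z)\<^sup>2)" for z
    by (metis complex_norm_square mult.commute of_real_power)
  ultimately show ?thesis by (simp add: cdot_def)
qed

text \<open>The prescribed images have the Gram matrix of the exponential vectors, the scalar factor
  compensating the translation by \<open>u\<close>. They are total because translating back and
  dividing by the nonzero factor recovers every exponential vector.\<close>

theorem
  fixes u :: "complex ^ 'n::finite"
  shows unitary_weyl: "unitary (weyl u)"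
    and weyl_exp_vec: "weyl u (exp_vec v) =
      exp (- complex_of_real ((norm u)\<^sup>2) / 2 - cdot u v) *\<^sub>C exp_vec (u + v)"
proof -
  let ?c = "\<lambda>v. exp (- complex_of_real ((norm u)\<^sup>2) / 2 - cdot u v)"
  have "total_family (\<lambda>v. ?c v *\<^sub>C exp_vec (u + v))"
    unfolding total_family_def
  proof (intro allI impI, elim conjE)
    fix X :: "'n fock set"
    assume X: "closed X" "\<forall>f\<in>X. \<forall>g\<in>X. f + g \<in> X" "\<forall>c. \<forall>f\<in>X. c *\<^sub>C f \<in> X"
      and r: "range (\<lambda>v. ?c v *\<^sub>C exp_vec (u + v)) \<subseteq> X"
    have "exp_vec v \<in> X" for v
    proof -
      have "?c (v - u) *\<^sub>C exp_vec (u + (v - u)) \<in> X" using r by blast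
      then have "(1 / ?c (v - u)) *\<^sub>C ?c (v - u) *\<^sub>C exp_vec (u + (v - u)) \<in> X" using X(3) by blast
      then show ?thesis by simp
    qed
    then show "X = UNIV" using total_familyD[OF total_family_exp_vec, of X] X by blast
  qed
  moreover have "cinner (?c v *\<^sub>C exp_vec (u + v)) (?c v' *\<^sub>C exp_vec (u + v')) =
      cinner (exp_vec v) (exp_vec v')" for v v'
    unfolding cinner_scaleC_left cinner_scaleC_right cinner_exp_vec exp_cnj mult_exp_exp
    by (rule arg_cong[where f = exp])
       (simp add: cdot_add_left cdot_add_right cnj_cdot cdot_self)
  ultimately have "\<exists>!W. unitary W \<and> (\<forall>v. W (exp_vec v) = ?c v *\<^sub>C exp_vec (u + v))"
    by (intro isometric_families_unitary total_family_exp_vec)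
  from theI'[OF this, folded weyl_def]
  show "unitary (weyl u)" "weyl u (exp_vec v) = ?c v *\<^sub>C exp_vec (u + v)" by blast+
qed

section \<open>Gaussian integrals and symmetric matrices\<close>

text \<open>The imaginary part of \<open>c\<close> is covered by the characteristic function of the
  standard normal law, and completing the square absorbs the real part by a real translation, so no
  contour has to be moved.\<close>

lemma gaussian_fourier_laplace:
  fixes \<gamma> :: real and c :: complex
  assumes "0 < \<gamma>"
  shows "has_bochner_integral lborel (\<lambda>x. exp (- complex_of_real (\<gamma> * x\<^sup>2) + c * complex_of_real x))
     (complex_of_real (sqrt (pi / \<gamma>)) * exp (c\<^sup>2 / complex_of_real (4 * \<gamma>)))"
proof -
  \<comment> \<open>Rescaling by \<open>s\<close> turns the exponent x^2/2 of the normal density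
    into \<gamma> x^2.\<close>
  define s where "s = sqrt (2 * \<gamma>)"
  have s: "s > 0" "s\<^sup>2 = 2 * \<gamma>" using assms by (simp_all add: s_def)
  define a b where "a = Re c" and "b = Im c"
  have c: "c = Complex a b" by (simp add: a_def b_def)
  let ?h = "\<lambda>x. std_normal_density x *\<^sub>R iexp (b / s * x)"
  let ?g = "\<lambda>x. exp (- complex_of_real (\<gamma> * x\<^sup>2) + c * complex_of_real x)"
  let ?k = "exp (- complex_of_real (a\<^sup>2 / (4 * \<gamma>)) - \<i> * complex_of_real (a * b / (2 * \<gamma>))) / sqrt (2 * pi)"
  have int: "integrable lborel ?h"
  proof -
    interpret prob_space std_normal_distribution by (rule prob_space_normal_density) simp
    have "integrable std_normal_distribution (\<lambda>x. iexp (b / s * x))"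
      by (rule integrable_iexp) simp_all
    then show ?thesis by (subst (asm) integrable_density) simp_all
  qed
  have val: "integral\<^sup>L lborel ?h = exp (- complex_of_real (b\<^sup>2 / (4 * \<gamma>)))"
  proof -
    have "integral\<^sup>L lborel ?h = char std_normal_distribution (b / s)"
      unfolding char_def by (subst integral_density) simp_all
    also have "\<dots> = exp (- complex_of_real (b\<^sup>2 / (4 * \<gamma>)))"
      unfolding char_std_normal_distribution using s(2)
      by (simp add: power_divide flip: exp_of_real)
    finally show ?thesis .
  qed
  have shift: "?h (- a / s + s * x) = ?k * ?g x" for x
  proof -
    have "(- a / s + s * x)\<^sup>2 = a\<^sup>2 / s\<^sup>2 - 2 * a * x + s\<^sup>2 * x\<^sup>2"
      using s(1) by (simp add: power2_eq_square field_simps)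
    then have "(- a / s + s * x)\<^sup>2 / 2 = a\<^sup>2 / (4 * \<gamma>) - a * x + \<gamma> * x\<^sup>2"
      unfolding s(2) by simp
    then have 1: "- (- a / s + s * x)\<^sup>2 / 2 = - (a\<^sup>2 / (4 * \<gamma>)) + a * x - \<gamma> * x\<^sup>2"
      by simp
    have "b / s * (- a / s + s * x) = - (a * b / s\<^sup>2) + b * x"
      using s(1) by (simp add: field_simps power2_eq_square)
    then have 2: "b / s * (- a / s + s * x) = - (a * b / (2 * \<gamma>)) + b * x"
      unfolding s(2) .
    have "?h (- a / s + s * x) = (1 / sqrt (2 * pi)) *
       exp (complex_of_real (- (a\<^sup>2 / (4 * \<gamma>)) + a * x - \<gamma> * x\<^sup>2) +
            \<i> * complex_of_real (- (a * b / (2 * \<gamma>)) + b * x))"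
      unfolding std_normal_density_def 1 2
      by (simp only: scaleR_conv_of_real of_real_mult exp_add exp_of_real mult.assoc)
    also have "complex_of_real (- (a\<^sup>2 / (4 * \<gamma>)) + a * x - \<gamma> * x\<^sup>2) +
            \<i> * complex_of_real (- (a * b / (2 * \<gamma>)) + b * x) =
        (- complex_of_real (a\<^sup>2 / (4 * \<gamma>)) - \<i> * complex_of_real (a * b / (2 * \<gamma>))) +
        (- complex_of_real (\<gamma> * x\<^sup>2) + c * complex_of_real x)"
      by (simp add: c complex_eq_iff)
    finally show ?thesis unfolding exp_add by simp
  qed
  have int': "integrable lborel ?g" and val': "integral\<^sup>L lborel ?h = s *\<^sub>R (?k * integral\<^sup>L lborel ?g)"
  proof -
    have k: "?k \<noteq> 0" by simp
    have "integrable lborel (\<lambda>x. ?h (- a / s + s * x))"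
      using s by (intro lborel_integrable_real_affine int) simp
    then have "integrable lborel (\<lambda>x. ?k * ?g x)" by (simp only: shift)
    then have "integrable lborel (\<lambda>x. (1 / ?k) * (?k * ?g x))" by (rule integrable_mult_right)
    then show "integrable lborel ?g"
      unfolding mult.assoc[symmetric] nonzero_divide_eq_eq[OF k, THEN iffD1, OF refl] by simp
    have "integral\<^sup>L lborel ?h = \<bar>s\<bar> *\<^sub>R integral\<^sup>L lborel (\<lambda>x. ?h (- a / s + s * x))"
      using s(1) by (intro lborel_integral_real_affine) simp
    then show "integral\<^sup>L lborel ?h = s *\<^sub>R (?k * integral\<^sup>L lborel ?g)"
      unfolding shift integral_mult_right_zero using s(1) by simp
  qed
  have "sqrt (pi / \<gamma>) = sqrt (2 * pi) / s"
    unfolding s_def by (simp flip: real_sqrt_divide)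
  moreover have "I = complex_of_real (r / s) * (e1 / e2)"
    if "e1 = s *\<^sub>R (e2 / complex_of_real r * I)" "e2 \<noteq> 0" "r \<noteq> 0" for I e1 e2 :: complex and r
    using that s(1) by (simp add: scaleR_conv_of_real)
  from this[OF val[symmetric, THEN trans, OF val']] have "integral\<^sup>L lborel ?g = complex_of_real (sqrt (2 * pi) / s) *
      (exp (- complex_of_real (b\<^sup>2 / (4 * \<gamma>))) /
       exp (- complex_of_real (a\<^sup>2 / (4 * \<gamma>)) - \<i> * complex_of_real (a * b / (2 * \<gamma>))))"
    by simp
  ultimately have "integral\<^sup>L lborel ?g = complex_of_real (sqrt (pi / \<gamma>)) *
      (exp (- complex_of_real (b\<^sup>2 / (4 * \<gamma>))) /
       exp (- complex_of_real (a\<^sup>2 / (4 * \<gamma>)) - \<i> * complex_of_real (a * b / (2 * \<gamma>))))"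
    by simp
  also have "exp (- complex_of_real (b\<^sup>2 / (4 * \<gamma>))) /
       exp (- complex_of_real (a\<^sup>2 / (4 * \<gamma>)) - \<i> * complex_of_real (a * b / (2 * \<gamma>))) =
       exp (c\<^sup>2 / complex_of_real (4 * \<gamma>))"
    unfolding exp_diff[symmetric]
    by (rule arg_cong[where f = exp])
       (use assms in \<open>simp add: c Complex_eq field_simps power2_eq_square complex_eq_iff\<close>)
  finally show ?thesis using int' by (simp add: has_bochner_integral_iff)
qed

text \<open>Lebesgue measure on a Euclidean space is the image of a product measure indexed by
  \<open>Basis\<close>; the unit vectors \<open>axis i 1\<close> translate between coordinates and
  basis elements.\<close>

lemma has_bochner_integral_prod_vec:
  fixes f :: "'m::finite \<Rightarrow> real \<Rightarrow> 'a::{real_normed_field, banach, second_countable_topology}"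
  assumes "\<And>i. has_bochner_integral lborel (f i) (I i)"
  shows "has_bochner_integral lborel (\<lambda>x :: real ^ 'm. \<Prod>i\<in>UNIV. f i (x $ i)) (\<Prod>i\<in>UNIV. I i)"
proof -
  interpret product_sigma_finite "\<lambda>_ :: real ^ 'm. lborel :: real measure" ..
  have inj: "inj (\<lambda>i :: 'm. axis i (1 :: real))" by (rule injI) (simp add: axis_eq_axis)
  have Basis: "Basis = range (\<lambda>i :: 'm. axis i (1 :: real))" by (auto simp: Basis_vec_def)
  define F where "F b = f (inv (\<lambda>i :: 'm. axis i (1 :: real)) b)" for b
  have F: "F (axis i 1) = f i" for i by (simp add: F_def inv_f_f[OF inj])
  let ?T = "\<lambda>y. \<Sum>b\<in>Basis. y b *\<^sub>R b :: real ^ 'm"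
  have comp: "?T y $ i = y (axis i 1)" for y i
    unfolding cart_eq_inner_axis by (rule inner_sum_left_Basis) (simp add: Basis)
  have eq: "(\<Prod>i\<in>UNIV. f i (?T y $ i)) = (\<Prod>b\<in>Basis. F b (y b))" for y
    unfolding comp by (simp add: Basis prod.reindex[OF inj] o_def F)
  have intF: "integrable lborel (F b)" if "b \<in> Basis" for b
    using that assms by (auto simp: Basis F has_bochner_integral_iff)
  have [measurable]: "f i \<in> borel_measurable borel" for i
    using assms[of i] by (auto dest!: has_bochner_integral_iff[THEN iffD1] borel_measurable_integrable)
  have meas: "(\<lambda>x :: real ^ 'm. \<Prod>i\<in>UNIV. f i (x $ i)) \<in> borel_measurable borel"
  proof (rule borel_measurable_prod)
    fix i
    have "(\<lambda>x :: real ^ 'm. x $ i) \<in> borel_measurable borel"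
      by (intro borel_measurable_continuous_onI continuous_intros)
    then show "(\<lambda>x :: real ^ 'm. f i (x $ i)) \<in> borel_measurable borel"
      by (rule measurable_compose) measurable
  qed
  have mT: "?T \<in> measurable (\<Pi>\<^sub>M b\<in>Basis. lborel) borel"
    by measurable
  show ?thesis
  proof (rule has_bochner_integral_iff[THEN iffD2], intro conjI)
    show "integrable lborel (\<lambda>x :: real ^ 'm. \<Prod>i\<in>UNIV. f i (x $ i))"
      unfolding lborel_eq[where 'a = "real ^ 'm"] integrable_distr_eq[OF mT meas] eq
      by (rule product_integrable_prod) (simp_all add: intF)
    have "(\<integral>x. (\<Prod>i\<in>UNIV. f i (x $ i)) \<partial>(lborel :: (real ^ 'm) measure)) = (\<Prod>b\<in>Basis. integral\<^sup>L lborel (F b))"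
      unfolding lborel_eq[where 'a = "real ^ 'm"]
        integral_distr[OF mT meas] eq
      by (rule product_integral_prod) (simp_all add: intF)
    also have "\<dots> = (\<Prod>i\<in>UNIV. I i)"
      using assms by (simp add: Basis prod.reindex[OF inj] o_def F has_bochner_integral_iff)
    finally show "(\<integral>x. (\<Prod>i\<in>UNIV. f i (x $ i)) \<partial>(lborel :: (real ^ 'm) measure)) = (\<Prod>i\<in>UNIV. I i)" .
  qed
qed

section \<open>Rotation invariance of Lebesgue measure\<close>

text \<open>Uniqueness of Haar measure: both sides below are compared with the (rotation invariant) volume
  of the unit ball.\<close>

lemma lborel_distr_orthogonal:
  fixes f :: "'a::euclidean_space \<Rightarrow> 'a"
  assumes "orthogonal_transformation f"
  shows "distr lborel borel f = lborel"
proof (rule measure_eqI)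
  have lin: "linear f" using assms by (rule orthogonal_transformation_linear)
  have [measurable]: "f \<in> borel_measurable borel"
    by (intro borel_measurable_continuous_onI linear_continuous_on linear_conv_bounded_linear[THEN iffD1] lin)
  obtain g where g: "\<And>y. f (g y) = y"
    using orthogonal_transformation_surj[OF assms] by (metis surj_def)
  define u :: "'a \<Rightarrow> ennreal" where "u = indicator (cball 0 1)"
  have [measurable]: "u \<in> borel_measurable borel" 
    unfolding u_def by (rule borel_measurable_indicator) simp
  have uf: "u (f x) = u x" for x
    using orthogonal_transformation_norm[OF assms, of x] by (simp add: u_def indicator_def)
  have um: "u (- x) = u x" for x by (simp add: u_def indicator_def)
  let ?c = "\<integral>\<^sup>+ x. u x \<partial>lborel"
  have c: "?c = emeasure lborel (cball (0::'a) 1)" by (simp add: u_def)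
  have c0: "?c \<noteq> 0"
    unfolding c using content_cball_gt_0_iff[of "0::'a" 1] by (metis measure_def enn2real_0 less_irrefl zero_less_one)
  have cinf: "?c \<noteq> \<infinity>" 
    unfolding c using emeasure_lborel_cball_finite[of "0::'a" 1] by (simp add: less_top)
  have trans: "(\<integral>\<^sup>+ x. h (x + t) \<partial>lborel) = (\<integral>\<^sup>+ x. h x \<partial>lborel)"
    if [measurable]: "h \<in> borel_measurable borel" for h :: "'a \<Rightarrow> ennreal" and t
    using nn_integral_distr[of "(+) t" lborel borel h] by (simp add: lborel_distr_plus add.commute)
  fix A assume "A \<in> sets (distr lborel borel f)"
  then have [measurable]: "A \<in> sets borel" by simp
  let ?F = "indicator A :: 'a \<Rightarrow> ennreal"
  \<comment> \<open>The same double integral is computed twice. Integrating over \<open>t\<close>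
    first gives the image measure of \<open>A\<close> times the ball volume. Integrating over
    \<open>s\<close> first, the translation by \<open>g t\<close> brings the ball back to the
    origin, where \<open>f\<close> preserves it, and a second exchange leaves the plain measure of
    \<open>A\<close>.\<close>
  have "?c * (\<integral>\<^sup>+ s. ?F (f s) \<partial>lborel) = (\<integral>\<^sup>+ s. (\<integral>\<^sup>+ t. ?F (f s) * u (t - f s) \<partial>lborel) \<partial>lborel)"
  proof -
    have "(\<integral>\<^sup>+ t. ?F (f s) * u (t - f s) \<partial>lborel) = ?F (f s) * ?c" for s
      using trans[of u "- f s"] by (simp add: nn_integral_cmult)
    then have "(\<integral>\<^sup>+ s. (\<integral>\<^sup>+ t. ?F (f s) * u (t - f s) \<partial>lborel) \<partial>lborel) = (\<integral>\<^sup>+ s. ?F (f s) * ?c \<partial>lborel)"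
      by simp
    also have "\<dots> = (\<integral>\<^sup>+ s. ?F (f s) \<partial>lborel) * ?c" by (rule nn_integral_multc) measurable
    finally show ?thesis by (simp only: mult.commute)
  qed
  also have "\<dots> = (\<integral>\<^sup>+ t. (\<integral>\<^sup>+ s. ?F (f s) * u (t - f s) \<partial>lborel) \<partial>lborel)"
    by (rule lborel_pair.Fubini') measurable
  also have "\<dots> = (\<integral>\<^sup>+ t. (\<integral>\<^sup>+ s. ?F (f s + t) * u s \<partial>lborel) \<partial>lborel)"
  proof (rule nn_integral_cong)
    fix t
    have "(\<integral>\<^sup>+ s. ?F (f s) * u (t - f s) \<partial>lborel) = (\<integral>\<^sup>+ s. ?F (f (s + g t)) * u (t - f (s + g t)) \<partial>lborel)"
      by (rule trans[symmetric]) measurable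
    also have "\<dots> = (\<integral>\<^sup>+ s. ?F (f s + t) * u s \<partial>lborel)"
      by (intro nn_integral_cong) (simp add: linear_add[OF lin] g um uf)
    finally show "(\<integral>\<^sup>+ s. ?F (f s) * u (t - f s) \<partial>lborel) = (\<integral>\<^sup>+ s. ?F (f s + t) * u s \<partial>lborel)" .
  qed
  also have "\<dots> = (\<integral>\<^sup>+ s. (\<integral>\<^sup>+ t. ?F (f s + t) * u s \<partial>lborel) \<partial>lborel)"
    by (rule lborel_pair.Fubini') measurable
  also have "\<dots> = ?c * (\<integral>\<^sup>+ t. ?F t \<partial>lborel)"
  proof -
    have "(\<integral>\<^sup>+ t. ?F (f s + t) * u s \<partial>lborel) = (\<integral>\<^sup>+ t. ?F t \<partial>lborel) * u s" for s
      using trans[of ?F "f s"] by (simp add: nn_integral_multc add.commute)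
    then have "(\<integral>\<^sup>+ s. (\<integral>\<^sup>+ t. ?F (f s + t) * u s \<partial>lborel) \<partial>lborel) = (\<integral>\<^sup>+ s. (\<integral>\<^sup>+ t. ?F t \<partial>lborel) * u s \<partial>lborel)"
      by simp
    also have "\<dots> = (\<integral>\<^sup>+ t. ?F t \<partial>lborel) * ?c" by (rule nn_integral_cmult) measurable
    finally show ?thesis by (simp only: mult.commute)
  qed
  finally have "(\<integral>\<^sup>+ s. ?F (f s) \<partial>lborel) = (\<integral>\<^sup>+ t. ?F t \<partial>lborel)"
    using c0 cinf by (simp add: ennreal_mult_cancel_left)
  moreover have "emeasure (distr lborel borel f) A = (\<integral>\<^sup>+ s. ?F (f s) \<partial>lborel)"
    by (subst nn_integral_indicator[symmetric], simp, subst nn_integral_distr) simp_all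
  ultimately show "emeasure (distr lborel borel f) A = emeasure lborel A" by simp
qed simp

section \<open>Spectral theorem for real symmetric matrices\<close>

lemma self_adjoint_orthonormal_eigenbasis:
  fixes f :: "'a::euclidean_space \<Rightarrow> 'a"
  assumes lin: "linear f" and sym: "\<And>x y. inner (f x) y = inner x (f y)"
    and "subspace V" "f ` V \<subseteq> V"
  shows "\<exists>B\<subseteq>V. pairwise orthogonal B \<and> (\<forall>b\<in>B. norm b = 1 \<and> (\<exists>d. f b = d *\<^sub>R b)) \<and> span B = V"
  using assms(3,4)
proof (induction "dim V" arbitrary: V rule: less_induct)
  case less
  show ?case
  proof (cases "V \<subseteq> {0}")
    case True
    then have "V = {0}" using subspace_0[OF less.prems(1)] by auto
    then show ?thesis by (intro exI[of _ "{}"]) auto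
  next
    case False
    \<comment> \<open>The first eigenvector is a maximiser of the quadratic form on the unit sphere
      of \<open>V\<close>, which is compact.\<close>
    let ?K = "V \<inter> sphere 0 1"
    have K: "compact ?K"
      by (intro closed_Int_compact closed_subspace less.prems) simp
    from False obtain x where x: "x \<in> V" "x \<noteq> 0" by auto
    then have "(1 / norm x) *\<^sub>R x \<in> ?K" using subspace_scale[OF less.prems(1)] by simp
    then have ne: "?K \<noteq> {}" by blast
    have "continuous_on ?K (\<lambda>x. inner x (f x))"
      by (intro continuous_intros linear_continuous_on linear_conv_bounded_linear[THEN iffD1] lin)
    from continuous_attains_sup[OF K ne this] obtain v where
      v: "v \<in> V" "norm v = 1" and max: "\<And>x. x \<in> V \<Longrightarrow> norm x = 1 \<Longrightarrow> inner x (f x) \<le> inner v (f v)"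
      by auto
    define M where "M = inner v (f v)"
    have bound: "inner x (f x) \<le> M * (norm x)\<^sup>2" if "x \<in> V" for x
    proof (cases "x = 0")
      case False
      have "inner ((1 / norm x) *\<^sub>R x) (f ((1 / norm x) *\<^sub>R x)) \<le> M"
        unfolding M_def using False by (intro max subspace_scale less.prems that) simp
      then have "inner x (f x) / (norm x)\<^sup>2 \<le> M"
        by (simp add: linear_scale[OF lin] power2_eq_square)
      then show ?thesis using False by (simp add: divide_le_eq)
    qed (simp add: linear_0[OF lin])
    \<comment> \<open>A maximiser is a critical point: moving from \<open>v\<close> in an orthogonal
      direction \<open>w\<close> changes the form to first order by \<open>2 * t * p\<close>, while
      the bound allows only second order, which forces \<open>p = 0\<close>.\<close>
    have orth: "inner w (f v) = 0" if w: "w \<in> V" "inner w v = 0" for w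
    proof -
      define p q where "p = inner w (f v)" and "q = M * (norm w)\<^sup>2 - inner w (f w)"
      have *: "2 * t * p \<le> t\<^sup>2 * q" for t
      proof -
        have "v + t *\<^sub>R w \<in> V" by (intro subspace_add subspace_scale less.prems v w)
        from bound[OF this] have
          "inner v (f v) + t * inner v (f w) + t * inner w (f v) + t\<^sup>2 * inner w (f w) \<le> M * (norm (v + t *\<^sub>R w))\<^sup>2"
          by (simp add: linear_add[OF lin] linear_scale[OF lin] inner_add_left inner_add_right algebra_simps power2_eq_square)
        moreover have "(norm (v + t *\<^sub>R w))\<^sup>2 = 1 + t\<^sup>2 * (norm w)\<^sup>2"
          using w(2) v(2) unfolding power2_norm_eq_inner norm_eq_1
          by (simp add: inner_add_left inner_add_right inner_commute[of v w] power2_eq_square)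
        moreover have "inner v (f w) = inner w (f v)"
          by (metis inner_commute sym)
        ultimately show ?thesis by (simp add: p_def q_def M_def algebra_simps)
      qed
      have "p = 0"
      proof (rule ccontr)
        assume p: "p \<noteq> 0"
        \<comment> \<open>This \<open>t\<close> has the sign of \<open>p\<close> and is so small
          that the quadratic term is at most half the linear one; adding 1 keeps the denominator
          positive.\<close>
        define t where "t = p / (\<bar>q\<bar> + 1)"
        have "2 * t * p \<le> t\<^sup>2 * (\<bar>q\<bar> + 1)"
        proof (rule order_trans[OF *])
          have "q \<le> \<bar>q\<bar> + 1" by linarith
          then show "t\<^sup>2 * q \<le> t\<^sup>2 * (\<bar>q\<bar> + 1)" by (rule mult_left_mono) simp
        qed
        also have "\<dots> = t * p" by (simp add: t_def power2_eq_square)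
        finally have "t * p \<le> 0" by (simp add: mult.commute)
        moreover have "t * p > 0"
          using p by (simp add: t_def power2_eq_square[symmetric])
        ultimately show False by simp
      qed
      then show ?thesis by (simp add: p_def)
    qed
    have fv: "f v = M *\<^sub>R v"
    proof -
      let ?w = "f v - M *\<^sub>R v"
      have "?w \<in> V" using less.prems v by (intro subspace_diff subspace_scale) auto
      moreover have wv: "inner ?w v = 0"
        using v(2) by (simp add: inner_diff_left M_def inner_commute[of "f v"] norm_eq_1)
      ultimately have "inner ?w (f v) = 0" by (rule orth)
      then have "inner ?w ?w = 0" using wv by (simp add: inner_diff_right)
      then show ?thesis by simp
    qed
    \<comment> \<open>Self-adjointness keeps the complement of the eigenvector invariant, and its
      dimension is smaller.\<close>
    let ?W = "V \<inter> {x. orthogonal v x}"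
    have W: "subspace ?W" by (intro subspace_inter less.prems subspace_orthogonal_to_vector)
    have "f ` ?W \<subseteq> ?W"
    proof
      fix y assume "y \<in> f ` ?W"
      then obtain x where x: "y = f x" "x \<in> V" "inner v x = 0" by (auto simp: orthogonal_def)
      have "inner v (f x) = M * inner v x" by (metis sym fv inner_scaleR_left)
      then show "y \<in> ?W" using x less.prems(2) by (auto simp: orthogonal_def)
    qed
    moreover have "dim ?W < dim V"
    proof (rule dim_psubset)
      have "v \<notin> ?W" using v(2) by (auto simp: orthogonal_def)
      then have "?W \<subset> V" using v(1) by blast
      then show "span ?W \<subset> span V"
        unfolding span_eq_iff[THEN iffD2, OF W] span_eq_iff[THEN iffD2, OF less.prems(1)] .
    qed
    ultimately obtain B where B: "B \<subseteq> ?W" "pairwise orthogonal B"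
      "\<And>b. b \<in> B \<Longrightarrow> norm b = 1 \<and> (\<exists>d. f b = d *\<^sub>R b)" "span B = ?W"
      using less.hyps[OF _ W] by blast
    have "span (insert v B) = V"
    proof
      show "span (insert v B) \<subseteq> V" using v(1) B(1) less.prems(1) by (intro span_minimal) auto
      show "V \<subseteq> span (insert v B)"
      proof
        fix x assume x: "x \<in> V"
        have "x - inner v x *\<^sub>R v \<in> ?W"
          using x v less.prems(1)
          by (auto simp: orthogonal_def inner_diff_right norm_eq_1 intro: subspace_diff subspace_scale)
        then have "x - inner v x *\<^sub>R v \<in> span B" using B(4) by simp
        then show "x \<in> span (insert v B)" by (auto simp: span_insert)
      qed
    qed
    moreover have "pairwise orthogonal (insert v B)"
      using B(1,2) by (auto simp: pairwise_insert orthogonal_commute)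
    ultimately show ?thesis
      using v fv B(1,3) by (intro exI[of _ "insert v B"]) auto
  qed
qed

lemma symmetric_matrix_diagonalize:
  fixes A :: "real ^ 'm ^ 'm"
  assumes "transpose A = A"
  obtains Q d where "orthogonal_matrix Q" "A = Q ** (\<chi> i j. if i = j then d i else 0) ** transpose Q"
proof -
  have lin: "linear ((*v) A)" by simp
  have sym: "inner (A *v x) y = inner x (A *v y)" for x y
    using assms by (metis dot_lmul_matrix inner_commute transpose_matrix_vector)
  obtain B where B: "pairwise orthogonal B" "\<And>b. b \<in> B \<Longrightarrow> norm b = 1" "\<And>b. b \<in> B \<Longrightarrow> \<exists>d. A *v b = d *\<^sub>R b"
      "span B = UNIV"
    using self_adjoint_orthonormal_eigenbasis[OF lin sym subspace_UNIV] by blast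
  have "0 \<notin> B" using B(2) by force
  then have ind: "independent B" by (rule pairwise_orthogonal_independent[OF B(1)])
  then have "card B = CARD('m)"
    using dim_eq_card_independent[OF ind] B(4) dim_span[of B] by simp
  moreover have "finite B" by (rule independent_imp_finite[OF ind])
  ultimately obtain b where b: "bij_betw b (UNIV :: 'm set) B"
    using finite_same_card_bij[of "UNIV :: 'm set" B] by auto
  then have bB: "b i \<in> B" for i by (auto simp: bij_betw_def)
  have inn: "inner (b i) (b j) = (if i = j then 1 else 0)" for i j
  proof (cases "i = j")
    case True
    then show ?thesis using B(2)[OF bB[of i]] by (simp add: norm_eq_1)
  next
    case False
    then have "b i \<noteq> b j" using b by (auto simp: bij_betw_def inj_eq)
    then show ?thesis using B(1) bB False unfolding pairwise_def orthogonal_def by auto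
  qed
  obtain d where d: "\<And>i. A *v b i = d i *\<^sub>R b i" using B(3)[OF bB] by metis
  define Q :: "real ^ 'm ^ 'm" where "Q = (\<chi> k i. b i $ k)"
  let ?D = "(\<chi> i j. if i = j then d i else 0) :: real ^ 'm ^ 'm"
  have "transpose Q ** Q = mat 1"
    using inn by (simp add: Q_def vec_eq_iff matrix_matrix_mult_def transpose_def mat_def inner_vec_def)
  then have Q: "orthogonal_matrix Q" by (simp add: orthogonal_matrix)
  have "(A ** Q) $ k $ i = (Q ** ?D) $ k $ i" for k i
    using arg_cong[OF d[of i], of "\<lambda>x. x $ k"]
    by (simp add: Q_def matrix_matrix_mult_def matrix_vector_mult_def if_distrib[of "\<lambda>t. _ * t"] mult.commute cong: if_cong)
  then have "A ** Q = Q ** ?D" by (simp add: vec_eq_iff)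
  then have "A = Q ** ?D ** transpose Q"
    using Q unfolding orthogonal_matrix_def by (metis matrix_mul_assoc matrix_mul_rid)
  then show ?thesis using that Q by blast
qed

section \<open>Orthogonal conjugates of diagonal matrices\<close>

abbreviation diag_mat :: "('m \<Rightarrow> real) \<Rightarrow> real ^ 'm ^ 'm" where
  "diag_mat d \<equiv> (\<chi> i j. if i = j then d i else 0)"

lemma diag_mat_vec: "diag_mat d *v y = (\<chi> i. d i * y $ i)"
  by (simp add: vec_eq_iff matrix_vector_mult_def if_distrib[of "\<lambda>t. t * _"] cong: if_cong)

lemma diag_mat_mult: "diag_mat d ** diag_mat e = diag_mat (\<lambda>i. d i * e i)"
  by (auto simp: vec_eq_iff matrix_matrix_mult_def if_distrib[of "\<lambda>t. t * _"] cong: if_cong)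

lemma matrix_diff_ldistrib: "A ** (B - C) = A ** B - A ** C"
  for A :: "'a::ring_1 ^ 'n ^ 'm" and B C :: "'a ^ 'k ^ 'n"
  by (simp add: vec_eq_iff matrix_matrix_mult_def right_diff_distrib sum_subtractf)

lemma matrix_diff_rdistrib: "(A - B) ** C = A ** C - B ** C"
  for A B :: "'a::ring_1 ^ 'n ^ 'm" and C :: "'a ^ 'k ^ 'n"
  by (simp add: vec_eq_iff matrix_matrix_mult_def left_diff_distrib sum_subtractf)

lemma orthogonal_conj_mat:
  assumes "orthogonal_matrix Q"
  shows "Q ** diag_mat (\<lambda>_. t) ** transpose Q = mat t"
proof -
  have "diag_mat (\<lambda>_. t) = t *\<^sub>R (mat 1 :: real ^ 'a ^ 'a)"
    by (simp add: vec_eq_iff mat_def)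
  then have "Q ** diag_mat (\<lambda>_. t) ** transpose Q = t *\<^sub>R (Q ** transpose Q)"
    by (simp add: scalar_matrix_assoc[symmetric] matrix_scalar_ac flip: scalar_mult_eq_scaleR)
  also have "\<dots> = mat t"
    using assms by (simp add: orthogonal_matrix_def vec_eq_iff mat_def)
  finally show ?thesis .
qed

lemma orthogonal_conj_diff_mat:
  assumes "orthogonal_matrix Q"
  shows "Q ** diag_mat d ** transpose Q - mat t = Q ** diag_mat (\<lambda>i. d i - t) ** transpose Q"
proof -
  have "diag_mat (\<lambda>i. d i - t) = diag_mat d - diag_mat (\<lambda>_. t)"
    by (simp add: vec_eq_iff)
  then show ?thesis
    unfolding orthogonal_conj_mat[OF assms, of t, symmetric]
    by (simp add: matrix_diff_ldistrib matrix_diff_rdistrib)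
qed

lemma det_mat_diff_orthogonal_conj:
  fixes Q :: "real ^ 'm ^ 'm"
  assumes "orthogonal_matrix Q"
  shows "det (mat t - Q ** diag_mat d ** transpose Q) = (\<Prod>i\<in>UNIV. t - d i)"
proof -
  have "mat t - Q ** diag_mat d ** transpose Q = Q ** diag_mat (\<lambda>i. t - d i) ** transpose Q"
  proof -
    have "diag_mat (\<lambda>i. t - d i) = diag_mat (\<lambda>_. t) - diag_mat d" by (simp add: vec_eq_iff)
    then show ?thesis
      unfolding orthogonal_conj_mat[OF assms, of t, symmetric]
      by (simp add: matrix_diff_ldistrib matrix_diff_rdistrib)
  qed
  then have "det (mat t - Q ** diag_mat d ** transpose Q) = (det Q)\<^sup>2 * det (diag_mat (\<lambda>i. t - d i))"
    by (simp add: det_mul power2_eq_square mult_ac)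
  moreover have "(det Q)\<^sup>2 = 1" using det_orthogonal_matrix[OF assms] by auto
  ultimately show ?thesis by (simp add: det_diagonal)
qed

lemma trace_sq_orthogonal_conj:
  fixes Q :: "real ^ 'm ^ 'm"
  assumes Q: "orthogonal_matrix Q" and A: "A = Q ** diag_mat d ** transpose Q"
  shows "trace (A ** A) = (\<Sum>i\<in>UNIV. (d i)\<^sup>2)"
proof -
  have "A ** A = Q ** (diag_mat d ** (transpose Q ** Q) ** diag_mat d ** transpose Q)"
    unfolding A by (simp add: matrix_mul_assoc)
  also have "\<dots> = Q ** (diag_mat (\<lambda>i. d i * d i) ** transpose Q)"
    using Q by (simp add: orthogonal_matrix_def diag_mat_mult)
  finally have "trace (A ** A) = trace (Q ** (diag_mat (\<lambda>i. d i * d i) ** transpose Q))"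
    by simp
  also have "\<dots> = trace ((diag_mat (\<lambda>i. d i * d i) ** transpose Q) ** Q)"
    by (rule trace_mul_sym)
  also have "(diag_mat (\<lambda>i. d i * d i) ** transpose Q) ** Q = diag_mat (\<lambda>i. d i * d i)"
    using Q by (simp add: orthogonal_matrix_def flip: matrix_mul_assoc)
  finally show ?thesis by (simp add: trace_def power2_eq_square)
qed

lemma inner_orthogonal_conj:
  fixes Q :: "real ^ 'm ^ 'm"
  shows "x \<bullet> ((Q ** diag_mat d ** transpose Q) *v x) = (\<Sum>i\<in>UNIV. d i * ((transpose Q *v x) $ i)\<^sup>2)"
proof -
  have "x \<bullet> ((Q ** diag_mat d ** transpose Q) *v x) = (transpose Q *v x) \<bullet> (diag_mat d *v (transpose Q *v x))"
    by (simp only: matrix_vector_mul_assoc[symmetric] transpose_matrix_vector dot_lmul_matrix)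
  then show ?thesis by (simp add: diag_mat_vec inner_vec_def power2_eq_square mult_ac)
qed

text \<open>Rotating the variable by the transpose of \<open>Q\<close> leaves Lebesgue measure
  unchanged and splits the integrand into one-dimensional Gaussians.\<close>

lemma gaussian_integral_orthogonal_conj:
  fixes Q :: "real ^ 'm ^ 'm"
  assumes Q: "orthogonal_matrix Q" and d: "\<And>i. 0 < d i"
  shows "has_bochner_integral lborel (\<lambda>x. exp (- (x \<bullet> ((Q ** diag_mat d ** transpose Q) *v x))))
     (\<Prod>i\<in>UNIV. sqrt (pi / d i))"
proof -
  have "has_bochner_integral lborel (\<lambda>x. exp (- (d i * x\<^sup>2))) (sqrt (pi / d i))" for i
    using has_bochner_integral_Re[OF gaussian_fourier_laplace[OF d, of i 0]]
    by (simp add: Re_exp)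
  from has_bochner_integral_prod_vec[OF this]
  have "has_bochner_integral lborel (\<lambda>y :: real ^ 'm. exp (- (\<Sum>i\<in>UNIV. d i * (y $ i)\<^sup>2))) (\<Prod>i\<in>UNIV. sqrt (pi / d i))"
    by (simp add: exp_sum sum_negf[symmetric])
  moreover have T: "distr lborel borel ((*v) (transpose Q)) = (lborel :: (real ^ 'm) measure)"
    using Q by (intro lborel_distr_orthogonal) (simp add: orthogonal_transformation_matrix orthogonal_matrix_transpose)
  ultimately have "has_bochner_integral (distr lborel borel ((*v) (transpose Q)))
      (\<lambda>y :: real ^ 'm. exp (- (\<Sum>i\<in>UNIV. d i * (y $ i)\<^sup>2))) (\<Prod>i\<in>UNIV. sqrt (pi / d i))"
    by simp
  moreover have "(\<lambda>y :: real ^ 'm. exp (- (\<Sum>i\<in>UNIV. d i * (y $ i)\<^sup>2))) \<in> borel_measurable borel"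
    by (intro borel_measurable_continuous_onI continuous_intros)
  moreover have "(*v) (transpose Q) \<in> borel_measurable borel"
    by (intro borel_measurable_continuous_onI linear_continuous_on matrix_vector_mul_bounded_linear)
  ultimately show ?thesis
    unfolding inner_orthogonal_conj by (simp add: has_bochner_integral_iff integrable_distr_eq integral_distr)
qed

text \<open>Both products are the same polynomial, so its roots agree with multiplicity. Sums and
  products over the diagonal entries can then be rewritten over the ordered eigenvalues without an
  explicit bijection.\<close>

lemma multiset_eq_of_linear_factors:
  fixes d :: "'i \<Rightarrow> real" and e :: "'j \<Rightarrow> real"
  assumes "finite A" "finite B" "\<And>t. (\<Prod>i\<in>A. t - d i) = (\<Prod>j\<in>B. t - e j)"
  shows "image_mset d (mset_set A) = image_mset e (mset_set B)"
proof -
  have *: "proots (\<Prod>i\<in>A. [:- d i, 1:]) = image_mset d (mset_set A)" if "finite A" for A and d :: "'k \<Rightarrow> real"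
  proof -
    have "(\<Sum>i\<in>A. {#d i#}) = image_mset d (mset_set A)"
      using that by induction simp_all
    then show ?thesis by (subst proots_prod) simp_all
  qed
  have "poly (\<Prod>i\<in>A. [:- d i, 1:]) = poly (\<Prod>j\<in>B. [:- e j, 1:])"
    by (rule ext) (use assms(3) in \<open>simp add: poly_prod\<close>)
  then have "(\<Prod>i\<in>A. [:- d i, 1:]) = (\<Prod>j\<in>B. [:- e j, 1:])"
    by (simp add: poly_eq_poly_eq_iff)
  then show ?thesis using *[OF assms(1), of d] *[OF assms(2), of e] by simp
qed

lemma ordered_eigenvalues_diagonalize:
  fixes S :: "real ^ 'm ^ 'm"
  assumes "transpose S = S" "ordered_eigenvalues S lam"
  obtains Q d where "orthogonal_matrix Q" "S = Q ** diag_mat d ** transpose Q"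
    "image_mset d (mset_set UNIV) = image_mset lam (mset_set {1..CARD('m)})"
proof -
  obtain Q d where Q: "orthogonal_matrix Q" "S = Q ** diag_mat d ** transpose Q"
    using symmetric_matrix_diagonalize[OF assms(1)] .
  have "(\<Prod>i\<in>UNIV. t - d i) = (\<Prod>j=1..CARD('m). t - lam j)" for t
    using assms(2) det_mat_diff_orthogonal_conj[OF Q(1), of t d]
    by (simp add: ordered_eigenvalues_def Q(2))
  then have "image_mset d (mset_set UNIV) = image_mset lam (mset_set {1..CARD('m)})"
    by (intro multiset_eq_of_linear_factors) auto
  then show ?thesis using that Q by blast
qed

text \<open>On a real vector the term with \<open>J_mat\<close> is purely imaginary, so the real
  part of the uncertainty condition only sees \<open>S\<close>.\<close>

lemma gaussian_covariance_nonneg: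
  fixes S :: "real ^ ('n::finite + 'n) ^ ('n + 'n)"
  assumes "cmat_nonneg (\<chi> a b. 2 * complex_of_real (S $ a $ b) + \<i> * complex_of_real (J_mat $ a $ b))"
  shows "0 \<le> x \<bullet> (S *v x)"
proof -
  let ?M = "\<chi> a b. 2 * complex_of_real (S $ a $ b) + \<i> * complex_of_real (J_mat $ a $ b)"
  let ?z = "\<chi> a. complex_of_real (x $ a)"
  have "0 \<le> Re (cdot ?z (?M *v ?z))"
    using assms unfolding cmat_nonneg_def by (auto simp: complex_nonneg_Reals_iff)
  also have "Re (cdot ?z (?M *v ?z)) = 2 * (x \<bullet> (S *v x))"
    by (simp add: cdot_def matrix_vector_mult_def inner_vec_def sum_distrib_left mult_ac)
  finally show ?thesis by simp
qed

section \<open>Negative binomial distributions\<close>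

lemma powser_zero_coeffs:
  fixes a :: "nat \<Rightarrow> real"
  assumes "\<And>x. 0 < x \<Longrightarrow> x < 1 \<Longrightarrow> (\<lambda>k. a k * x ^ k) sums 0"
  shows "a n = 0"
proof (induction n rule: less_induct)
  case (less n)
  \<comment> \<open>By induction the lower coefficients vanish, so the power x^n can be divided out
    and the next coefficient becomes the constant term.\<close>
  have z: "(\<lambda>k. a (k + n) * x ^ k) sums 0" if x: "0 < x" "x < 1" for x
  proof -
    have "(\<lambda>k. a (k + n) * x ^ (k + n)) sums 0"
      using assms[OF x] less by (subst sums_iff_shift) simp
    then have "(\<lambda>k. a (k + n) * x ^ (k + n) / x ^ n) sums (0 / x ^ n)" by (rule sums_divide)
    then show ?thesis using x by (simp add: power_add)
  qed
  have "summable (\<lambda>k. a (k + n) * (1/2) ^ k)" using z[of "1/2"] by (simp add: sums_iff)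
  from powser_inside[OF this]
  have "(\<lambda>k. a (k + n) * x ^ k) sums (\<Sum>k. a (k + n) * x ^ k)" if "norm x < 1/2" for x :: real
    using that by (intro summable_sums) simp
  from powser_limit_0[of "1/2", OF _ this] have "((\<lambda>x. \<Sum>k. a (k + n) * x ^ k) \<longlongrightarrow> a (0 + n)) (at 0)" by simp
  \<comment> \<open>The shifted series is continuous at 0, and its vanishing is known only to the
    right of 0; the one-sided limit already determines the constant term.\<close>
  then have "((\<lambda>x. \<Sum>k. a (k + n) * x ^ k) \<longlongrightarrow> a n) (at_right 0)"
    by (simp add: filterlim_at_split)
  moreover have "\<forall>\<^sub>F x in at_right 0. (\<Sum>k. a (k + n) * x ^ k) = 0"
    by (rule eventually_mono[OF eventually_at_right_real[of 0 1]]) (use z in \<open>auto simp: sums_iff\<close>)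
  ultimately have "((\<lambda>x. 0) \<longlongrightarrow> a n) (at_right (0 :: real))"
    by (rule Lim_transform_eventually)
  then show "a n = 0" by (simp add: tendsto_const_iff)
qed

lemma powser_eq_coeffs:
  fixes a b :: "nat \<Rightarrow> real"
  assumes "\<And>x. 0 < x \<Longrightarrow> x < 1 \<Longrightarrow> (\<lambda>k. a k * x ^ k) sums F x"
    and "\<And>x. 0 < x \<Longrightarrow> x < 1 \<Longrightarrow> (\<lambda>k. b k * x ^ k) sums F x"
  shows "a n = b n"
proof -
  have "a n - b n = 0"
  proof (rule powser_zero_coeffs)
    fix x :: real assume "0 < x" "x < 1"
    from sums_diff[OF assms[OF this]] show "(\<lambda>k. (a k - b k) * x ^ k) sums 0"
      by (simp add: left_diff_distrib)
  qed
  then show ?thesis by simp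
qed

section \<open>Probability generating functions and convolution\<close>

lemma nn_integral_pmf_nat: "(\<integral>\<^sup>+ k. f k \<partial>measure_pmf (p :: nat pmf)) = (\<Sum>k. ennreal (pmf p k) * f k)"
  by (simp add: nn_integral_measure_pmf nn_integral_count_space_nat)

lemma pmf_nat_sums: "pmf (p :: nat pmf) sums 1"
proof -
  have "(\<integral>\<^sup>+ k. 1 \<partial>measure_pmf p) = 1" by simp
  then have "(\<Sum>k. ennreal (pmf p k)) = ennreal 1"
    unfolding nn_integral_pmf_nat mult_1_right ennreal_1 .
  moreover from this have sm: "summable (pmf p)"
    by (intro summable_suminf_not_top) simp_all
  ultimately have "ennreal (suminf (pmf p)) = ennreal 1"
    by (simp add: suminf_ennreal2)
  then have "suminf (pmf p) = 1"
    using suminf_nonneg[OF sm] by (subst (asm) ennreal_inj) simp_all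
  then show ?thesis using sm by (simp add: sums_iff)
qed

lemma pgf_sums:
  assumes "0 \<le> x" "x \<le> 1"
  shows "(\<lambda>k. pmf p k * x ^ k) sums pgf p x"
proof -
  have "summable (\<lambda>k. pmf p k * x ^ k)"
  proof (rule summable_comparison_test')
    show "summable (pmf p)" using pmf_nat_sums by (rule sums_summable)
    show "norm (pmf p k * x ^ k) \<le> pmf p k" if "k \<ge> 0" for k
      using assms by (simp add: abs_mult mult_left_le power_le_one)
  qed
  then show ?thesis unfolding pgf_def by (rule summable_sums)
qed

lemma pgf_nonneg: "0 \<le> x \<Longrightarrow> x \<le> 1 \<Longrightarrow> 0 \<le> pgf p x"
  unfolding pgf_def by (intro suminf_nonneg sums_summable[OF pgf_sums]) auto

lemma nn_integral_pgf:
  assumes "0 \<le> x" "x \<le> 1"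
  shows "(\<integral>\<^sup>+ k. ennreal (x ^ k) \<partial>measure_pmf p) = ennreal (pgf p x)"
  unfolding nn_integral_pmf_nat using assms
  by (simp add: ennreal_mult[symmetric] suminf_ennreal_eq[OF _ pgf_sums[OF assms], unfolded pgf_def] pgf_def)

lemma pgf_inj:
  assumes "\<And>x. 0 < x \<Longrightarrow> x < 1 \<Longrightarrow> pgf p x = pgf q x"
  shows "p = q"
proof (rule pmf_eqI)
  fix k
  show "pmf p k = pmf q k"
  proof (rule powser_eq_coeffs)
    fix x :: real assume x: "0 < x" "x < 1"
    then show "(\<lambda>k. pmf p k * x ^ k) sums pgf p x" by (intro pgf_sums) simp_all
    show "(\<lambda>k. pmf q k * x ^ k) sums pgf p x"
      unfolding assms[OF x] using x by (intro pgf_sums) simp_all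
  qed
qed

lemma nn_integral_conv_pmf:
  "(\<integral>\<^sup>+ k. f k \<partial>measure_pmf (conv_pmf p q)) = (\<integral>\<^sup>+ a. \<integral>\<^sup>+ b. f (a + b) \<partial>measure_pmf q \<partial>measure_pmf p)"
  by (simp add: conv_pmf_def nn_integral_pair_pmf')

lemma pgf_conv_pmf:
  assumes "0 \<le> x" "x \<le> 1"
  shows "pgf (conv_pmf p q) x = pgf p x * pgf q x"
proof -
  have "ennreal (pgf (conv_pmf p q) x) = (\<integral>\<^sup>+ a. \<integral>\<^sup>+ b. ennreal (x ^ a) * ennreal (x ^ b) \<partial>measure_pmf q \<partial>measure_pmf p)"
    using assms by (simp add: nn_integral_pgf[symmetric] nn_integral_conv_pmf power_add ennreal_mult)
  also have "\<dots> = ennreal (pgf p x) * ennreal (pgf q x)"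
    using assms by (simp add: nn_integral_cmult nn_integral_multc nn_integral_pgf)
  finally show ?thesis
    using assms by (simp add: ennreal_mult[symmetric] pgf_nonneg)
qed

lemma pgf_return_0: "pgf (return_pmf 0) x = 1"
proof -
  have "(\<lambda>k. pmf (return_pmf 0) k * x ^ k) = (\<lambda>k. if k = 0 then 1 else 0)"
    by (auto simp: fun_eq_iff)
  then show ?thesis unfolding pgf_def using sums_single[of 0 "\<lambda>_. 1::real"] by (simp add: sums_iff)
qed

lemma pgf_conv_list:
  assumes "0 \<le> x" "x \<le> 1"
  shows "pgf (conv_list ps) x = prod_list (map (\<lambda>p. pgf p x) ps)"
  by (induction ps) (simp_all add: conv_list_def pgf_return_0 pgf_conv_pmf assms)

text \<open>The negative binomial law of arbitrary positive index \<open>s\<close>. Indices besides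
  1/2 serve two purposes: \<open>s / k\<close> gives convolution roots, and \<open>s + 1\<close>
  arises in the moments.\<close>

definition nb_pmf :: "real \<Rightarrow> real \<Rightarrow> nat pmf" where
  "nb_pmf s \<alpha> = embed_pmf (\<lambda>k. (1 - \<alpha>) powr s * (pochhammer s k / fact k * \<alpha> ^ k))"

text \<open>Newton's binomial series for the exponent \<open>- s\<close> at \<open>- y\<close>; the
  two alternating signs cancel.\<close>

lemma negative_binomial_series:
  fixes y s :: real
  assumes "\<bar>y\<bar> < 1"
  shows "(\<lambda>k. pochhammer s k / fact k * y ^ k) sums (1 - y) powr (- s)"
proof -
  have "(- 1) ^ k * (- y) ^ k = y ^ k" for k
    by (simp flip: power_mult_distrib)
  then have "((- s) gchoose k) * (- y) ^ k = pochhammer s k / fact k * y ^ k" for k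
    by (simp add: gbinomial_pochhammer mult_ac)
  then show ?thesis
    using gen_binomial_real[of "- y" "- s"] assms by simp
qed

context
  fixes s \<alpha> :: real
  assumes s: "0 < s" and \<alpha>: "0 \<le> \<alpha>" "\<alpha> < 1"
begin

lemma pmf_nb_pmf: "pmf (nb_pmf s \<alpha>) k = (1 - \<alpha>) powr s * (pochhammer s k / fact k * \<alpha> ^ k)"
  unfolding nb_pmf_def
proof (rule pmf_embed_pmf)
  show nn: "0 \<le> (1 - \<alpha>) powr s * (pochhammer s k / fact k * \<alpha> ^ k)" for k
    using s \<alpha> by (simp add: pochhammer_nonneg)
  have "(\<lambda>k. (1 - \<alpha>) powr s * (pochhammer s k / fact k * \<alpha> ^ k)) sums ((1 - \<alpha>) powr s * (1 - \<alpha>) powr (- s))"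
    using \<alpha> by (intro sums_mult negative_binomial_series) simp
  also have "(1 - \<alpha>) powr s * (1 - \<alpha>) powr (- s) = 1"
    using \<alpha> by (simp flip: powr_add)
  finally show "(\<integral>\<^sup>+ k. ennreal ((1 - \<alpha>) powr s * (pochhammer s k / fact k * \<alpha> ^ k)) \<partial>count_space UNIV) = 1"
    unfolding nn_integral_count_space_nat by (subst suminf_ennreal_eq[OF nn]) simp_all
qed

lemma pgf_nb_pmf:
  assumes "0 \<le> x" "x \<le> 1"
  shows "pgf (nb_pmf s \<alpha>) x = ((1 - \<alpha>) / (1 - \<alpha> * x)) powr s"
proof -
  have "\<alpha> * x \<le> \<alpha> * 1" using \<alpha> assms by (intro mult_left_mono) auto
  then have ax: "\<bar>\<alpha> * x\<bar> < 1" using \<alpha> assms by simp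
  have "(\<lambda>k. (1 - \<alpha>) powr s * (pochhammer s k / fact k * (\<alpha> * x) ^ k)) sums ((1 - \<alpha>) powr s * (1 - \<alpha> * x) powr (- s))"
    by (intro sums_mult negative_binomial_series ax)
  then have "pgf (nb_pmf s \<alpha>) x = (1 - \<alpha>) powr s * (1 - \<alpha> * x) powr (- s)"
    unfolding pgf_def by (simp add: pmf_nb_pmf sums_iff power_mult_distrib mult_ac)
  also have "\<dots> = ((1 - \<alpha>) / (1 - \<alpha> * x)) powr s"
  proof -
    have "0 \<le> 1 - \<alpha> * x" using ax by linarith
    then show ?thesis using \<alpha> by (subst powr_divide) (simp_all add: powr_minus divide_inverse)
  qed
  finally show ?thesis .
qed

end

text \<open>Weighting the law by its value and shifting by one raises the index to
  \<open>s + 1\<close>, the factor in front being the mean. Moments thus reduce to the total mass at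
  a higher index.\<close>

lemma pmf_nb_pmf_Suc:
  assumes s: "0 < s" and \<alpha>: "0 \<le> \<alpha>" "\<alpha> < 1"
  shows "real (Suc k) * pmf (nb_pmf s \<alpha>) (Suc k) = s * \<alpha> / (1 - \<alpha>) * pmf (nb_pmf (s + 1) \<alpha>) k"
proof -
  have "(1 - \<alpha>) powr (s + 1) = (1 - \<alpha>) powr s * (1 - \<alpha>)"
    using \<alpha> by (simp add: powr_add)
  then have "s * \<alpha> / (1 - \<alpha>) * pmf (nb_pmf (s + 1) \<alpha>) k =
      (1 - \<alpha>) powr s * (s * pochhammer (s + 1) k / fact k * \<alpha> ^ Suc k)"
    using assms by (simp add: pmf_nb_pmf)
  moreover have "real (Suc k) * (pochhammer s (Suc k) / fact (Suc k)) = s * pochhammer (s + 1) k / fact k"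
    by (simp add: pochhammer_rec del: of_nat_Suc)
  moreover have "real (Suc k) * pmf (nb_pmf s \<alpha>) (Suc k) =
      (1 - \<alpha>) powr s * (real (Suc k) * (pochhammer s (Suc k) / fact (Suc k)) * \<alpha> ^ Suc k)"
    unfolding pmf_nb_pmf[OF assms] by (simp only: mult_ac)
  ultimately show ?thesis by (simp only:)
qed

text \<open>Mean \<open>a\<close>, and excess \<open>c\<close> of the variance over the mean; both are additive under convolution.\<close>

definition moments :: "nat pmf \<Rightarrow> real \<Rightarrow> real \<Rightarrow> bool" where
  "moments p a c \<longleftrightarrow> 0 \<le> a \<and> 0 \<le> c \<and> (\<integral>\<^sup>+ k. ennreal (real k) \<partial>measure_pmf p) = ennreal a \<and>
     (\<integral>\<^sup>+ k. ennreal ((real k)\<^sup>2) \<partial>measure_pmf p) = ennreal (a + a\<^sup>2 + c)"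

lemma moments_return_0: "moments (return_pmf 0) 0 0"
  by (simp add: moments_def)

text \<open>The second moment has the form \<open>a + a\<^sup>2 + c\<close>, and the cross term of
  the square of a sum completes \<open>(a + b)\<^sup>2\<close>, so the excesses simply add.
  Nonnegative integrals avoid integrability side conditions.\<close>

lemma moments_conv_pmf:
  assumes "moments p a c" "moments q b d"
  shows "moments (conv_pmf p q) (a + b) (c + d)"
proof -
  have nn: "0 \<le> a" "0 \<le> c" "0 \<le> b" "0 \<le> d" using assms by (auto simp: moments_def)
  have 1: "(\<integral>\<^sup>+ k. ennreal (real k) \<partial>measure_pmf (conv_pmf p q)) = ennreal (a + b)"
    using assms nn by (simp add: nn_integral_conv_pmf moments_def nn_integral_add ennreal_plus)
  have sq: "ennreal ((real (i + j))\<^sup>2) = ennreal ((real i)\<^sup>2) + (2 * ennreal (real i) * ennreal (real j) + ennreal ((real j)\<^sup>2))" for i j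
    by (simp add: power2_sum ennreal_mult'[symmetric] ennreal_plus[symmetric] add_ac del: ennreal_plus flip: ennreal_numeral)
  have "(\<integral>\<^sup>+ k. ennreal ((real k)\<^sup>2) \<partial>measure_pmf (conv_pmf p q)) =
     ennreal (a + a\<^sup>2 + c) + (2 * ennreal a * ennreal b + ennreal (b + b\<^sup>2 + d))"
    using assms nn unfolding nn_integral_conv_pmf sq
    by (simp add: moments_def nn_integral_add nn_integral_cmult nn_integral_multc)
  also have "\<dots> = ennreal ((a + a\<^sup>2 + c) + (2 * a * b + (b + b\<^sup>2 + d)))"
    using nn by (simp add: ennreal_mult'[symmetric] ennreal_plus[symmetric] del: ennreal_plus flip: ennreal_numeral)
  also have "(a + a\<^sup>2 + c) + (2 * a * b + (b + b\<^sup>2 + d)) = (a + b) + (a + b)\<^sup>2 + (c + d)"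
    by (simp add: power2_sum)
  finally show ?thesis using 1 nn by (simp add: moments_def)
qed

lemma moments_conv_list:
  assumes "\<And>i. i \<in> set is \<Longrightarrow> moments (p i) (a i) (c i)"
  shows "moments (conv_list (map p is)) (sum_list (map a is)) (sum_list (map c is))"
  using assms by (induction "is") (auto simp: conv_list_def moments_return_0 intro!: moments_conv_pmf)

lemma moments_nb_pmf:
  assumes s: "0 < s" and \<alpha>: "0 \<le> \<alpha>" "\<alpha> < 1"
  shows "moments (nb_pmf s \<alpha>) (s * (\<alpha> / (1 - \<alpha>))) (s * (\<alpha> / (1 - \<alpha>))\<^sup>2)"
proof -
  define r where "r = \<alpha> / (1 - \<alpha>)"
  have r: "0 \<le> r" using \<alpha> by (simp add: r_def)
  \<comment> \<open>Stated for every positive index, since the second moment uses the first one at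
    \<open>s + 1\<close>.\<close>
  have sums1: "(\<lambda>k. pmf (nb_pmf s \<alpha>) k * real k) sums (s * r)" if "0 < s" for s
  proof -
    have "(\<lambda>k. s * r * pmf (nb_pmf (s + 1) \<alpha>) k) sums (s * r * 1)"
      by (intro sums_mult pmf_nat_sums)
    then have "(\<lambda>k. pmf (nb_pmf s \<alpha>) (Suc k) * real (Suc k)) sums (s * r)"
      using pmf_nb_pmf_Suc[OF that \<alpha>] by (simp add: r_def mult.commute)
    then show ?thesis by (subst (asm) sums_Suc_iff) simp
  qed
  have "(\<lambda>k. s * r * (pmf (nb_pmf (s + 1) \<alpha>) k + pmf (nb_pmf (s + 1) \<alpha>) k * real k)) sums (s * r * (1 + (s + 1) * r))"
    using s by (intro sums_mult sums_add pmf_nat_sums sums1) simp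
  also have "(\<lambda>k. s * r * (pmf (nb_pmf (s + 1) \<alpha>) k + pmf (nb_pmf (s + 1) \<alpha>) k * real k)) =
      (\<lambda>k. pmf (nb_pmf s \<alpha>) (Suc k) * (real (Suc k))\<^sup>2)"
  proof
    fix k
    have "s * r * (pmf (nb_pmf (s + 1) \<alpha>) k + pmf (nb_pmf (s + 1) \<alpha>) k * real k) =
       (s * \<alpha> / (1 - \<alpha>) * pmf (nb_pmf (s + 1) \<alpha>) k) * real (Suc k)"
    proof -
      have "pmf (nb_pmf (s + 1) \<alpha>) k + pmf (nb_pmf (s + 1) \<alpha>) k * real k = pmf (nb_pmf (s + 1) \<alpha>) k * real (Suc k)"
        by (simp add: distrib_left)
      then show ?thesis by (simp only: r_def times_divide_eq_right mult.assoc)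
    qed
    then show "s * r * (pmf (nb_pmf (s + 1) \<alpha>) k + pmf (nb_pmf (s + 1) \<alpha>) k * real k) =
      pmf (nb_pmf s \<alpha>) (Suc k) * (real (Suc k))\<^sup>2"
      unfolding pmf_nb_pmf_Suc[OF assms, symmetric] by (simp add: power2_eq_square)
  qed
  finally have sums2: "(\<lambda>k. pmf (nb_pmf s \<alpha>) k * (real k)\<^sup>2) sums (s * r * (1 + (s + 1) * r))"
    by (subst (asm) sums_Suc_iff) simp
  have "(\<integral>\<^sup>+ k. ennreal (real k) \<partial>measure_pmf (nb_pmf s \<alpha>)) = ennreal (s * r)"
    unfolding nn_integral_pmf_nat ennreal_mult''[OF of_nat_0_le_iff, symmetric]
    by (rule suminf_ennreal_eq[OF _ sums1[OF s]]) simp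
  moreover have "(\<integral>\<^sup>+ k. ennreal ((real k)\<^sup>2) \<partial>measure_pmf (nb_pmf s \<alpha>)) = ennreal (s * r * (1 + (s + 1) * r))"
    unfolding nn_integral_pmf_nat ennreal_mult''[OF zero_le_power2, symmetric]
    by (rule suminf_ennreal_eq[OF _ sums2]) simp
  moreover have "s * r * (1 + (s + 1) * r) = s * r + (s * r)\<^sup>2 + s * r\<^sup>2"
    by (simp add: power2_eq_square algebra_simps)
  ultimately show ?thesis
    using s r by (simp add: moments_def r_def[symmetric])
qed

lemma moments_variance:
  assumes "moments p a c"
  shows "integrable (measure_pmf p) (\<lambda>k. (real k)\<^sup>2)"
    and "measure_pmf.variance p real - measure_pmf.expectation p real = c"
proof -
  have nn: "0 \<le> a" "0 \<le> c" using assms by (auto simp: moments_def)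
  have 1: "has_bochner_integral (measure_pmf p) real a"
    by (rule has_bochner_integral_nn_integral) (use assms nn in \<open>auto simp: moments_def\<close>)
  have 2: "has_bochner_integral (measure_pmf p) (\<lambda>k. (real k)\<^sup>2) (a + a\<^sup>2 + c)"
    by (rule has_bochner_integral_nn_integral) (use assms nn in \<open>auto simp: moments_def\<close>)
  show int: "integrable (measure_pmf p) (\<lambda>k. (real k)\<^sup>2)"
    using 2 by (simp add: has_bochner_integral_iff)
  have "measure_pmf.variance p real = (a + a\<^sup>2 + c) - a\<^sup>2"
    using 1 2 by (subst measure_pmf.variance_eq) (auto simp: has_bochner_integral_iff)
  then show "measure_pmf.variance p real - measure_pmf.expectation p real = c"
    using 1 by (simp add: has_bochner_integral_iff)
qed

section \<open>Orthonormal bases and traces\<close>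

lemma cmod_sq: "complex_of_real ((cmod z)\<^sup>2) = cnj z * z"
  by (metis complex_norm_square mult.commute of_real_power)

lemma onb_inner: "is_onb B \<Longrightarrow> e \<in> B \<Longrightarrow> f \<in> B \<Longrightarrow> cinner e f = (if e = f then 1 else 0)"
  unfolding is_onb_def by blast

lemma onb_norm_sum:
  assumes "is_onb B" "finite F" "F \<subseteq> B"
  shows "(norm (\<Sum>e\<in>F. d e *\<^sub>C e))\<^sup>2 = (\<Sum>e\<in>F. (cmod (d e))\<^sup>2)"
proof -
  have "cinner (\<Sum>e\<in>F. d e *\<^sub>C e) (\<Sum>e\<in>F. d e *\<^sub>C e) =
      (\<Sum>e\<in>F. \<Sum>f\<in>F. cnj (d e) * (d f * cinner e f))"
    by (subst cinner.sum_left) (simp only: cinner.sum_right cinner_scaleC_left cinner_scaleC_right sum_distrib_left mult.left_commute)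
  also have "\<dots> = (\<Sum>e\<in>F. \<Sum>f\<in>F. if e = f then cnj (d e) * d f else 0)"
    by (intro sum.cong refl) (use assms(3) in \<open>auto simp: onb_inner[OF assms(1)] subset_iff\<close>)
  also have "\<dots> = (\<Sum>e\<in>F. complex_of_real ((cmod (d e))\<^sup>2))"
    using assms(2) by (simp add: cmod_sq del: of_real_power)
  finally show ?thesis
    unfolding cinner_norm of_real_sum[symmetric] of_real_eq_iff .
qed

lemma onb_bessel:
  assumes "is_onb B" "finite F" "F \<subseteq> B"
  shows "(\<Sum>e\<in>F. (cmod (cinner e g))\<^sup>2) \<le> (norm g)\<^sup>2"
proof -
  let ?s = "\<Sum>e\<in>F. cinner e g *\<^sub>C e"
  have "cinner g ?s = (\<Sum>e\<in>F. complex_of_real ((cmod (cinner e g))\<^sup>2))"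
    unfolding cinner.sum_right cinner_scaleC_right cmod_sq
    by (intro sum.cong refl) (metis cinner_commute mult.commute)
  then have "inner g ?s = (\<Sum>e\<in>F. (cmod (cinner e g))\<^sup>2)"
    by (simp add: inner_eq_Re_cinner)
  moreover have "(norm (g - ?s))\<^sup>2 = (norm g)\<^sup>2 - 2 * inner g ?s + (norm ?s)\<^sup>2"
    by (simp add: power2_norm_eq_inner inner_diff_left inner_diff_right inner_commute)
  moreover have "0 \<le> (norm (g - ?s))\<^sup>2" by simp
  ultimately show ?thesis unfolding onb_norm_sum[OF assms] by simp
qed

text \<open>Bessel's inequality makes the squared coefficients summable, so the finite partial sums
  form a Cauchy filter. Its limit has the coefficients of \<open>g\<close>, and a vector orthogonal
  to the whole basis is zero. Sums are unordered because the basis is an arbitrary set.\<close>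

theorem onb_expansion:
  fixes g :: "'n fock"
  assumes B: "is_onb B"
  shows "((\<lambda>e. cinner e g *\<^sub>C e) has_sum g) B"
proof -
  let ?h = "\<lambda>e. cinner e g *\<^sub>C e"
  let ?a = "\<lambda>e. (cmod (cinner e g))\<^sup>2"
  have sm: "?a summable_on B"
    by (rule nonneg_bdd_above_summable_on)
       (auto intro!: bdd_aboveI2[where M = "(norm g)\<^sup>2"] onb_bessel[OF B])
  have "cauchy_filter (filtermap (sum ?h) (finite_subsets_at_top B))"
    unfolding cauchy_filter_metric_filtermap
  proof (intro allI impI)
    fix r :: real assume r: "0 < r"
    \<comment> \<open>Beyond \<open>F0\<close> the squared coefficients add up to at most
      \<open>(r / 3)\<^sup>2\<close>; two such errors together stay below \<open>r\<close>.\<close>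
    obtain F0 where F0: "finite F0" "F0 \<subseteq> B" "dist (sum ?a F0) (infsum ?a B) \<le> (r / 3)\<^sup>2"
      using infsum_finite_approximation[OF sm, of "(r / 3)\<^sup>2"] r by auto
    have near: "dist (sum ?h F0) (sum ?h F) \<le> r / 3" if F: "finite F" "F0 \<subseteq> F" "F \<subseteq> B" for F
    proof -
      have "sum ?a (F - F0) = sum ?a F - sum ?a F0"
        using F by (intro sum_diff)
      also have "\<dots> \<le> infsum ?a B - sum ?a F0"
        using finite_sum_le_infsum[OF sm F(1,3)] by simp
      also have "\<dots> \<le> (r / 3)\<^sup>2" using F0(3) by (simp add: dist_real_def)
      also have "sum ?a (F - F0) = (norm (sum ?h (F - F0)))\<^sup>2"
        by (rule onb_norm_sum[OF B, symmetric]) (use F in auto)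
      finally have "(norm (sum ?h (F - F0)))\<^sup>2 \<le> (r / 3)\<^sup>2" .
      then have "norm (sum ?h (F - F0)) \<le> r / 3"
        using r by (simp add: power2_le_iff_abs_le)
      moreover have "sum ?h (F - F0) = sum ?h F - sum ?h F0"
        using F by (intro sum_diff)
      ultimately show ?thesis by (simp add: dist_norm norm_minus_commute)
    qed
    show "\<exists>P. eventually P (finite_subsets_at_top B) \<and> (\<forall>x y. P x \<and> P y \<longrightarrow> dist (sum ?h x) (sum ?h y) < r)"
    proof (intro exI conjI allI impI)
      show "eventually (\<lambda>F. finite F \<and> F0 \<subseteq> F \<and> F \<subseteq> B) (finite_subsets_at_top B)"
        unfolding eventually_finite_subsets_at_top using F0 by blast
      fix F F' assume FF: "(finite F \<and> F0 \<subseteq> F \<and> F \<subseteq> B) \<and> finite F' \<and> F0 \<subseteq> F' \<and> F' \<subseteq> B"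
      have "dist (sum ?h F) (sum ?h F') \<le> dist (sum ?h F0) (sum ?h F) + dist (sum ?h F0) (sum ?h F')"
        by (rule dist_triangle3)
      also have "\<dots> \<le> r / 3 + r / 3"
        using FF by (intro add_mono near) auto
      finally show "dist (sum ?h F) (sum ?h F') < r" using r by simp
    qed
  qed
  then have "\<exists>s. filtermap (sum ?h) (finite_subsets_at_top B) \<le> nhds s"
    using complete_uniform[where S = "UNIV :: 'n fock set", THEN iffD1, OF complete_UNIV, rule_format,
        of "filtermap (sum ?h) (finite_subsets_at_top B)"]
    by (simp add: filtermap_bot_iff)
  then obtain s where "(sum ?h \<longlongrightarrow> s) (finite_subsets_at_top B)"
    unfolding filterlim_def by blast
  then have s: "(?h has_sum s) B" by (simp add: has_sum_def)
  have "cinner e (g - s) = 0" if e: "e \<in> B" for e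
  proof -
    have "((\<lambda>f. cinner e (?h f)) has_sum cinner e s) B"
      by (rule has_sum_bounded_linear[OF cinner.bounded_linear_right s])
    moreover have "((\<lambda>f. cinner e (?h f)) has_sum cinner e g) B"
      using e by (intro has_sum_finite_neutralI[of "{e}"]) (auto simp: cinner_scaleC_right onb_inner[OF B])
    ultimately have "cinner e s = cinner e g" by (rule has_sum_unique)
    then show ?thesis by (simp add: cinner.diff_right)
  qed
  then have "g - s = 0" using B unfolding is_onb_def by blast
  then show ?thesis using s by simp
qed

text \<open>With the factors in this order it is the trace over \<open>B\<close> of the rank-one
  operator taking \<open>h\<close> to \<open>cinner f h *\<^sub>C g\<close>, and its value does not
  depend on \<open>B\<close>.\<close>

lemma onb_parseval:
  assumes "is_onb B"
  shows "((\<lambda>e. cinner e g * cinner f e) has_sum cinner f g) B"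
  using has_sum_bounded_linear[OF cinner.bounded_linear_right onb_expansion[OF assms], of f g]
  by (simp add: cinner_scaleC_right)

lemma is_onb_unitary_image:
  assumes "unitary U" "is_onb B"
  shows "is_onb (U ` B)"
  unfolding is_onb_def
proof (intro conjI ballI allI impI)
  fix e f assume "e \<in> U ` B" "f \<in> U ` B"
  then obtain e' f' where ef: "e = U e'" "f = U f'" "e' \<in> B" "f' \<in> B" by blast
  then have c: "cinner e f = (if e' = f' then 1 else 0)"
    using assms unfolding unitary_def by (simp add: onb_inner)
  show "cinner e f = (if e = f then 1 else 0)"
  proof (cases "e' = f'")
    case False
    then have "cinner e f = 0" using c by simp
    moreover have "cinner e e = 1"
      using assms ef unfolding unitary_def by (simp add: onb_inner)
    ultimately have "e \<noteq> f" by auto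
    then show ?thesis using c False by simp
  qed (use c ef in simp)
next
  fix h assume h: "\<forall>e\<in>U ` B. cinner e h = 0"
  obtain k where k: "h = U k" using assms(1) unfolding unitary_def by (metis surjD)
  have "\<forall>e\<in>B. cinner e k = 0" using h k assms(1) unfolding unitary_def by auto
  then have "k = 0" using assms(2) unfolding is_onb_def by blast
  then show "h = 0"
    using k assms(1) unfolding unitary_def bounded_clinear_def by (simp add: bounded_linear.linear linear_0)
qed

lemma unitary_inj:
  assumes "unitary U" shows "inj U"
proof (rule injI)
  fix f g assume eq: "U f = U g"
  have bl: "bounded_linear U" using assms unfolding unitary_def bounded_clinear_def by blast
  have "U (f - g) = 0" using eq by (simp add: linear_diff[OF bounded_linear.linear[OF bl]])
  moreover have "cinner (U (f - g)) (U (f - g)) = cinner (f - g) (f - g)"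
    using assms unfolding unitary_def by blast
  ultimately show "f = g" by (simp add: cinner_norm cinner.zero_left)
qed

lemma bounded_clinear_compose:
  assumes "bounded_clinear A" "bounded_clinear B" shows "bounded_clinear (A \<circ> B)"
  using assms bounded_linear_compose[of A B] unfolding bounded_clinear_def o_def by simp

lemma bounded_clinearI_norm_le:
  assumes "\<And>f g. A (f + g) = A f + A g" "\<And>c f. A (c *\<^sub>C f) = c *\<^sub>C A f" "\<And>f. norm (A f) \<le> norm f"
  shows "bounded_clinear A"
  unfolding bounded_clinear_def
proof (intro conjI allI assms(2))
  show "bounded_linear A"
    by (rule bounded_linear_intro[of _ 1]) (simp_all add: assms scaleR_scaleC)
qed

lemma bounded_clinear_number_proj: "bounded_clinear (number_proj k)"
proof (rule bounded_clinearI_norm_le)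
  fix f g :: "'a fock" and c
  show "number_proj k (f + g) = number_proj k f + number_proj k g"
    by (rule fock_eqI) (simp add: number_proj.rep_eq plus_fock.rep_eq)
  show "number_proj k (c *\<^sub>C f) = c *\<^sub>C number_proj k f"
    by (rule fock_eqI) (simp add: number_proj.rep_eq scaleC.rep_eq)
  show "norm (number_proj k f) \<le> norm f"
    by (rule norm_fock_mono) (simp add: number_proj.rep_eq)
qed

lemma has_sum_finite_sum:
  fixes f :: "'i \<Rightarrow> 'b \<Rightarrow> 'c::{topological_comm_monoid_add}"
  assumes "\<And>i. i \<in> I \<Longrightarrow> (f i has_sum s i) A"
  shows "((\<lambda>x. \<Sum>i\<in>I. f i x) has_sum (\<Sum>i\<in>I. s i)) A"
  using assms by (induction I rule: infinite_finite_induct) (auto intro: has_sum_add)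

text \<open>The operator is a finite sum of rank-one operators, each of which has a basis
  independent trace by Parseval.\<close>

theorem has_trace_number_proj:
  fixes A :: "'n::finite fock \<Rightarrow> 'n fock"
  assumes A: "bounded_clinear A"
  shows "has_trace (A \<circ> number_proj k) (\<Sum>m | size m = k. cinner (num_state m) (A (num_state m)))"
  unfolding has_trace_def
proof (intro conjI allI impI)
  show "bounded_clinear (A \<circ> number_proj k)"
    by (intro bounded_clinear_compose A bounded_clinear_number_proj)
next
  fix B :: "'n fock set" assume B: "is_onb B"
  interpret A: bounded_linear A by (rule bounded_clinear_bounded_linear[OF A])
  have "cinner e ((A \<circ> number_proj k) e) =
     (\<Sum>m | size m = k. cinner e (A (num_state m)) * cinner (num_state m) e)" for e
    by (simp add: number_proj_eq_sum A.sum bounded_clinear_scaleC[OF A] cinner.sum_right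
        cinner_scaleC_right mult.commute)
  then show "((\<lambda>e. cinner e ((A \<circ> number_proj k) e)) has_sum
      (\<Sum>m | size m = k. cinner (num_state m) (A (num_state m)))) B"
    by (simp add: has_sum_finite_sum onb_parseval[OF B])
qed

section \<open>Positive operators\<close>

text \<open>Polarisation: the quadratic form is real at \<open>f + g\<close> and at
  \<open>f + \<i> *\<^sub>C g\<close>, which settles the imaginary and the real part of the claim
  respectively.\<close>

lemma positive_op_self_adjoint:
  assumes "positive_op A"
  shows "cinner f (A g) = cinner (A f) g"
proof -
  have bc: "bounded_clinear A" using assms by (simp add: positive_op_def)
  interpret A: bounded_linear A by (rule bounded_clinear_bounded_linear[OF bc])
  have im: "Im (cinner h (A h)) = 0" for h
    using assms by (auto simp: positive_op_def complex_nonneg_Reals_iff)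
  have "Im (cinner f (A g)) + Im (cinner g (A f)) = 0"
    using im[of "f + g"] im[of f] im[of g]
    by (simp add: A.add cinner_add_left cinner_add_right)
  moreover have "Re (cinner f (A g)) - Re (cinner g (A f)) = 0"
    using im[of "f + \<i> *\<^sub>C g"] im[of f] im[of g]
    by (simp add: A.add bounded_clinear_scaleC[OF bc] cinner_add_left cinner_add_right
        cinner_scaleC_left cinner_scaleC_right)
  ultimately have "cinner f (A g) = cnj (cinner g (A f))"
    by (simp add: complex_eq_iff)
  then show ?thesis by (metis cinner_commute)
qed

text \<open>Positivity at \<open>f + g\<close> and \<open>f - g\<close>. The arithmetic mean is
  preferred to the geometric one because it sums directly to traces.\<close>

lemma positive_op_inner_bound:
  assumes "positive_op A"
  shows "\<bar>inner f (A g)\<bar> \<le> (inner f (A f) + inner g (A g)) / 2"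
proof -
  interpret A: bounded_linear A
    using assms by (intro bounded_clinear_bounded_linear) (simp add: positive_op_def)
  have nn: "0 \<le> inner h (A h)" for h
    using assms by (auto simp: positive_op_def complex_nonneg_Reals_iff inner_eq_Re_cinner)
  have "inner g (A f) = inner f (A g)"
    by (metis inner_commute inner_eq_Re_cinner positive_op_self_adjoint[OF assms])
  then show ?thesis
    using nn[of "f + g"] nn[of "f - g"]
    by (simp add: A.add A.diff inner_add_left inner_add_right inner_diff_left inner_diff_right)
qed

text \<open>By Cauchy-Schwarz for the form \<open>\<langle>f|\<rho> g\<rangle>\<close>, since \<open>\<rho>\<close> has trace one over both
  bases \<open>B\<close> and \<open>U ` B\<close>.\<close>

lemma state_partial_trace_bound:
  assumes st: "is_state \<rho>" and U: "unitary U" and B: "is_onb B" and F: "finite F" "F \<subseteq> B"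
  shows "\<bar>\<Sum>e\<in>F. inner e (\<rho> (U e))\<bar> \<le> 1"
proof -
  have pos: "positive_op \<rho>" and tr: "has_trace \<rho> 1" using st by (auto simp: is_state_def)
  have nn: "0 \<le> inner h (\<rho> h)" for h
    using pos by (auto simp: positive_op_def complex_nonneg_Reals_iff inner_eq_Re_cinner)
  \<comment> \<open>The diagonal of a positive operator is nonnegative, so each finite part of it is
    below the full trace; \<open>has_trace\<close> grants this for every orthonormal basis.\<close>
  have le1: "(\<Sum>e\<in>F. inner e (\<rho> e)) \<le> 1" if "is_onb B" "finite F" "F \<subseteq> B" for F B
  proof (rule finite_sum_le_has_sum)
    have "((\<lambda>e. cinner e (\<rho> e)) has_sum 1) B" using tr that by (auto simp: has_trace_def)
    then show "((\<lambda>e. inner e (\<rho> e)) has_sum 1) B"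
      using has_sum_Re by (fastforce simp: inner_eq_Re_cinner)
  qed (use that nn in auto)
  have "\<bar>\<Sum>e\<in>F. inner e (\<rho> (U e))\<bar> \<le> (\<Sum>e\<in>F. \<bar>inner e (\<rho> (U e))\<bar>)" by (rule sum_abs)
  also have "\<dots> \<le> (\<Sum>e\<in>F. (inner e (\<rho> e) + inner (U e) (\<rho> (U e))) / 2)"
    by (intro sum_mono positive_op_inner_bound pos)
  \<comment> \<open>Injectivity of \<open>U\<close> turns the second half into a partial trace of
    the state over the image basis.\<close>
  also have "\<dots> = ((\<Sum>e\<in>F. inner e (\<rho> e)) + (\<Sum>e\<in>U ` F. inner e (\<rho> e))) / 2"
    using inj_on_subset[OF unitary_inj[OF U]]
    by (simp add: sum.reindex sum.distrib flip: sum_divide_distrib)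
  also have "\<dots> \<le> (1 + 1) / 2"
    using F by (intro divide_right_mono add_mono le1[OF B] le1[OF is_onb_unitary_image[OF U B]]) auto
  finally show ?thesis by simp
qed

section \<open>The operator \<open>x^N\<close>\<close>

text \<open>For |x| > 1 multiplication by powers of \<open>x\<close> need not preserve square
  summability; the value 0 there makes the definition total in \<open>x\<close>.\<close>

lift_definition number_power :: "real \<Rightarrow> 'n fock \<Rightarrow> 'n fock"
  is "\<lambda>x f w. (if \<bar>x\<bar> \<le> 1 then complex_of_real (x ^ length w) else 0) * f w"
proof -
  fix x :: real and f :: "'n list \<Rightarrow> complex"
  assume f: "f \<in> fock_set"
  have le: "cmod (if \<bar>x\<bar> \<le> 1 then complex_of_real (x ^ length w) else 0) \<le> 1" for w :: "'n list"
    by (simp add: norm_power power_le_one)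
  have "(\<lambda>w. (cmod ((if \<bar>x\<bar> \<le> 1 then complex_of_real (x ^ length w) else 0) * f w))\<^sup>2) summable_on UNIV"
    by (rule summable_on_comparison_test[where f = "\<lambda>w. (cmod (f w))\<^sup>2"])
       (auto intro!: fock_set_summable[OF f] power_mono simp: norm_mult norm_power power_le_one mult_left_le_one_le)
  moreover have "(if \<bar>x\<bar> \<le> 1 then complex_of_real (x ^ length v) else 0) * f v =
      (if \<bar>x\<bar> \<le> 1 then complex_of_real (x ^ length w) else 0) * f w" if "mset v = mset w" for v w
  proof -
    have "f v = f w" using f that unfolding fock_set_def by blast
    then show ?thesis using mset_eq_length[OF that] by simp
  qed
  ultimately show "(\<lambda>w. (if \<bar>x\<bar> \<le> 1 then complex_of_real (x ^ length w) else 0) * f w) \<in> fock_set"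
    unfolding fock_set_def by blast
qed

lemma bounded_clinear_number_power: "bounded_clinear (number_power x)"
proof (rule bounded_clinearI_norm_le)
  fix f g :: "'a fock" and c
  show "number_power x (f + g) = number_power x f + number_power x g"
    by (rule fock_eqI) (simp add: number_power.rep_eq plus_fock.rep_eq distrib_left)
  show "number_power x (c *\<^sub>C f) = c *\<^sub>C number_power x f"
    by (rule fock_eqI) (simp add: number_power.rep_eq scaleC.rep_eq)
  show "norm (number_power x f) \<le> norm f"
    by (rule norm_fock_mono) (auto simp: number_power.rep_eq norm_mult norm_power power_le_one mult_left_le_one_le)
qed

lemma number_power_num_state:
  "\<bar>x\<bar> \<le> 1 \<Longrightarrow> number_power x (num_state m) = complex_of_real (x ^ size m) *\<^sub>C num_state m"
  by (rule fock_eqI) (auto simp: number_power.rep_eq scaleC.rep_eq num_state.rep_eq)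

lemma number_power_exp_vec:
  assumes "\<bar>x\<bar> \<le> 1" shows "number_power x (exp_vec v) = exp_vec (x *\<^sub>R v)"
proof (rule fock_eqI)
  fix w
  have "prod_list (map (\<lambda>i. (x *\<^sub>R v) $ i) w) = complex_of_real (x ^ length w) * prod_list (map (\<lambda>i. v $ i) w)"
    unfolding vector_scaleR_component by (induction w) (simp_all add: scaleR_conv_of_real[where 'a = complex])
  then show "amplitude (number_power x (exp_vec v)) w = amplitude (exp_vec (x *\<^sub>R v)) w"
    using assms by (simp add: number_power.rep_eq exp_vec.rep_eq)
qed

section \<open>\<open>x^N\<close> as a Gaussian integral of Weyl operators\<close>

definition phase_point :: "real ^ ('n + 'n) \<Rightarrow> complex ^ 'n::finite" where
  "phase_point s = (\<chi> i. Complex (s $ Inl i) (s $ Inr i))"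

lemma sum_UNIV_Plus: "(\<Sum>a\<in>UNIV. f a) = (\<Sum>i\<in>UNIV. f (Inl i)) + (\<Sum>i\<in>UNIV. f (Inr i))"
  for f :: "'a::finite + 'b::finite \<Rightarrow> 'c::comm_monoid_add"
  unfolding UNIV_Plus_UNIV[symmetric] by (subst sum.Plus) simp_all

lemma norm_vec_sq: "(norm s)\<^sup>2 = (\<Sum>i\<in>UNIV. (s $ i)\<^sup>2)" for s :: "real ^ 'm::finite"
  unfolding power2_norm_eq_inner inner_vec_def by (simp add: power2_eq_square)

lemma norm_phase_point: "norm (phase_point s) = norm s"
proof -
  have "(norm (phase_point s))\<^sup>2 = (\<Sum>i\<in>UNIV. (cmod (phase_point s $ i))\<^sup>2)"
    by (simp add: norm_vec_def L2_set_def sum_nonneg)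
  also have "\<dots> = (norm s)\<^sup>2"
    by (simp add: phase_point_def cmod_power2 norm_vec_sq sum_UNIV_Plus sum.distrib)
  finally show ?thesis by simp
qed

lemma weyl_exp_vec_integral:
  fixes u v :: "complex ^ 'n::finite"
  assumes x: "0 \<le> x" "x < 1" and \<gamma>: "\<gamma> = 1 / (1 - x)"
  shows "has_bochner_integral lborel
     (\<lambda>s. complex_of_real (exp (- ((\<gamma> - 1/2) * (norm s)\<^sup>2))) * cinner (exp_vec u) (weyl (phase_point s) (exp_vec v)))
     (complex_of_real ((pi / \<gamma>) ^ CARD('n)) * cinner (exp_vec u) (number_power x (exp_vec v)))"
proof -
  have pos: "0 < \<gamma>" using x by (simp add: \<gamma>)
  \<comment> \<open>The coefficient of the real coordinate \<open>s $ a\<close> in <u|z> - <z|v>,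
    where z is the phase point of \<open>s\<close>.\<close>
  define c where "c a = (case a of Inl i \<Rightarrow> cnj (u $ i) - v $ i | Inr i \<Rightarrow> \<i> * (cnj (u $ i) + v $ i))" for a
  let ?I = "\<lambda>a. complex_of_real (sqrt (pi / \<gamma>)) * exp ((c a)\<^sup>2 / complex_of_real (4 * \<gamma>))"
  have "has_bochner_integral lborel
      (\<lambda>s :: real ^ ('n + 'n). \<Prod>a\<in>UNIV. exp (- complex_of_real (\<gamma> * (s $ a)\<^sup>2) + c a * complex_of_real (s $ a)))
      (\<Prod>a\<in>UNIV. ?I a)"
    by (rule has_bochner_integral_prod_vec) (rule gaussian_fourier_laplace[OF pos])
  then have main: "has_bochner_integral lborel
      (\<lambda>s :: real ^ ('n + 'n). exp (cdot u v) *
        (\<Prod>a\<in>UNIV. exp (- complex_of_real (\<gamma> * (s $ a)\<^sup>2) + c a * complex_of_real (s $ a))))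
      (exp (cdot u v) * (\<Prod>a\<in>UNIV. ?I a))"
    by (rule has_bochner_integral_mult_right)
  have integrand: "exp (cdot u v) *
        (\<Prod>a\<in>UNIV. exp (- complex_of_real (\<gamma> * (s $ a)\<^sup>2) + c a * complex_of_real (s $ a))) =
      complex_of_real (exp (- ((\<gamma> - 1/2) * (norm s)\<^sup>2))) * cinner (exp_vec u) (weyl (phase_point s) (exp_vec v))"
    for s :: "real ^ ('n + 'n)"
  proof -
    have "(\<Sum>a\<in>UNIV. c a * complex_of_real (s $ a)) = cdot u (phase_point s) - cdot (phase_point s) v"
      unfolding sum_UNIV_Plus cdot_def phase_point_def c_def sum_subtractf[symmetric] sum.distrib[symmetric]
      by (intro sum.cong refl) (simp add: complex_eq_iff algebra_simps)
    then have "(\<Sum>a\<in>UNIV. - complex_of_real (\<gamma> * (s $ a)\<^sup>2) + c a * complex_of_real (s $ a)) =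
        - complex_of_real (\<gamma> * (norm s)\<^sup>2) + (cdot u (phase_point s) - cdot (phase_point s) v)"
      by (simp add: sum.distrib norm_vec_sq sum_distrib_left sum_negf sum_subtractf)
    then have "exp (cdot u v) *
        (\<Prod>a\<in>UNIV. exp (- complex_of_real (\<gamma> * (s $ a)\<^sup>2) + c a * complex_of_real (s $ a))) =
        exp (cdot u v + (- complex_of_real (\<gamma> * (norm s)\<^sup>2) + (cdot u (phase_point s) - cdot (phase_point s) v)))"
      unfolding exp_add[of "cdot u v"] by (simp only: exp_sum[OF finite, symmetric])
    \<comment> \<open>The Gaussian factor of the Weyl operator supplies the missing half: \<gamma>
      splits as (\<gamma> - 1/2) + 1/2.\<close>
    also have "\<dots> = exp (complex_of_real (- ((\<gamma> - 1/2) * (norm s)\<^sup>2)) +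
        (- complex_of_real ((norm (phase_point s))\<^sup>2) / 2 - cdot (phase_point s) v + cdot u (phase_point s + v)))"
      by (rule arg_cong[where f = exp]) (simp add: cdot_add_right norm_phase_point algebra_simps)
    also have "\<dots> = complex_of_real (exp (- ((\<gamma> - 1/2) * (norm s)\<^sup>2))) * cinner (exp_vec u) (weyl (phase_point s) (exp_vec v))"
      unfolding weyl_exp_vec cinner_scaleC_right cinner_exp_vec exp_of_real[symmetric] exp_add[symmetric] ..
    finally show ?thesis .
  qed
  have "exp (cdot u v) * (\<Prod>a\<in>UNIV. ?I a) =
      complex_of_real (sqrt (pi / \<gamma>)) ^ CARD('n + 'n) * exp (cdot u v + (\<Sum>a\<in>UNIV. (c a)\<^sup>2) / complex_of_real (4 * \<gamma>))"
    unfolding prod.distrib prod_constant exp_add exp_sum[OF finite] sum_divide_distrib by (simp only: mult_ac)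
  \<comment> \<open>In each mode this is a difference of two squares, the second block carrying the
    factor -1 from the square of the imaginary unit, and only the cross term survives.\<close>
  also have "(\<Sum>a\<in>UNIV. (c a)\<^sup>2) = - 4 * cdot u v"
    unfolding sum_UNIV_Plus cdot_def c_def sum.distrib[symmetric] sum_distrib_left
    by (intro sum.cong refl) (simp add: power2_eq_square algebra_simps)
  also have "cdot u v + - 4 * cdot u v / complex_of_real (4 * \<gamma>) = cdot u (x *\<^sub>R v)"
  proof -
    have 1: "cdot u (x *\<^sub>R v) = complex_of_real x * cdot u v"
      unfolding cdot_def vector_scaleR_component sum_distrib_left
      by (intro sum.cong refl) (simp add: scaleR_conv_of_real[where 'a = complex])
    have "x = 1 - 1 / \<gamma>" using x by (simp add: \<gamma>)
    then have 2: "complex_of_real x = 1 - 1 / complex_of_real \<gamma>"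
      by (metis of_real_1 of_real_diff of_real_divide)
    show ?thesis unfolding 1 2 using pos by (simp add: field_simps)
  qed
  \<comment> \<open>There are 2n real coordinates, each contributing a square root.\<close>
  also have "complex_of_real (sqrt (pi / \<gamma>)) ^ CARD('n + 'n) = complex_of_real ((pi / \<gamma>) ^ CARD('n))"
  proof -
    have "sqrt (pi / \<gamma>) ^ CARD('n + 'n) = (sqrt (pi / \<gamma>) * sqrt (pi / \<gamma>)) ^ CARD('n)"
      by (simp add: card_Plus[where A = UNIV and B = UNIV, unfolded UNIV_Plus_UNIV] power_add power_mult_distrib
          del: real_sqrt_mult_self)
    also have "sqrt (pi / \<gamma>) * sqrt (pi / \<gamma>) = pi / \<gamma>" using pos by simp
    finally show ?thesis by (simp only: of_real_power[symmetric])
  qed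
  finally have "exp (cdot u v) * (\<Prod>a\<in>UNIV. ?I a) =
      complex_of_real ((pi / \<gamma>) ^ CARD('n)) * cinner (exp_vec u) (number_power x (exp_vec v))"
    using x by (simp add: number_power_exp_vec cinner_exp_vec)
  with main show ?thesis unfolding integrand by simp
qed

text \<open>Unitarity bounds the integrands by a fixed multiple of |w|, uniformly in
  \<open>k\<close>, so dominated convergence carries the weak identity to limits of vectors. This is
  the closure step for extending it from exponential vectors.\<close>

lemma has_bochner_integral_cinner_limit:
  fixes W :: "'s \<Rightarrow> 'n fock \<Rightarrow> 'n fock" and w :: "'s \<Rightarrow> complex"
  assumes W: "\<And>s. unitary (W s)" and w: "integrable M w" and T: "bounded_clinear T"
    and a: "a \<longlonglongrightarrow> a'" and b: "b \<longlonglongrightarrow> b'"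
    and int: "\<And>k :: nat. has_bochner_integral M (\<lambda>s. w s * cinner (a k) (W s (b k))) (C * cinner (a k) (T (b k)))"
  shows "has_bochner_integral M (\<lambda>s. w s * cinner a' (W s b')) (C * cinner a' (T b'))"
proof -
  have blW: "bounded_linear (W s)" for s using W[of s] by (simp add: unitary_def bounded_clinear_def)
  have nW: "norm (W s f) = norm f" for s f
  proof -
    have "cinner (W s f) (W s f) = cinner f f" using W[of s] by (simp add: unitary_def)
    then show ?thesis unfolding cinner_norm of_real_eq_iff by (simp add: power2_eq_iff_nonneg)
  qed
  obtain K where K: "K \<ge> 0" "\<And>f g :: 'n fock. norm (cinner f g) \<le> norm f * norm g * K"
    using cinner.nonneg_bounded by blast
  obtain A where A: "\<And>k. norm (a k) \<le> A"
    using convergent_imp_Bseq[OF convergentI[OF a]] unfolding Bseq_def by blast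
  obtain B where B: "\<And>k. norm (b k) \<le> B"
    using convergent_imp_Bseq[OF convergentI[OF b]] unfolding Bseq_def by blast
  have A0: "0 \<le> A" using A[of 0] norm_ge_zero order_trans by blast
  have m: "(\<lambda>s. w s * cinner (a k) (W s (b k))) \<in> borel_measurable M" for k
    using int[of k] by (auto simp: has_bochner_integral_iff)
  have lim: "(\<lambda>k. w s * cinner (a k) (W s (b k))) \<longlonglongrightarrow> w s * cinner a' (W s b')" for s
    by (intro tendsto_mult tendsto_const cinner.tendsto bounded_linear.tendsto[OF blW] a b)
  \<comment> \<open>Measurability in \<open>s\<close> is inherited as a pointwise limit too, so no
    continuity of \<open>W\<close> in its parameter enters.\<close>
  have m': "(\<lambda>s. w s * cinner a' (W s b')) \<in> borel_measurable M"
    by (rule borel_measurable_LIMSEQ_metric[OF m]) (rule lim)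
  have bound: "norm (w s * cinner (a k) (W s (b k))) \<le> norm (w s) * (A * B * K)" for s k
  proof -
    have "norm (cinner (a k) (W s (b k))) \<le> norm (a k) * norm (b k) * K"
      using K(2)[of "a k" "W s (b k)"] by (simp add: nW)
    also have "\<dots> \<le> A * B * K"
      by (intro mult_right_mono mult_mono A B A0 K(1)) simp
    finally show ?thesis unfolding norm_mult by (intro mult_left_mono) simp_all
  qed
  have wi: "integrable M (\<lambda>s. norm (w s) * (A * B * K))"
    by (intro integrable_mult_left integrable_norm w)
  note dct = m' m wi AE_I2[OF lim] AE_I2[OF bound]
  have "(\<lambda>k. C * cinner (a k) (T (b k))) \<longlonglongrightarrow> (\<integral>s. w s * cinner a' (W s b') \<partial>M)"
    using integral_dominated_convergence[OF dct] int by (simp add: has_bochner_integral_iff)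
  moreover have "(\<lambda>k. C * cinner (a k) (T (b k))) \<longlonglongrightarrow> C * cinner a' (T b')"
    by (intro tendsto_mult tendsto_const cinner.tendsto a b
        bounded_linear.tendsto[OF bounded_clinear_bounded_linear[OF T]])
  ultimately have "(\<integral>s. w s * cinner a' (W s b') \<partial>M) = C * cinner a' (T b')"
    by (rule LIMSEQ_unique)
  then show ?thesis
    using integrable_dominated_convergence[OF dct] by (simp add: has_bochner_integral_iff)
qed

text \<open>The identity is preserved by sums, scalar multiples and limits in each argument, so
  totality spreads it from exponential vectors, first in the right argument and then in the left
  one.\<close>

theorem weyl_integral:
  fixes a b :: "'n::finite fock"
  assumes x: "0 \<le> x" "x < 1" and \<gamma>: "\<gamma> = 1 / (1 - x)"
    and w: "integrable lborel (\<lambda>s :: real ^ ('n + 'n). exp (- ((\<gamma> - 1/2) * (norm s)\<^sup>2)))"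
  shows "has_bochner_integral lborel
     (\<lambda>s. complex_of_real (exp (- ((\<gamma> - 1/2) * (norm s)\<^sup>2))) * cinner a (weyl (phase_point s) b))
     (complex_of_real ((pi / \<gamma>) ^ CARD('n)) * cinner a (number_power x b))"
proof -
  let ?w = "\<lambda>s :: real ^ ('n + 'n). complex_of_real (exp (- ((\<gamma> - 1/2) * (norm s)\<^sup>2)))"
  let ?C = "complex_of_real ((pi / \<gamma>) ^ CARD('n))"
  define P where "P a b \<longleftrightarrow> has_bochner_integral lborel (\<lambda>s. ?w s * cinner a (weyl (phase_point s) b))
     (?C * cinner a (number_power x b))" for a b :: "'n fock"
  have bcW: "bounded_clinear (weyl u)" for u :: "complex ^ 'n"
    using unitary_weyl[of u] by (simp add: unitary_def)
  have addW: "weyl u (f + g) = weyl u f + weyl u g" for u f and g :: "'n fock"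
    by (rule linear_add[OF bounded_linear.linear[OF bounded_clinear_bounded_linear[OF bcW]]])
  have addT: "number_power x (f + g) = number_power x f + number_power x g" for f and g :: "'n fock"
    by (rule linear_add[OF bounded_linear.linear[OF bounded_clinear_bounded_linear[OF bounded_clinear_number_power]]])
  have limP: "P a' b'" if "a \<longlonglongrightarrow> a'" "b \<longlonglongrightarrow> b'" "\<And>k. P (a k) (b k)" for a b a' b'
    unfolding P_def
    by (rule has_bochner_integral_cinner_limit[OF unitary_weyl _ bounded_clinear_number_power that(1,2)])
       (use that(3) w in \<open>auto simp: P_def\<close>)
  have addR: "P a (f + g)" if "P a f" "P a g" for a f g
    using has_bochner_integral_add[OF that[unfolded P_def]]
    unfolding P_def addW addT cinner_add_right by (simp only: distrib_left)
  have addL: "P (f + g) b" if "P f b" "P g b" for b f g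
    using has_bochner_integral_add[OF that[unfolded P_def]]
    unfolding P_def cinner_add_left by (simp only: distrib_left)
  have scR: "P a (c *\<^sub>C f)" if "P a f" for a f c
    using has_bochner_integral_mult_right[of c, OF that[unfolded P_def]]
    unfolding P_def bounded_clinear_scaleC[OF bcW] bounded_clinear_scaleC[OF bounded_clinear_number_power]
      cinner_scaleC_right by (simp only: mult.left_commute)
  have scL: "P (c *\<^sub>C f) b" if "P f b" for b f c
    using has_bochner_integral_mult_right[of "cnj c", OF that[unfolded P_def]]
    unfolding P_def cinner_scaleC_left by (simp only: mult.left_commute)
  have 1: "b \<in> {b. P (exp_vec u) b}" for u b
  proof (rule total_familyD[OF total_family_exp_vec])
    show "closed {b. P (exp_vec u) b}"
      unfolding closed_sequential_limits using limP[OF tendsto_const] by auto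
    show "exp_vec v \<in> {b. P (exp_vec u) b}" for v
      unfolding P_def using weyl_exp_vec_integral[OF x \<gamma>] by simp
  qed (use addR scR in auto)
  have "a \<in> {a. \<forall>b. P a b}" for a
  proof (rule total_familyD[OF total_family_exp_vec])
    show "closed {a. \<forall>b. P a b}"
      unfolding closed_sequential_limits using limP[OF _ tendsto_const] by auto
  qed (use 1 addL scL in auto)
  then show ?thesis by (simp add: P_def)
qed

section \<open>The generating function of the total number operator\<close>

definition number_probability :: "('n fock \<Rightarrow> 'n fock) \<Rightarrow> nat \<Rightarrow> real" where
  "number_probability \<rho> k = (\<Sum>m | size m = k. inner (num_state m) (\<rho> (num_state m)))"

lemma has_trace_number_probability:
  fixes \<rho> :: "'n::finite fock \<Rightarrow> 'n fock"
  assumes "is_state \<rho>"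
  shows "has_trace (\<rho> \<circ> number_proj k) (complex_of_real (number_probability \<rho> k))"
proof -
  have pos: "positive_op \<rho>" using assms by (simp add: is_state_def)
  have "cinner e (\<rho> e) = complex_of_real (inner e (\<rho> e))" for e
    using pos by (simp add: positive_op_def complex_nonneg_Reals_iff inner_eq_Re_cinner complex_eq_iff)
  then show ?thesis
    using has_trace_number_proj[of \<rho> k] pos by (simp add: number_probability_def positive_op_def)
qed

theorem number_generating_function:
  fixes S :: "real ^ ('n::finite + 'n) ^ ('n + 'n)" and d :: "'n + 'n \<Rightarrow> real"
  assumes gs: "is_gaussian_state 0 0 S \<rho>"
    and Q: "orthogonal_matrix Q" "S = Q ** diag_mat d ** transpose Q" and d: "\<And>i. 0 \<le> d i"
    and x: "0 \<le> x" "x < 1"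
  shows "(\<lambda>k. number_probability \<rho> k * x ^ k) sums (\<Prod>i\<in>UNIV. sqrt (1 / ((d i + 1/2) - (d i - 1/2) * x)))"
proof -
  define \<gamma> where \<gamma>: "\<gamma> = 1 / (1 - x)"
  define \<beta> where "\<beta> = \<gamma> - 1/2"
  have \<gamma>1: "1 \<le> \<gamma>" using x by (simp add: \<gamma>)
  then have \<beta>: "0 < \<beta>" by (simp add: \<beta>_def)
  let ?C = "(pi / \<gamma>) ^ CARD('n)"
  let ?w = "\<lambda>s :: real ^ ('n + 'n). exp (- (\<beta> * (norm s)\<^sup>2))"
  \<comment> \<open>The parameter \<open>t\<close> is used at 0 for the bare weight, which serves as
    the dominating function, and at 1 for the weight times the characteristic function.\<close>
  have quad: "s \<bullet> ((Q ** diag_mat (\<lambda>i. \<beta> + t * d i) ** transpose Q) *v s) = \<beta> * (norm s)\<^sup>2 + t * (s \<bullet> (S *v s))" for s t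
  proof -
    have "orthogonal_transformation ((*v) (transpose Q))"
      using Q(1) by (simp add: orthogonal_transformation_matrix orthogonal_matrix_transpose)
    then have "norm (transpose Q *v s) = norm s" by (rule orthogonal_transformation_norm)
    then have "(norm s)\<^sup>2 = (\<Sum>i\<in>UNIV. ((transpose Q *v s) $ i)\<^sup>2)" by (metis norm_vec_sq)
    then show ?thesis
      unfolding Q(2) inner_orthogonal_conj by (simp add: distrib_right sum.distrib sum_distrib_left mult.assoc)
  qed
  have w: "integrable lborel ?w"
    using gaussian_integral_orthogonal_conj[OF Q(1), of "\<lambda>i. \<beta> + 0 * d i"] \<beta>
    unfolding quad by (simp add: has_bochner_integral_iff)
  have g: "has_bochner_integral lborel (\<lambda>s. ?w s * exp (- (s \<bullet> (S *v s)))) (\<Prod>i\<in>UNIV. sqrt (pi / (\<beta> + d i)))"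
    using gaussian_integral_orthogonal_conj[OF Q(1), of "\<lambda>i. \<beta> + 1 * d i"] \<beta> d
    unfolding quad by (simp add: add_pos_nonneg exp_add[symmetric] add.commute)
  have st: "is_state \<rho>" and chr: "has_trace (\<rho> \<circ> weyl (phase_point s)) (complex_of_real (exp (- (s \<bullet> (S *v s)))))" for s
  proof -
    show "is_state \<rho>" using gs by (simp add: is_gaussian_state_def)
    define p q where "p = (\<chi> i. s $ Inl i)" and "q = (\<chi> i. s $ Inr i)"
    have "stack p q = s"
      by (simp add: vec_eq_iff stack_def p_def q_def split: sum.split)
    moreover have "(\<chi> i. Complex (p $ i) (q $ i)) = phase_point s"
      by (simp add: phase_point_def p_def q_def)
    ultimately show "has_trace (\<rho> \<circ> weyl (phase_point s)) (complex_of_real (exp (- (s \<bullet> (S *v s)))))"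
      using gs unfolding is_gaussian_state_def by (metis (no_types, lifting) diff_0 diff_self exp_of_real inner_zero_left mult_zero_right of_real_0 of_real_minus)
  qed
  have pos: "positive_op \<rho>" using st by (simp add: is_state_def)
  let ?t = "\<lambda>s m. inner (num_state m) (\<rho> (weyl (phase_point s) (num_state m)))"
  let ?f = "\<lambda>k s. \<Sum>r<k. \<Sum>m | size m = r. ?w s * ?t s m"
  have lim: "(\<lambda>k. ?f k s) \<longlonglongrightarrow> ?w s * exp (- (s \<bullet> (S *v s)))" for s
  proof -
    have "((\<lambda>e. cinner e ((\<rho> \<circ> weyl (phase_point s)) e)) has_sum complex_of_real (exp (- (s \<bullet> (S *v s))))) (range num_state)"
      by (rule chr[of s, unfolded has_trace_def, THEN conjunct2, rule_format, OF is_onb_num_state])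
    then have "((\<lambda>m. cinner (num_state m) (\<rho> (weyl (phase_point s) (num_state m)))) has_sum complex_of_real (exp (- (s \<bullet> (S *v s))))) UNIV"
      by (subst (asm) has_sum_reindex[OF inj_num_state]) (simp add: o_def)
    from has_sum_Re[OF this] have "(?t s has_sum exp (- (s \<bullet> (S *v s)))) UNIV"
      by (simp add: inner_eq_Re_cinner)
    from has_sum_imp_sums[OF has_sum_finite_fibres[OF this finite_msets_of_size]]
    have "(\<lambda>k. ?w s * (\<Sum>r<k. \<Sum>m | size m = r. ?t s m)) \<longlonglongrightarrow> ?w s * exp (- (s \<bullet> (S *v s)))"
      unfolding sums_def by (intro tendsto_mult tendsto_const)
    then show ?thesis by (simp only: sum_distrib_left)
  qed
  \<comment> \<open>A truncated trace is a finite partial trace over the number basis, at most one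
    in modulus; the integrable weight \<open>?w\<close> therefore dominates all truncations at
    once.\<close>
  have bound: "norm (?f k s) \<le> ?w s" for k s
  proof -
    let ?F = "{m :: 'n multiset. size m < k}"
    have F: "?F = (\<Union>r<k. {m. size m = r})" by auto
    then have fin: "finite ?F" by (simp add: finite_msets_of_size)
    have "?f k s = ?w s * (\<Sum>r<k. \<Sum>m | size m = r. ?t s m)" by (simp only: sum_distrib_left)
    also have "(\<Sum>r<k. \<Sum>m | size m = r. ?t s m) = (\<Sum>m\<in>?F. ?t s m)"
      unfolding F by (intro sum.UNION_disjoint[symmetric]) (auto simp: finite_msets_of_size)
    also have "\<dots> = (\<Sum>e\<in>num_state ` ?F. inner e (\<rho> (weyl (phase_point s) e)))"
      by (subst sum.reindex) (auto intro: inj_on_subset[OF inj_num_state])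
    also have "norm (?w s * \<dots>) \<le> ?w s * 1"
      unfolding real_norm_def abs_mult
      by (intro mult_mono state_partial_trace_bound[OF st unitary_weyl is_onb_num_state]) (use fin in auto)
    finally show ?thesis by simp
  qed
  \<comment> \<open>Moving the state to the left argument exposes a matrix element of the Weyl
    operator alone; number states are eigenvectors of x^N, which produces the power of
    \<open>x\<close>.\<close>
  have single: "has_bochner_integral lborel (\<lambda>s. ?w s * ?t s m) (?C * (inner (num_state m) (\<rho> (num_state m)) * x ^ size m))" for m
  proof -
    have sa: "cinner (\<rho> (num_state m)) h = cinner (num_state m) (\<rho> h)" for h
      by (rule positive_op_self_adjoint[OF pos, symmetric])
    have "cinner (\<rho> (num_state m)) (number_power x (num_state m)) =
        complex_of_real (x ^ size m) * cinner (num_state m) (\<rho> (num_state m))"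
      unfolding sa[symmetric] using x by (simp add: number_power_num_state cinner_scaleC_right)
    moreover have "has_bochner_integral lborel (\<lambda>s. Re (complex_of_real (?w s) * cinner (\<rho> (num_state m)) (weyl (phase_point s) (num_state m))))
       (Re (complex_of_real ?C * cinner (\<rho> (num_state m)) (number_power x (num_state m))))"
      by (rule has_bochner_integral_Re)
         (use weyl_integral[OF x \<gamma> w[unfolded \<beta>_def], of "\<rho> (num_state m)" "num_state m"] in \<open>simp add: \<beta>_def\<close>)
    ultimately show ?thesis
      by (simp add: sa inner_eq_Re_cinner mult.commute del: of_real_power flip: of_real_mult)
  qed
  have int_f: "has_bochner_integral lborel (?f k) (\<Sum>r<k. ?C * (number_probability \<rho> r * x ^ r))" for k
  proof -
    have "has_bochner_integral lborel (?f k) (\<Sum>r<k. \<Sum>m | size m = r. ?C * (inner (num_state m) (\<rho> (num_state m)) * x ^ size m))"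
      by (intro has_bochner_integral_sum single)
    also have "(\<Sum>r<k. \<Sum>m | size m = r. ?C * (inner (num_state m) (\<rho> (num_state m)) * x ^ size m)) =
       (\<Sum>r<k. ?C * (number_probability \<rho> r * x ^ r))"
      unfolding number_probability_def sum_distrib_right sum_distrib_left by (intro sum.cong refl) auto
    finally show ?thesis .
  qed
  have m: "?f k \<in> borel_measurable lborel" for k
    using int_f[of k] by (auto simp: has_bochner_integral_iff)
  have m': "(\<lambda>s. ?w s * exp (- (s \<bullet> (S *v s)))) \<in> borel_measurable lborel"
    using g by (auto simp: has_bochner_integral_iff)
  have "(\<lambda>k. integral\<^sup>L lborel (?f k)) \<longlonglongrightarrow> (\<integral>s. ?w s * exp (- (s \<bullet> (S *v s))) \<partial>lborel)"
    by (rule integral_dominated_convergence[OF m' m w AE_I2[OF lim] AE_I2[OF bound]])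
  then have "(\<lambda>r. ?C * (number_probability \<rho> r * x ^ r)) sums (\<Prod>i\<in>UNIV. sqrt (pi / (\<beta> + d i)))"
    using int_f g unfolding sums_def by (simp add: has_bochner_integral_iff)
  then have "(\<lambda>r. inverse ?C * (?C * (number_probability \<rho> r * x ^ r))) sums (inverse ?C * (\<Prod>i\<in>UNIV. sqrt (pi / (\<beta> + d i))))"
    by (rule sums_mult)
  moreover have "inverse ?C * (?C * y) = y" for y
    using \<gamma>1 by simp
  moreover have "inverse ?C * (\<Prod>i\<in>UNIV. sqrt (pi / (\<beta> + d i))) = (\<Prod>i\<in>UNIV. sqrt (1 / ((d i + 1/2) - (d i - 1/2) * x)))"
  proof -
    \<comment> \<open>The n-th power is distributed over 2n factors, one square root for each
      eigenvalue.\<close>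
    have "inverse ?C = (\<Prod>i\<in>(UNIV :: ('n + 'n) set). sqrt (\<gamma> / pi))"
    proof -
      have "(\<Prod>i\<in>(UNIV :: ('n + 'n) set). sqrt (\<gamma> / pi)) = (sqrt (\<gamma> / pi) * sqrt (\<gamma> / pi)) ^ CARD('n)"
        by (simp add: card_Plus[where A = UNIV and B = UNIV, unfolded UNIV_Plus_UNIV] power_add power_mult_distrib
            del: real_sqrt_mult_self)
      also have "\<dots> = (\<gamma> / pi) ^ CARD('n)" using \<gamma>1 by simp
      finally show ?thesis by (simp add: power_inverse[symmetric])
    qed
    then have "inverse ?C * (\<Prod>i\<in>UNIV. sqrt (pi / (\<beta> + d i))) = (\<Prod>i\<in>UNIV. sqrt (\<gamma> / pi) * sqrt (pi / (\<beta> + d i)))"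
      by (simp only: prod.distrib)
    also have "\<dots> = (\<Prod>i\<in>UNIV. sqrt (1 / ((d i + 1/2) - (d i - 1/2) * x)))"
    proof (intro prod.cong refl)
      fix i
      \<comment> \<open>Because \<gamma> (1 - x) = 1 and \<beta> = (1 + x) / (2 (1 - x)).\<close>
      have "\<gamma> * ((d i + 1/2) - (d i - 1/2) * x) = \<beta> + d i"
        unfolding \<beta>_def \<gamma> using x by (simp add: field_simps)
      then have "(d i + 1/2) - (d i - 1/2) * x = (\<beta> + d i) / \<gamma>"
        using \<gamma>1 by (simp add: field_simps)
      then show "sqrt (\<gamma> / pi) * sqrt (pi / (\<beta> + d i)) = sqrt (1 / ((d i + 1/2) - (d i - 1/2) * x))"
        unfolding real_sqrt_mult[symmetric] by simp
    qed
    finally show ?thesis .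
  qed
  ultimately show ?thesis by simp
qed

section \<open>The distribution of the total number\<close>

lemma prod_list_upt: "prod_list (map f [1..<Suc n]) = (\<Prod>j=1..n. f j)"
  for f :: "nat \<Rightarrow> 'a::comm_monoid_mult"
  by (simp add: prod.distinct_set_conv_list[symmetric] atLeastLessThanSuc_atLeastAtMost del: upt_Suc)

lemma sum_list_upt: "sum_list (map f [1..<Suc n]) = (\<Sum>j=1..n. f j)"
  for f :: "nat \<Rightarrow> 'a::comm_monoid_add"
  by (simp add: sum.distinct_set_conv_list[symmetric] atLeastLessThanSuc_atLeastAtMost del: upt_Suc)

text \<open>The index is the exponent of the generating function, so dividing it by \<open>k\<close>
  in every factor yields a k-th convolution root.\<close>

lemma inf_divisible_conv_nb_pmf:
  assumes s: "0 < s" and \<alpha>: "\<And>j. j \<in> set js \<Longrightarrow> 0 \<le> \<alpha> j \<and> \<alpha> j < 1"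
  shows "inf_divisible (conv_list (map (\<lambda>j. nb_pmf s (\<alpha> j)) js))"
  unfolding inf_divisible_def
proof (intro allI impI exI)
  fix k :: nat assume k: "1 \<le> k"
  show "conv_list (map (\<lambda>j. nb_pmf s (\<alpha> j)) js) =
    conv_list (replicate k (conv_list (map (\<lambda>j. nb_pmf (s / real k) (\<alpha> j)) js)))"
  proof (rule pgf_inj)
    fix x :: real assume x: "0 < x" "x < 1"
    have "pgf (nb_pmf s (\<alpha> j)) x = pgf (nb_pmf (s / real k) (\<alpha> j)) x ^ k" if j: "j \<in> set js" for j
    proof -
      have le: "\<alpha> j * x \<le> \<alpha> j * 1" using \<alpha>[OF j] x by (intro mult_left_mono) auto
      then have "0 < (1 - \<alpha> j) / (1 - \<alpha> j * x)" using \<alpha>[OF j] by simp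
      moreover have "\<alpha> j \<noteq> 1" "\<alpha> j * x \<noteq> 1" using \<alpha>[OF j] le by auto
      ultimately have "(((1 - \<alpha> j) / (1 - \<alpha> j * x)) powr (s / real k)) ^ k = ((1 - \<alpha> j) / (1 - \<alpha> j * x)) powr s"
        using k by (subst powr_realpow[symmetric]) (simp_all add: powr_powr)
      then show ?thesis using \<alpha>[OF j] s k x by (simp add: pgf_nb_pmf)
    qed
    moreover have "prod_list (map (\<lambda>j. f j ^ k) js) = prod_list (map f js) ^ k" for f :: "'a \<Rightarrow> real"
      by (induction js) (simp_all add: power_mult_distrib)
    ultimately show "pgf (conv_list (map (\<lambda>j. nb_pmf s (\<alpha> j)) js)) x =
      pgf (conv_list (replicate k (conv_list (map (\<lambda>j. nb_pmf (s / real k) (\<alpha> j)) js)))) x"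
      using x by (simp add: pgf_conv_list o_def cong: map_cong)
  qed
qed

theorem mainTheorem6:
  fixes S :: "real ^ ('n::finite + 'n) ^ ('n + 'n)"
    and \<rho> :: "'n fock \<Rightarrow> 'n fock"
    and lam \<alpha> :: "nat \<Rightarrow> real"
  assumes gaussian: "is_gaussian_state 0 0 S \<rho>"
    and eigenvalues: "ordered_eigenvalues S lam"
    and alpha: "\<And>j. j \<in> {1..2 * CARD('n)} \<Longrightarrow> \<alpha> j = (lam j - 1/2) / (lam j + 1/2)"
    and alpha_nonneg: "\<And>j. j \<in> {1..2 * CARD('n)} \<Longrightarrow> 0 \<le> \<alpha> j"
  shows "(\<exists>p. is_number_distribution \<rho> p \<and>
            (\<forall>x\<in>{0..<1}. pgf p x =
               (\<Prod>j=1..2 * CARD('n). ((1 - \<alpha> j) / (1 - \<alpha> j * x)) powr (1/2))) \<and>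
            (\<exists>q. (\<forall>j\<in>{1..2 * CARD('n)}. is_neg_binomial_half (\<alpha> j) (q j)) \<and>
                 p = conv_list (map q [1..<2 * CARD('n) + 1])) \<and>
            inf_divisible p \<and>
            integrable (measure_pmf p) (\<lambda>k. (real k)\<^sup>2) \<and>
            measure_pmf.variance p real - measure_pmf.expectation p real =
              1/2 * trace ((S - mat (1/2)) ** (S - mat (1/2)))) \<and>
         0 \<le> 1/2 * trace ((S - mat (1/2)) ** (S - mat (1/2)))"
proof -
  let ?N = "2 * CARD('n)"
  have card: "CARD('n + 'n) = ?N"
    by (simp add: card_Plus[where A = UNIV and B = UNIV, unfolded UNIV_Plus_UNIV])
  have symS: "transpose S = S" and st: "is_state \<rho>" and psd: "\<And>x. 0 \<le> x \<bullet> (S *v x)"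
    using gaussian gaussian_covariance_nonneg by (auto simp: is_gaussian_state_def)
  obtain Q d where Q: "orthogonal_matrix Q" "S = Q ** diag_mat d ** transpose Q"
    and lam: "image_mset d (mset_set UNIV) = image_mset lam (mset_set {1..?N})"
    using ordered_eigenvalues_diagonalize[OF symS eigenvalues] unfolding card .
  \<comment> \<open>The form of \<open>S\<close> is tested at the i-th column of \<open>Q\<close>, a
    unit eigenvector.\<close>
  have d: "0 \<le> d i" for i
  proof -
    have "transpose Q *v (Q *v axis i 1) = axis i 1"
      using Q(1) by (simp only: matrix_vector_mul_assoc orthogonal_matrix_def matrix_vector_mul_lid)
    then have "(Q *v axis i 1) \<bullet> (S *v (Q *v axis i 1)) = (\<Sum>j\<in>UNIV. d j * (axis i 1 $ j)\<^sup>2)"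
      unfolding Q(2) inner_orthogonal_conj by simp
    also have "\<dots> = (\<Sum>j\<in>UNIV. if j = i then d j else 0)"
      by (intro sum.cong) (auto simp: axis_def)
    finally show ?thesis using psd[of "Q *v axis i 1"] by simp
  qed
  \<comment> \<open>Eigenvalues are nonnegative, so the denominator in \<open>alpha\<close> is
    positive and \<open>0 \<le> \<alpha> j\<close> says that the numerator is nonnegative, that is
    \<open>1/2 \<le> lam j\<close>.\<close>
  have \<alpha>: "1/2 \<le> lam j" "1 - \<alpha> j = 1 / (lam j + 1/2)" "\<alpha> j / (1 - \<alpha> j) = lam j - 1/2" "0 \<le> \<alpha> j" "\<alpha> j < 1"
    if j: "j \<in> {1..?N}" for j
  proof -
    have "lam j \<in># image_mset d (mset_set UNIV)" unfolding lam using j by simp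
    then have nn: "0 \<le> lam j" using d by auto
    then have pos: "0 < lam j + 1/2" by simp
    show half: "1/2 \<le> lam j"
      using alpha_nonneg[OF j] pos unfolding alpha[OF j] by (simp add: zero_le_divide_iff)
    show one: "1 - \<alpha> j = 1 / (lam j + 1/2)"
      unfolding alpha[OF j] using pos by (simp add: field_simps)
    show "\<alpha> j / (1 - \<alpha> j) = lam j - 1/2"
    proof -
      have "\<alpha> j * (lam j + 1/2) = lam j - 1/2" unfolding alpha[OF j] using pos by simp
      then show ?thesis unfolding one by simp
    qed
    show "0 \<le> \<alpha> j" by (rule alpha_nonneg[OF j])
    have "0 < 1 / (lam j + 1/2)" using pos by simp
    then show "\<alpha> j < 1" using one by linarith
  qed
  have tr: "trace ((S - mat (1/2)) ** (S - mat (1/2))) = (\<Sum>j=1..?N. (lam j - 1/2)\<^sup>2)"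
  proof -
    have "S - mat (1/2) = Q ** diag_mat (\<lambda>i. d i - 1/2) ** transpose Q"
      unfolding Q(2) by (rule orthogonal_conj_diff_mat[OF Q(1)])
    then have "trace ((S - mat (1/2)) ** (S - mat (1/2))) = (\<Sum>i\<in>UNIV. (d i - 1/2)\<^sup>2)"
      by (rule trace_sq_orthogonal_conj[OF Q(1)])
    \<comment> \<open>The sum depends only on the multiset of diagonal entries, which is that of the
      ordered eigenvalues.\<close>
    also have "\<dots> = sum_mset (image_mset (\<lambda>t. (t - 1/2)\<^sup>2) (image_mset d (mset_set UNIV)))"
      by (simp add: sum_unfold_sum_mset image_mset.compositionality o_def)
    also have "\<dots> = (\<Sum>j=1..?N. (lam j - 1/2)\<^sup>2)"
      unfolding lam by (simp add: sum_unfold_sum_mset image_mset.compositionality o_def)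
    finally show ?thesis .
  qed
  define q where "q j = nb_pmf (1/2) (\<alpha> j)" for j
  define p where "p = conv_list (map q [1..<?N + 1])"
  have js: "j \<in> {1..?N}" if "j \<in> set [1..<?N + 1]" for j using that by auto
  have pgf_p: "pgf p x = (\<Prod>j=1..?N. ((1 - \<alpha> j) / (1 - \<alpha> j * x)) powr (1/2))" if "0 \<le> x" "x < 1" for x
  proof -
    have "pgf p x = (\<Prod>j=1..?N. pgf (q j) x)"
      using that unfolding p_def by (simp add: pgf_conv_list o_def prod_list_upt[unfolded One_nat_def] del: upt_Suc)
    then show ?thesis
      using \<alpha> that by (simp add: q_def pgf_nb_pmf cong: prod.cong_simp)
  qed
  have nbh: "is_neg_binomial_half (\<alpha> j) (q j)" if "j \<in> {1..?N}" for j
    using \<alpha>[OF that] by (simp add: is_neg_binomial_half_def q_def pgf_nb_pmf)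
  \<comment> \<open>Equality of the two series on (0,1) identifies each probability, so the traces
    against the number projections form the probability distribution \<open>p\<close>.\<close>
  have "number_probability \<rho> k = pmf p k" for k
  proof (rule powser_eq_coeffs)
    fix x :: real assume x: "0 < x" "x < 1"
    show "(\<lambda>k. pmf p k * x ^ k) sums pgf p x" using x by (intro pgf_sums) simp_all
    let ?h = "\<lambda>t. sqrt (1 / ((t + 1/2) - (t - 1/2) * x))"
    have "(\<Prod>i\<in>UNIV. ?h (d i)) = prod_mset (image_mset ?h (image_mset d (mset_set UNIV)))"
      by (simp add: prod_unfold_prod_mset image_mset.compositionality o_def)
    also have "\<dots> = (\<Prod>j=1..?N. ?h (lam j))"
      unfolding lam by (simp add: prod_unfold_prod_mset image_mset.compositionality o_def)
    also have "\<dots> = pgf p x"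
    proof -
      have "?h (lam j) = ((1 - \<alpha> j) / (1 - \<alpha> j * x)) powr (1/2)" if j: "j \<in> {1..?N}" for j
      proof -
        have pos: "0 < lam j + 1/2" using \<alpha>(1)[OF j] by simp
        have "1 - \<alpha> j * x = ((lam j + 1/2) - (lam j - 1/2) * x) / (lam j + 1/2)"
          unfolding alpha[OF j] using pos by (simp add: field_simps)
        then have "(1 - \<alpha> j) / (1 - \<alpha> j * x) = 1 / ((lam j + 1/2) - (lam j - 1/2) * x)"
          unfolding \<alpha>(2)[OF j] using pos by simp
        \<comment> \<open>Keeps the denominator positive, so that the power 1/2 is the real square
          root.\<close>
        moreover have "(lam j - 1/2) * x \<le> (lam j - 1/2) * 1"
          using \<alpha>(1)[OF j] x by (intro mult_left_mono) auto
        ultimately show ?thesis by (simp add: powr_half_sqrt)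
      qed
      then show ?thesis using pgf_p[of x] x by simp
    qed
    finally show "(\<lambda>k. number_probability \<rho> k * x ^ k) sums pgf p x"
      using number_generating_function[OF gaussian Q d, of x] x by simp
  qed
  then have "is_number_distribution \<rho> p"
    using has_trace_number_probability[OF st] by (simp add: is_number_distribution_def)
  moreover have "inf_divisible p"
    unfolding p_def q_def by (rule inf_divisible_conv_nb_pmf) (use \<alpha>(4,5) js in auto)
  \<comment> \<open>Each factor of index 1/2 has excess \<open>1/2 * (lam j - 1/2)\<^sup>2\<close>,
    and these add up to half the trace of the square.\<close>
  moreover have mom: "moments p (\<Sum>j=1..?N. 1/2 * (\<alpha> j / (1 - \<alpha> j))) (1/2 * trace ((S - mat (1/2)) ** (S - mat (1/2))))"
  proof -
    have "moments p (sum_list (map (\<lambda>j. 1/2 * (\<alpha> j / (1 - \<alpha> j))) [1..<?N + 1]))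
       (sum_list (map (\<lambda>j. 1/2 * (\<alpha> j / (1 - \<alpha> j))\<^sup>2) [1..<?N + 1]))"
      unfolding p_def q_def by (intro moments_conv_list moments_nb_pmf \<alpha>(4,5) js) simp_all
    moreover have "(\<Sum>j=1..?N. 1/2 * (\<alpha> j / (1 - \<alpha> j))\<^sup>2) = 1/2 * trace ((S - mat (1/2)) ** (S - mat (1/2)))"
      unfolding tr sum_distrib_left by (intro sum.cong refl) (simp only: \<alpha>(3))
    ultimately show ?thesis
      unfolding Suc_eq_plus1[symmetric] sum_list_upt by (simp only:)
  qed
  moreover have "0 \<le> trace ((S - mat (1/2)) ** (S - mat (1/2)))"
    unfolding tr by (intro sum_nonneg) simp
  ultimately show ?thesis
    using pgf_p nbh moments_variance[OF mom] by (auto simp: p_def intro!: exI[of _ p] exI[of _ q])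
qed

end
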